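(* Let $X$ be a compact metric space and let $\Phi=\{T_0,\dots,T_{\ell-1}\}$ be an iterated function system of expanding type on $X$ (conditions (A1)–(A3) in the context). Let $\Sigma=\{0,\dots,\ell-1\}^{\mathbb Z}$ with left shift $\sigma$, and let $\mathbb P$ be an ergodic $\sigma$-invariant Borel probability measure on $\Sigma$. Let $T:\Sigma\times X\to\Sigma\times X$, $T(\underline\omega,x)=(\sigma\underline\omega,T_{\omega_0}x)$, be the associated skew product, and let $\{\lambda_{\underline\omega}\}_{\underline\omega\in\Sigma}$ be the eigenvalues of the fiberwise (zero-potential) transfer operators, as defined in the context. Then $$h_{\mathrm{top}}(T)=\int_\Sigma\log\lambda_{\underline\omega}\,d\mathbb P(\underline\omega)=\sup\Big\{h_m(T)\;:\;m\in\mathcal M(\Sigma\times X,T),\ \pi_*m=\mathbb P\Big\},$$ where $h_{\mathrm{top}}(T)$ is the relative topological entropy of $T$ over $\mathbb P$, $h_m(T)$ is the relative (fiber) metric entropy of $m$ over $\mathbb P$, and $\pi:\Sigma\times X\to\Sigma$ is the projection $\pi(\underline\omega,x)=\underline\omega$.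
   Context: Setting. $(X,d_X)$ is a compact metric space and $T_0,\dots,T_{\ell-1}:X\to X$ are continuous surjective maps. $\Sigma=\{0,\dots,\ell-1\}^{\mathbb Z}$ is the full two-sided shift space with its usual compact metric, and $\sigma$ is the left shift. For $\underline\omega\in\Sigma$, $X_{\underline\omega}=\{\underline\omega\}\times X$ is identified with $X$, and $T_{\underline\omega}^n=T_{\omega_{n-1}}\circ\cdots\circ T_{\omega_0}:X_{\underline\omega}\to X_{\sigma^n\underline\omega}$, with $T^0_{\underline\omega}=\mathrm{id}$. $B(x,\epsilon)$ is the open ball in $X$. Expanding type. $\Phi$ is of expanding type if: (A1) there is $D\in\mathbb N$ with $\#T_{\omega_0}^{-1}(z)\le D$ for every $\underline\omega\in\Sigma$ and $z\in X$; (A2) there are $\delta>0$ and $\rho\in(0,1)$ such that for every $\underline\omega\in\Sigma$ and all $x,x'\in X$ with $d_X(x,x')\le\delta$ one has $d_X(x,x')\le\rho\,d_X(T_{\omega_0}x,T_{\omega_0}x')$, and moreover $T_{\omega_0}(B(x,\delta))\supset B(T_{\omega_0}x,\delta)$ for every $x\in X$; (A3) for every $\epsilon>0$ there is $N=N(\epsilon)\in\mathbb N$ such that $T_{\underline\omega}^n(B(x,\epsilon))=X$ for every $\underline\omega\in\Sigma$, $x\in X$ and $n\ge N$. Transfer operators and eigenvalues. For $\underline\omega\in\Sigma$ let $L_{\underline\omega}:C(X_{\underline\omega})\to C(X_{\sigma\underline\omega})$, $(L_{\underline\omega}\psi)(z)=\sum_{y:\,T_{\omega_0}(y)=z}\psi(y)$,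 with dual $L_{\underline\omega}^*$ on measures given by $\int\psi\,d(L_{\underline\omega}^*\eta)=\int L_{\underline\omega}\psi\,d\eta$. By a known nonstationary Ruelle–Perron–Frobenius theorem, if $\Phi$ is of expanding type then, for every $\underline\omega\in\Sigma$, there are uniquely determined positive reals $\{\lambda_{\sigma^n\underline\omega}\}_{n\in\mathbb Z}$ and Borel probability measures $\{\nu_{\sigma^n\underline\omega}\}_{n\in\mathbb Z}$ on the fibers $X_{\sigma^n\underline\omega}$ with $$L_{\sigma^n\underline\omega}^*\nu_{\sigma^{n+1}\underline\omega}=\lambda_{\sigma^n\underline\omega}\nu_{\sigma^n\underline\omega}\quad(n\in\mathbb Z).$$ These are the $\lambda_{\underline\omega}$. The same theorem provides a unique family of strictly positive functions $h_{\sigma^n\underline\omega}$ with $\int h_{\sigma^n\underline\omega}\,d\nu_{\sigma^n\underline\omega}=1$ and $L_{\sigma^n\underline\omega}h_{\sigma^n\underline\omega}=\lambda_{\sigma^n\underline\omega}h_{\sigma^{n+1}\underline\omega}$, bounded between $C^{-1}$ and $C$ for a constant $C>1$ independent of $\underline\omega$, $n$ and the point, and the probability measures $\mu_{\sigma^n\underline\omega}=h_{\sigma^n\underline\omega}\nu_{\sigma^n\underline\omega}$ satisfy $(T_{\omega_n})_*\mu_{\sigma^n\underline\omega}=\mu_{\sigma^{n+1}\underline\omega}$. Relative topological entropy. For $x,y\in X_{\underline\omega}$ put $d_{\underline\omega}^n(x,y)=\max_{0\le k<n}d_X(T_{\underline\omega}^kx,T_{\underline\omega}^ky)$. A set $E\subset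 X_{\underline\omega}$ is $(\underline\omega,n,\epsilon)$-separated if $d_{\underline\omega}^n(x,y)>\epsilon$ for all distinct $x,y\in E$; $s(\underline\omega,n,\epsilon)$ is the largest cardinality of such a set. Then $$h_{\mathrm{top}}(T)=\lim_{\epsilon\to0}\limsup_{n\to\infty}\frac1n\int_\Sigma\log s(\underline\omega,n,\epsilon)\,d\mathbb P(\underline\omega).$$ Relative metric entropy. $\mathcal M(\Sigma\times X,T)$ is the set of $T$-invariant Borel probability measures on $\Sigma\times X$. If $m\in\mathcal M(\Sigma\times X,T)$ and $\pi_*m=\mathbb P$, let $m=\int_\Sigma m_{\underline\omega}\,d\mathbb P(\underline\omega)$ be its disintegration over $\mathbb P$ into probability measures on the fibers. For a finite measurable partition $\xi$ of $X$ let $\xi_{\underline\omega}^n=\bigvee_{k=0}^{n-1}(T_{\underline\omega}^k)^{-1}\xi$, let $H_\nu(\xi)=-\sum_{A\in\xi}\nu(A)\log\nu(A)$, and set $$h_m(T,\xi)=\lim_{n\to\infty}\frac1n\int_\Sigma H_{m_{\underline\omega}}(\xi_{\underline\omega}^n)\,d\mathbb P(\underline\omega),\qquad h_m(T)=\sup_\xi h_m(T,\xi),$$ the supremum being over finite measurable partitions $\xi$ of $X$. *)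

theory Defs
  imports "HOL-Probability.Probability"
begin

text \<open>
  The topology on \<^typ>\<open>int \<Rightarrow> nat\<close> is the product of the discrete topologies, so restricting
  \<^const>\<open>borel\<close> to \<open>full_shift l\<close> yields the Borel sets of the compact shift space.
\<close>

definition full_shift :: "nat \<Rightarrow> (int \<Rightarrow> nat) set" where
  "full_shift l = {\<omega>. \<forall>i. \<omega> i < l}"

definition shift :: "(int \<Rightarrow> nat) \<Rightarrow> (int \<Rightarrow> nat)" where
  "shift \<omega> = (\<lambda>i. \<omega> (i + 1))"

definition shift_pow :: "int \<Rightarrow> (int \<Rightarrow> nat) \<Rightarrow> (int \<Rightarrow> nat)" where
  "shift_pow n \<omega> = (\<lambda>i. \<omega> (i + n))"

text \<open>The fibre over each \<open>\<omega>\<close> is identified with the whole type \<^typ>\<open>'a\<close>.\<close>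

primrec fiber_iter :: "(nat \<Rightarrow> 'a \<Rightarrow> 'a) \<Rightarrow> (int \<Rightarrow> nat) \<Rightarrow> nat \<Rightarrow> 'a \<Rightarrow> 'a" where
  "fiber_iter T \<omega> 0 = id"
| "fiber_iter T \<omega> (Suc n) = T (\<omega> (int n)) \<circ> fiber_iter T \<omega> n"

definition skew :: "(nat \<Rightarrow> 'a \<Rightarrow> 'a) \<Rightarrow> (int \<Rightarrow> nat) \<times> 'a \<Rightarrow> (int \<Rightarrow> nat) \<times> 'a" where
  "skew T = (\<lambda>(\<omega>, x). (shift \<omega>, T (\<omega> 0) x))"

definition expanding_type :: "nat \<Rightarrow> (nat \<Rightarrow> 'a::metric_space \<Rightarrow> 'a) \<Rightarrow> bool" where
  "expanding_type l T \<longleftrightarrow>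
     (\<exists>D::nat. \<forall>\<omega>\<in>full_shift l. \<forall>z.
        finite (T (\<omega> 0) -` {z}) \<and> card (T (\<omega> 0) -` {z}) \<le> D) \<and>
     (\<exists>\<delta>>0. \<exists>\<rho>. 0 < \<rho> \<and> \<rho> < 1 \<and> (\<forall>\<omega>\<in>full_shift l.
        (\<forall>x x'. dist x x' \<le> \<delta> \<longrightarrow> dist x x' \<le> \<rho> * dist (T (\<omega> 0) x) (T (\<omega> 0) x')) \<and>
        (\<forall>x. ball (T (\<omega> 0) x) \<delta> \<subseteq> T (\<omega> 0) ` ball x \<delta>))) \<and>
     (\<forall>\<epsilon>>0. \<exists>N. \<forall>\<omega>\<in>full_shift l. \<forall>x. \<forall>n\<ge>N. fiber_iter T \<omega> n ` ball x \<epsilon> = UNIV)"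

definition ergodic_shift_measure :: "nat \<Rightarrow> (int \<Rightarrow> nat) measure \<Rightarrow> bool" where
  "ergodic_shift_measure l P \<longleftrightarrow>
     sets P = sets (restrict_space borel (full_shift l)) \<and>
     prob_space P \<and>
     distr P P shift = P \<and>
     (\<forall>A\<in>sets P. shift -` A \<inter> space P = A \<longrightarrow> measure P A = 0 \<or> measure P A = 1)"

definition transfer :: "(nat \<Rightarrow> 'a \<Rightarrow> 'a) \<Rightarrow> (int \<Rightarrow> nat) \<Rightarrow> ('a \<Rightarrow> real) \<Rightarrow> 'a \<Rightarrow> real" where
  "transfer T \<omega> \<psi> z = (\<Sum>y\<in>T (\<omega> 0) -` {z}. \<psi> y)"

text \<open>
  \<open>dual_eq T \<omega> \<eta> c \<nu>\<close> says that the dual of the transfer operator at \<open>\<omega>\<close> maps \<open>\<eta>\<close> to \<open>c \<cdot> \<nu>\<close>;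
  measures are compared by integrating continuous functions, as in the definition of the dual.
\<close>

definition dual_eq ::
  "(nat \<Rightarrow> 'a::topological_space \<Rightarrow> 'a) \<Rightarrow> (int \<Rightarrow> nat) \<Rightarrow> 'a measure \<Rightarrow> real \<Rightarrow> 'a measure \<Rightarrow> bool" where
  "dual_eq T \<omega> \<eta> c \<nu> \<longleftrightarrow>
     (\<forall>\<psi>::'a \<Rightarrow> real. continuous_on UNIV \<psi> \<longrightarrow>
        (\<integral>x. transfer T \<omega> \<psi> x \<partial>\<eta>) = c * (\<integral>x. \<psi> x \<partial>\<nu>))"

definition eigen_system ::
  "(nat \<Rightarrow> 'a::topological_space \<Rightarrow> 'a) \<Rightarrow> (int \<Rightarrow> nat) \<Rightarrow> (int \<Rightarrow> real) \<Rightarrow> (int \<Rightarrow> 'a measure) \<Rightarrow> bool" where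
  "eigen_system T \<omega> lam \<nu> \<longleftrightarrow>
     (\<forall>n. lam n > 0 \<and> prob_space (\<nu> n) \<and> sets (\<nu> n) = sets borel \<and>
          dual_eq T (shift_pow n \<omega>) (\<nu> (n + 1)) (lam n) (\<nu> n))"

text \<open>
  Well-defined for systems of expanding type: the nonstationary Ruelle--Perron--Frobenius theorem
  gives existence and uniqueness of the eigen system along the orbit of \<open>\<omega>\<close>.
\<close>

definition eigenvalue :: "(nat \<Rightarrow> 'a::topological_space \<Rightarrow> 'a) \<Rightarrow> (int \<Rightarrow> nat) \<Rightarrow> real" where
  "eigenvalue T \<omega> = (THE c. \<exists>lam \<nu>. eigen_system T \<omega> lam \<nu> \<and> c = lam 0)"

text \<open>The case \<open>n = 0\<close> (maximum over the empty set) is irrelevant for the limits below.\<close>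

definition fiber_dist ::
  "(nat \<Rightarrow> 'a::metric_space \<Rightarrow> 'a) \<Rightarrow> (int \<Rightarrow> nat) \<Rightarrow> nat \<Rightarrow> 'a \<Rightarrow> 'a \<Rightarrow> real" where
  "fiber_dist T \<omega> n x y = Max ((\<lambda>k. dist (fiber_iter T \<omega> k x) (fiber_iter T \<omega> k y)) ` {..<n})"

definition separated ::
  "(nat \<Rightarrow> 'a::metric_space \<Rightarrow> 'a) \<Rightarrow> (int \<Rightarrow> nat) \<Rightarrow> nat \<Rightarrow> real \<Rightarrow> 'a set \<Rightarrow> bool" where
  "separated T \<omega> n \<epsilon> E \<longleftrightarrow> (\<forall>x\<in>E. \<forall>y\<in>E. x \<noteq> y \<longrightarrow> fiber_dist T \<omega> n x y > \<epsilon>)"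

definition max_separated ::
  "(nat \<Rightarrow> 'a::metric_space \<Rightarrow> 'a) \<Rightarrow> (int \<Rightarrow> nat) \<Rightarrow> nat \<Rightarrow> real \<Rightarrow> nat" where
  "max_separated T \<omega> n \<epsilon> = Max {card E | E. finite E \<and> separated T \<omega> n \<epsilon> E}"

definition rel_top_entropy ::
  "(int \<Rightarrow> nat) measure \<Rightarrow> (nat \<Rightarrow> 'a::metric_space \<Rightarrow> 'a) \<Rightarrow> ereal" where
  "rel_top_entropy P T =
     Lim (at_right 0) (\<lambda>\<epsilon>::real.
       limsup (\<lambda>n. ereal (1 / real n * (\<integral>\<omega>. ln (real (max_separated T \<omega> n \<epsilon>)) \<partial>P))))"

definition invariant_measures ::
  "nat \<Rightarrow> (nat \<Rightarrow> 'a::topological_space \<Rightarrow> 'a) \<Rightarrow> ((int \<Rightarrow> nat) \<times> 'a) measure set" where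
  "invariant_measures l T =
     {m. sets m = sets (restrict_space borel (full_shift l \<times> UNIV)) \<and>
         prob_space m \<and> distr m m (skew T) = m}"

definition is_disintegration ::
  "(int \<Rightarrow> nat) measure \<Rightarrow> ((int \<Rightarrow> nat) \<times> 'a::topological_space) measure \<Rightarrow>
   ((int \<Rightarrow> nat) \<Rightarrow> 'a measure) \<Rightarrow> bool" where
  "is_disintegration P m \<kappa> \<longleftrightarrow>
     \<kappa> \<in> measurable P (prob_algebra borel) \<and>
     (\<forall>A\<in>sets m. emeasure m A = (\<integral>\<^sup>+\<omega>. emeasure (\<kappa> \<omega>) {x. (\<omega>, x) \<in> A} \<partial>P))"

text \<open>The choice is immaterial below: any two disintegrations agree for \<open>P\<close>-almost every \<open>\<omega>\<close>.\<close>

definition disintegration ::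
  "(int \<Rightarrow> nat) measure \<Rightarrow> ((int \<Rightarrow> nat) \<times> 'a::topological_space) measure \<Rightarrow>
   (int \<Rightarrow> nat) \<Rightarrow> 'a measure" where
  "disintegration P m = (SOME \<kappa>. is_disintegration P m \<kappa>)"

definition finite_partition :: "'a::topological_space set set \<Rightarrow> bool" where
  "finite_partition \<xi> \<longleftrightarrow> finite \<xi> \<and> \<xi> \<subseteq> sets borel \<and> partition_on UNIV \<xi>"

text \<open>The join may contain the empty set, which contributes nothing to the entropy.\<close>

definition fiber_join ::
  "(nat \<Rightarrow> 'a \<Rightarrow> 'a) \<Rightarrow> 'a set set \<Rightarrow> (int \<Rightarrow> nat) \<Rightarrow> nat \<Rightarrow> 'a set set" where
  "fiber_join T \<xi> \<omega> n = {\<Inter>k<n. fiber_iter T \<omega> k -` A k | A. \<forall>k<n. A k \<in> \<xi>}"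

definition partition_entropy :: "'a measure \<Rightarrow> 'a set set \<Rightarrow> real" where
  "partition_entropy \<nu> \<xi> = - (\<Sum>A\<in>\<xi>. measure \<nu> A * ln (measure \<nu> A))"

definition rel_entropy_partition ::
  "(int \<Rightarrow> nat) measure \<Rightarrow> (nat \<Rightarrow> 'a::topological_space \<Rightarrow> 'a) \<Rightarrow>
   ((int \<Rightarrow> nat) \<times> 'a) measure \<Rightarrow> 'a set set \<Rightarrow> real" where
  "rel_entropy_partition P T m \<xi> =
     lim (\<lambda>n. 1 / real n *
       (\<integral>\<omega>. partition_entropy (disintegration P m \<omega>) (fiber_join T \<xi> \<omega> n) \<partial>P))"

definition rel_entropy ::
  "(int \<Rightarrow> nat) measure \<Rightarrow> (nat \<Rightarrow> 'a::topological_space \<Rightarrow> 'a) \<Rightarrow>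
   ((int \<Rightarrow> nat) \<times> 'a) measure \<Rightarrow> ereal" where
  "rel_entropy P T m = (SUP \<xi>\<in>Collect finite_partition. ereal (rel_entropy_partition P T m \<xi>))"

end

theory Submission
  imports Defs
begin

text \<open>
  Write \<open>N\<^sub>n(\<omega>, z)\<close> for the number of preimages of \<open>z\<close> under \<open>n\<close> steps of the fibre maps. Inverse
  branches make \<open>N\<^sub>n(\<omega>, \<cdot>)\<close> locally constant at a uniform scale, and the covering property then
  makes it constant up to a uniform factor. For the same reason averages over the preimages of \<open>z\<close>
  lose their dependence on \<open>z\<close> exponentially fast; their limits are the fibre measures \<open>\<nu>\<^sub>\<omega>\<close>, and
  \<open>\<lambda>\<^sub>\<omega> \<lambda>\<^sub>\<sigma>\<^sub>\<omega> \<cdots>\<close> (\<open>n\<close> factors) is comparable to \<open>N\<^sub>n(\<omega>, z)\<close>.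

  Preimages of a single point are separated, while pulling back a finite net produces a shadowing set,
  so \<open>N\<^sub>n\<close> also counts separated sets and gives the topological entropy. The measure
  \<open>h\<^sub>\<omega> \<nu>\<^sub>\<omega>\<close> gives mass at most a constant over \<open>N\<^sub>n\<close> to every set that stays small for \<open>n\<close> steps, so its
  entropy is at least \<open>\<integral> log \<lambda>\<close>. For an arbitrary invariant measure and partition, Gibbs' inequality is
  applied to the random itinerary obtained by choosing a point of the shadowing set uniformly and
  reading off its itinerary with a small error probability per symbol; the cost of the errors is
  controlled by inner regularity of the partition elements.
\<close>

section \<open>Measures on compact metric spaces\<close>

text \<open>Three obstacles shape the argument. The definitions select objects by \<open>THE\<close>
  and \<open>SOME\<close>: an eigenvalue has a meaning only once the eigen system is known to be
  unique, and a disintegration is determined only up to null sets. Fibrewise identities are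
  therefore proved for countable families of sets, whose exceptional null sets can be discarded
  together. Measurability in \<open>\<omega>\<close> is not visible from the constructions, since
  densities look into the whole past and fibre measures into the whole future. Everything is written
  as a limit of expressions that read finitely many symbols. In the upper bound for metric entropy
  the cells of a partition may touch everywhere, so a shadowing orbit does not determine the symbols
  of the shadowed one. A crude comparison costs a fixed amount per step; passing to powers of the
  system is the classical way to remove it. Here the cost per symbol is made small directly: the
  error probability is fixed before the closed cores of the cells, and these before the net, so that
  each choice can absorb the constant produced by the preceding one.\<close>

lemma finite_ball_cover:
  assumes "compact (UNIV :: 'a::metric_space set)" "0 < e"
  shows "\<exists>F::'a set. finite F \<and> (\<Union>x\<in>F. ball x e) = UNIV"
proof -
  have "UNIV \<subseteq> (\<Union>x::'a. ball x e)" using assms(2) by auto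
  from compactE_image[OF assms(1) _ this] show ?thesis by (metis open_ball top.extremum_uniqueI)
qed

text \<open>Cantor-set digits: the first differing digit contributes
  \<open>2 * (1/3) ^ Suc k\<close>, all later ones together at most \<open>(1/3) ^ Suc k\<close>.
  Base three rather than two leaves a gap, so codes that are close must share their leading
  digits.\<close>

lemma ternary_gap:
  fixes b c :: "nat \<Rightarrow> real"
  assumes b: "\<And>j. b j \<in> {0, 1}" and c: "\<And>j. c j \<in> {0, 1}"
    and eq: "\<And>j. j < k \<Longrightarrow> b j = c j" and neq: "b k \<noteq> c k"
  shows "(1/3) ^ Suc k \<le> \<bar>(\<Sum>j. 2/3 * (1/3) ^ j * b j) - (\<Sum>j. 2/3 * (1/3) ^ j * c j)\<bar>"
proof -
  let ?w = "\<lambda>j::nat. 2/3 * (1/3::real) ^ j"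
  let ?d = "\<lambda>j. ?w j * (b j - c j)"
  have wsum: "summable ?w"
    by (intro summable_mult summable_geometric) auto
  have bs: "summable (\<lambda>j. ?w j * b j)" and cs: "summable (\<lambda>j. ?w j * c j)"
  proof -
    have "summable (\<lambda>j. ?w j * f j)" if "\<And>j. f j \<in> {0, 1}" for f :: "nat \<Rightarrow> real"
      by (rule summable_comparison_test'[OF wsum, of 0]) (use that in \<open>auto simp: abs_mult\<close>, metis abs_0 abs_1 insertE le_numeral_extra(4) singletonD that zero_le_one)
    from this[OF b] this[OF c] show "summable (\<lambda>j. ?w j * b j)" "summable (\<lambda>j. ?w j * c j)" .
  qed
  have dle: "\<bar>?d j\<bar> \<le> ?w j" for j
    using b[of j] c[of j] by auto
  have ds: "summable ?d"
    by (rule summable_comparison_test'[OF wsum, of 0]) (use dle in auto)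
  have "(\<Sum>j. ?w j * b j) - (\<Sum>j. ?w j * c j) = suminf ?d"
    unfolding right_diff_distrib by (rule suminf_diff[OF bs cs])
  also have "\<dots> = (\<Sum>j. ?d (j + Suc k)) + (\<Sum>j<Suc k. ?d j)"
    by (rule suminf_split_initial_segment[OF ds])
  also have "(\<Sum>j<Suc k. ?d j) = ?d k"
    using eq by simp
  finally have e: "(\<Sum>j. ?w j * b j) - (\<Sum>j. ?w j * c j) = (\<Sum>j. ?d (j + Suc k)) + ?d k" .
  have ws: "(\<lambda>j. ?w (j + Suc k)) sums ((1/3) ^ Suc k)"
  proof -
    have "(\<lambda>j. 2/3 * (1/3::real) ^ Suc k * (1/3) ^ j) sums (2/3 * (1/3) ^ Suc k * (1 / (1 - 1/3)))"
      by (intro sums_mult geometric_sums) auto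
    then show ?thesis by (simp add: power_add mult_ac)
  qed
  have "\<bar>\<Sum>j. ?d (j + Suc k)\<bar> \<le> (\<Sum>j. ?w (j + Suc k))"
  proof (rule summable_rabs_comparison_test[THEN summable_rabs[THEN order_trans]])
    show "\<exists>N. \<forall>n\<ge>N. \<bar>?d (n + Suc k)\<bar> \<le> ?w (n + Suc k)"
      using dle by blast
    then have *: "summable (\<lambda>n. \<bar>?d (n + Suc k)\<bar>)"
      using ws[THEN sums_summable] by (rule summable_rabs_comparison_test)
    show "summable (\<lambda>n. ?w (n + Suc k))"
      using ws by (rule sums_summable)
    with * show "(\<Sum>n. \<bar>?d (n + Suc k)\<bar>) \<le> (\<Sum>j. ?w (j + Suc k))"
      by (intro suminf_le dle)
  qed
  then have "\<bar>\<Sum>j. ?d (j + Suc k)\<bar> \<le> (1/3) ^ Suc k"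
    by (simp only: sums_unique[OF ws, symmetric])
  moreover have "\<bar>?d k\<bar> = 2 * (1/3) ^ Suc k"
    using b[of k] c[of k] neq by auto
  ultimately show ?thesis
    unfolding e by linarith
qed

text \<open>The balls come from finite nets at the scales \<open>1 / Suc k\<close>, listed in one
  sequence. A single net decides distances at its own scale and is finite, so finitely many
  memberships suffice uniformly in the points.\<close>

lemma countable_separating_balls:
  assumes "compact (UNIV :: 'a::metric_space set)"
  obtains U :: "nat \<Rightarrow> 'a::metric_space set" where "\<And>j. open (U j)"
    and "\<And>e. 0 < e \<Longrightarrow> \<exists>J. \<forall>x y. (\<forall>j<J. x \<in> U j \<longleftrightarrow> y \<in> U j) \<longrightarrow> dist x y < e"
proof -
  have "\<exists>F::'a set. finite F \<and> (\<Union>x\<in>F. ball x (1 / real (Suc k))) = UNIV" for k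
    by (rule finite_ball_cover[OF assms]) simp
  then obtain F :: "nat \<Rightarrow> 'a set" where F: "\<And>k. finite (F k)"
    "\<And>k. (\<Union>x\<in>F k. ball x (1 / real (Suc k))) = UNIV"
    by metis
  define \<B> where "\<B> = (\<Union>k. (\<lambda>x. ball x (1 / real (Suc k))) ` F k)"
  have cB: "countable \<B>"
    unfolding \<B>_def using F by (auto intro: countable_finite)
  have neB: "\<B> \<noteq> {}"
    unfolding \<B>_def using F(2)[of 0] by blast
  define U where "U = from_nat_into \<B>"
  show thesis
  proof
    show "open (U j)" for j
      using from_nat_into[OF neB, of j] by (auto simp: U_def \<B>_def)
    fix e :: real assume "0 < e"
    then obtain k where k: "2 / real (Suc k) < e"
      using reals_Archimedean[of "e/2"] by (auto simp: field_simps)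
    have "\<forall>x\<in>F k. \<exists>j. U j = ball x (1 / real (Suc k))"
      using from_nat_into_surj[OF cB] unfolding U_def \<B>_def by blast
    then obtain f where f: "\<And>x. x \<in> F k \<Longrightarrow> U (f x) = ball x (1 / real (Suc k))"
      by metis
    obtain J where J: "\<And>x. x \<in> F k \<Longrightarrow> f x < J"
      using finite_nat_set_iff_bounded[of "f ` F k"] F(1) by auto
    have "dist x y < e" if xy: "\<forall>j<J. x \<in> U j \<longleftrightarrow> y \<in> U j" for x y
    proof -
      obtain z where z: "z \<in> F k" "x \<in> ball z (1 / real (Suc k))"
        using F(2)[of k] by blast
      then have "y \<in> ball z (1 / real (Suc k))"
        using xy J f by metis
      with z have "dist x y < 1 / real (Suc k) + 1 / real (Suc k)"
        by (intro le_less_trans[OF dist_triangle[of x y z]] add_strict_mono) (auto simp: dist_commute)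
      also have "\<dots> < e" using k by (simp add: field_simps)
      finally show ?thesis .
    qed
    then show "\<exists>J. \<forall>x y. (\<forall>j<J. x \<in> U j \<longleftrightarrow> y \<in> U j) \<longrightarrow> dist x y < e" by blast
  qed
qed

text \<open>
  The point of the coding is that it gives access to the measure theory of the real line: a compact
  metric space is not syntactically an instance of the Polish space classes of the library.
\<close>

lemma real_coding:
  assumes comp: "compact (UNIV :: 'a::metric_space set)"
  obtains C :: "real set" and s :: "'a::metric_space \<Rightarrow> real" and g :: "real \<Rightarrow> 'a"
  where "compact C" "C \<subseteq> {0..1}" "s \<in> borel_measurable borel" "\<And>x. s x \<in> C"
    "continuous_on C g" "\<And>x. g (s x) = x" "g \<in> borel_measurable borel"
proof -
  obtain U :: "nat \<Rightarrow> 'a set" where Uo: "\<And>j. open (U j)"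
    and U: "\<And>e. 0 < e \<Longrightarrow> \<exists>J. \<forall>x y. (\<forall>j<J. x \<in> U j \<longleftrightarrow> y \<in> U j) \<longrightarrow> dist x y < e"
    using countable_separating_balls[OF comp] by blast
  \<comment> \<open>Membership in the balls supplies the ternary digits. The code is in general only
    Borel; the continuous direction is its inverse.\<close>
  define s :: "'a \<Rightarrow> real" where "s x = (\<Sum>j. 2/3 * (1/3) ^ j * indicator (U j) x)" for x
  have s_meas: "s \<in> borel_measurable borel"
    unfolding s_def using Uo by (intro borel_measurable_suminf) auto
  have w: "(\<lambda>j. 2/3 * (1/3::real) ^ j) sums 1"
    using sums_mult[OF geometric_sums[of "1/3::real"], of "2/3"] by simp
  have s_sm: "summable (\<lambda>j. 2/3 * (1/3) ^ j * indicator (U j) x :: real)" for x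
    by (rule summable_comparison_test'[OF sums_summable[OF w], of 0]) (auto simp: indicator_def)
  have s01: "s x \<in> {0..1}" for x
  proof -
    have "s x \<le> (\<Sum>j. 2/3 * (1/3) ^ j)"
      unfolding s_def by (intro suminf_le s_sm sums_summable[OF w]) (auto simp: indicator_def)
    moreover have "0 \<le> s x"
      unfolding s_def by (intro suminf_nonneg s_sm) (auto simp: indicator_def)
    ultimately show ?thesis using sums_unique[OF w] by auto
  qed
  \<comment> \<open>Uniform continuity of the inverse: codes closer than \<open>(1/3) ^ J\<close>
    share their first \<open>J\<close> digits.\<close>
  have uc: "\<exists>d>0. \<forall>x y. \<bar>s x - s y\<bar> < d \<longrightarrow> dist x y < e" if e: "0 < e" for e
  proof -
    obtain J where J: "\<And>x y. (\<forall>j<J. x \<in> U j \<longleftrightarrow> y \<in> U j) \<Longrightarrow> dist x y < e"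
      using U[OF e] by blast
    have "dist x y < e" if lt: "\<bar>s x - s y\<bar> < (1/3) ^ J" for x y
    proof (rule J, rule ccontr)
      assume "\<not> (\<forall>j<J. x \<in> U j \<longleftrightarrow> y \<in> U j)"
      then have "\<exists>j. j < J \<and> (x \<in> U j) \<noteq> (y \<in> U j)" by blast
      then obtain k where k: "k < J" "(x \<in> U k) \<noteq> (y \<in> U k)"
        and least: "\<And>j. j < k \<Longrightarrow> \<not> (j < J \<and> (x \<in> U j) \<noteq> (y \<in> U j))"
        using exists_least_iff[of "\<lambda>j. j < J \<and> (x \<in> U j) \<noteq> (y \<in> U j)"] by blast
      have "(1/3) ^ Suc k \<le> \<bar>s x - s y\<bar>"
        unfolding s_def
      proof (rule ternary_gap)
        fix j assume "j < k"
        then show "indicator (U j) x = (indicator (U j) y :: real)"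
          using least[of j] k(1) by (auto simp: indicator_def)
      qed (use k in \<open>auto simp: indicator_def\<close>)
      moreover have "(1/3::real) ^ J \<le> (1/3) ^ Suc k"
        using k(1) by (intro power_decreasing) auto
      ultimately show False using lt by linarith
    qed
    then show ?thesis by (intro exI[of _ "(1/3) ^ J"]) auto
  qed
  define C where "C = closure (range s)"
  have C: "compact C" "C \<subseteq> {0..1}"
  proof -
    show "C \<subseteq> {0..1}"
      unfolding C_def using s01 by (intro closure_minimal) auto
    then show "compact C"
      by (metis C_def closed_closure compact_Icc compact_Int_closed inf.absorb_iff2)
  qed
  \<comment> \<open>The range of \<open>s\<close> need not be closed, so the inverse has to be
    extended to its closure. \<open>R t x\<close> says that \<open>x\<close> is a limit of points
    whose codes tend to \<open>t\<close>; compactness makes \<open>R\<close> total on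
    \<open>C\<close>, and \<open>R_close\<close> makes it a uniformly continuous function
    there.\<close>
  define R where "R t x \<longleftrightarrow> (\<exists>u. (\<lambda>n. s (u n)) \<longlonglongrightarrow> t \<and> u \<longlonglongrightarrow> x)" for t x
  have R_ex: "\<exists>x. R t x" if "t \<in> C" for t
  proof -
    obtain v where "\<forall>n. v n \<in> range s" "v \<longlonglongrightarrow> t"
      using \<open>t \<in> C\<close> unfolding C_def closure_sequential by blast
    then have "\<forall>n. \<exists>x. v n = s x" by blast
    then obtain u where u: "\<And>n. v n = s (u n)" by (auto dest!: choice)
    have "seq_compact (UNIV :: 'a set)"
      using comp by (simp add: compact_eq_seq_compact_metric)
    then obtain x r where "strict_mono r" "(u \<circ> r) \<longlonglongrightarrow> x"
      by (rule seq_compactE[of _ u]) auto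
    moreover have "(\<lambda>n. s ((u \<circ> r) n)) \<longlonglongrightarrow> t"
      using LIMSEQ_subseq_LIMSEQ[OF \<open>v \<longlonglongrightarrow> t\<close> \<open>strict_mono r\<close>] u by (simp add: o_def)
    ultimately show ?thesis unfolding R_def by blast
  qed
  have R_close: "\<exists>d>0. \<forall>t t' x x'. R t x \<longrightarrow> R t' x' \<longrightarrow> \<bar>t - t'\<bar> < d \<longrightarrow> dist x x' \<le> e" if e: "0 < e" for e
  proof -
    obtain d where d: "d > 0" "\<And>x y. \<bar>s x - s y\<bar> < d \<Longrightarrow> dist x y < e"
      using uc[OF e] by blast
    have "dist x x' \<le> e" if RR: "R t x" "R t' x'" "\<bar>t - t'\<bar> < d" for t t' x x'
    proof -
      obtain u u' where u: "(\<lambda>n. s (u n)) \<longlonglongrightarrow> t" "u \<longlonglongrightarrow> x" "(\<lambda>n. s (u' n)) \<longlonglongrightarrow> t'" "u' \<longlonglongrightarrow> x'"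
        using RR unfolding R_def by blast
      have "(\<lambda>n. \<bar>s (u n) - s (u' n)\<bar>) \<longlonglongrightarrow> \<bar>t - t'\<bar>"
        by (intro tendsto_intros u)
      then have "eventually (\<lambda>n. \<bar>s (u n) - s (u' n)\<bar> < d) sequentially"
        using \<open>\<bar>t - t'\<bar> < d\<close> by (rule order_tendstoD)
      then have "eventually (\<lambda>n. dist (u n) (u' n) \<le> e) sequentially"
        by eventually_elim (use d in \<open>auto simp: less_imp_le\<close>)
      then show ?thesis
        by (rule tendsto_upperbound[OF tendsto_dist[OF u(2,4)]]) simp
    qed
    with d show ?thesis by blast
  qed
  \<comment> \<open>A constant value outside the closed set \<open>C\<close> keeps \<open>g\<close>
    Borel on the whole line.\<close>
  define g where "g t = (if t \<in> C then SOME x. R t x else undefined)" for t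
  have Rg: "R t (g t)" if "t \<in> C" for t
    using someI_ex[OF R_ex[OF that]] that by (simp add: g_def)
  have sC: "s x \<in> C" for x
    unfolding C_def by (rule subsetD[OF closure_subset rangeI])
  have gs: "g (s x) = x" for x
  proof -
    have "R (s x) x" unfolding R_def by (intro exI[of _ "\<lambda>n. x"]) auto
    have "dist (g (s x)) x \<le> e" if e: "0 < e" for e
    proof -
      obtain d where "d > 0" "\<And>t t' x x'. R t x \<Longrightarrow> R t' x' \<Longrightarrow> \<bar>t - t'\<bar> < d \<Longrightarrow> dist x x' \<le> e"
        using R_close[OF e] by blast
      from this(2)[OF Rg[OF sC[of x]] \<open>R (s x) x\<close>] \<open>d > 0\<close> show ?thesis by simp
    qed
    then show ?thesis
      using dense_ge[of 0 "dist (g (s x)) x"] by simp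
  qed
  have gc: "continuous_on C g"
    unfolding continuous_on_iff
  proof (intro ballI allI impI)
    fix t e :: real assume t: "t \<in> C" "0 < e"
    obtain d where "d > 0" "\<And>t t' x x'. R t x \<Longrightarrow> R t' x' \<Longrightarrow> \<bar>t - t'\<bar> < d \<Longrightarrow> dist x x' \<le> e/2"
      using R_close[of "e/2"] t by auto
    then show "\<exists>d>0. \<forall>x'\<in>C. dist x' t < d \<longrightarrow> dist (g x') (g t) < e"
      using Rg t by (intro exI[of _ d]) (force simp: dist_real_def)
  qed
  have gm: "g \<in> borel_measurable borel"
  proof -
    have "(\<lambda>t. if t \<in> C then g t else undefined) \<in> borel_measurable borel"
      using C by (intro borel_measurable_continuous_on_if gc) (auto intro: borel_compact)
    also have "(\<lambda>t. if t \<in> C then g t else undefined) = g"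
      by (auto simp: g_def)
    finally show ?thesis .
  qed
  show thesis
    by (rule that[OF C s_meas sC gc gs gm])
qed

text \<open>On the line finite Borel measures are inner regular by compact sets. Push
  \<open>M\<close> there by the code and bring the compact set back with the decoding map, which is
  continuous on \<open>C\<close> and so has compact image.\<close>

lemma closed_inner_approx:
  fixes M :: "'a::metric_space measure"
  assumes comp: "compact (UNIV :: 'a set)" and fin: "finite_measure M" and M: "sets M = sets borel"
    and A: "A \<in> sets borel" and e: "0 < e"
  obtains K where "closed K" "K \<subseteq> A" "measure M (A - K) < e"
proof -
  interpret finite_measure M by fact
  obtain C and s :: "'a \<Rightarrow> real" and g where C: "compact C" "C \<subseteq> {0..1}"
    and s: "s \<in> borel_measurable borel" "\<And>x. s x \<in> C"
    and g: "continuous_on C g" "\<And>x. g (s x) = x" "g \<in> borel_measurable borel"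
    using real_coding[OF comp] by metis
  have sM: "s \<in> borel_measurable M"
    using s(1) M by (simp cong: measurable_cong_sets)
  define N where "N = distr M borel s"
  interpret N: finite_measure N
    unfolding N_def by (rule finite_measure_distr[OF sM])
  \<comment> \<open>Using the preimage under \<open>g\<close> rather than the image under
    \<open>s\<close> makes this copy of \<open>A\<close> a Borel set at once.\<close>
  define B where "B = g -` A \<inter> C"
  have B: "B \<in> sets borel"
    unfolding B_def using measurable_sets[OF g(3) A] C by (auto intro: borel_compact)
  have "emeasure N B = (SUP K \<in> {K. K \<subseteq> B \<and> compact K}. emeasure N K)"
    using B by (intro inner_regular) (auto simp: N_def N.emeasure_finite[unfolded N_def])
  moreover have "ennreal (measure N B - e) < emeasure N B" if "e \<le> measure N B"
    unfolding N.emeasure_eq_measure using that e by (intro ennreal_lessI) auto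
  ultimately have **: "\<exists>K. K \<subseteq> B \<and> compact K \<and> ennreal (measure N B - e) < emeasure N K" if "e \<le> measure N B"
    using that by (auto simp: less_SUP_iff)
  have "\<exists>K. K \<subseteq> B \<and> compact K \<and> measure N B - e < measure N K"
  proof (cases "e \<le> measure N B")
    case True
    then obtain K where "K \<subseteq> B" "compact K" "ennreal (measure N B - e) < ennreal (measure N K)"
      using ** by (auto simp: N.emeasure_eq_measure)
    with True show ?thesis by (auto simp: ennreal_less_iff)
  next
    case False
    then show ?thesis by (intro exI[of _ "{}"]) auto
  qed
  then obtain K where K: "K \<subseteq> B" "compact K" "measure N B - e < measure N K" by blast
  have gK: "compact (g ` K)"
    using K C g(1) by (intro compact_continuous_image) (auto simp: B_def intro: continuous_on_subset)
  show thesis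
  proof
    show "closed (g ` K)" using gK by (rule compact_imp_closed)
    show sub: "g ` K \<subseteq> A" using K by (auto simp: B_def)
    have gKs: "g ` K \<in> sets M" using gK M by (simp add: borel_compact)
    have "measure N K \<le> measure M (g ` K)"
    proof -
      have "s -` K \<inter> space M \<subseteq> g ` K"
      proof
        fix x assume "x \<in> s -` K \<inter> space M"
        then show "x \<in> g ` K" by (intro image_eqI[of _ _ "s x"]) (auto simp: g(2))
      qed
      then show ?thesis
        unfolding N_def using K(2) sM gKs
        by (simp add: measure_distr borel_compact finite_measure_mono)
    qed
    moreover have "measure N B = measure M A"
    proof -
      have "space M = UNIV" using sets_eq_imp_space_eq[OF M] by simp
      then have "s -` B \<inter> space M = A"
        using s(2) g(2) by (auto simp: B_def)
      then show ?thesis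
        unfolding N_def using B sM by (simp add: measure_distr)
    qed
    ultimately show "measure M (A - g ` K) < e"
      using K(3) sub gKs A M by (subst finite_measure_Diff) auto
  qed
qed

section \<open>Continuous test functions and weak limits\<close>

lemma closed_indicator_approx:
  fixes A :: "'a::metric_space set"
  assumes "closed A"
  obtains f :: "nat \<Rightarrow> 'a \<Rightarrow> real" where "\<And>n. continuous_on UNIV (f n)"
    "\<And>n x. 0 \<le> f n x" "\<And>n x. f n x \<le> 1" "\<And>x. (\<lambda>n. f n x) \<longlonglongrightarrow> indicator A x"
proof (cases "A = {}")
  \<comment> \<open>\<open>infdist\<close> to the empty set is 0, so the formula of the other case
    would give the constant 1.\<close>
  case True
  show ?thesis by (rule that[of "\<lambda>n x. 0"]) (use True in auto)
next
  case False
  let ?f = "\<lambda>n x. max 0 (1 - real n * infdist x A)"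
  have "(\<lambda>n. ?f n x) \<longlonglongrightarrow> indicator A x" for x
  proof (cases "x \<in> A")
    case True then show ?thesis by simp
  next
    case nA: False
    then have pos: "infdist x A > 0"
      using assms False by (metis in_closed_iff_infdist_zero infdist_nonneg less_eq_real_def)
    obtain N where N: "1 < real N * infdist x A"
      using reals_Archimedean3[OF pos] by blast
    have "eventually (\<lambda>n. ?f n x = 0) sequentially"
      using eventually_ge_at_top[of N]
    proof eventually_elim
      case (elim n)
      then have "real N * infdist x A \<le> real n * infdist x A"
        using pos by simp
      then show ?case using N by simp
    qed
    then show ?thesis using nA by (simp add: tendsto_eventually)
  qed
  then show ?thesis
    by (intro that[of ?f]) (auto intro!: continuous_intros mult_nonneg_nonneg infdist_nonneg)
qed

lemma measure_closed_limit:
  fixes M :: "'a::metric_space measure" and f :: "nat \<Rightarrow> 'a \<Rightarrow> real"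
  assumes "finite_measure M" "sets M = sets borel" "A \<in> sets borel"
    and f: "\<And>n. continuous_on UNIV (f n)" "\<And>n x. 0 \<le> f n x" "\<And>n x. f n x \<le> 1"
      "\<And>x. (\<lambda>n. f n x) \<longlonglongrightarrow> indicator A x"
  shows "(\<lambda>n. \<integral>x. f n x \<partial>M) \<longlonglongrightarrow> measure M A"
proof -
  interpret finite_measure M by fact
  have fm: "f n \<in> borel_measurable M" for n
    using borel_measurable_continuous_onI[OF f(1)] assms(2) by (simp cong: measurable_cong_sets)
  have am: "indicator A \<in> borel_measurable M"
    using assms by (simp cong: measurable_cong_sets)
  have "(\<lambda>n. \<integral>x. f n x \<partial>M) \<longlonglongrightarrow> (\<integral>x. indicator A x \<partial>M)"
    by (rule integral_dominated_convergence[where w="\<lambda>_. 1"]) (use f fm am in auto)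
  moreover have "space M = UNIV"
    using sets_eq_imp_space_eq[OF assms(2)] by simp
  ultimately show ?thesis
    using assms by simp
qed

text \<open>Closed sets are an intersection-stable generator, and their measures are limits of
  integrals of continuous functions with values in the unit interval.\<close>

lemma borel_eqI_continuous:
  fixes M N :: "'a::metric_space measure"
  assumes M: "finite_measure M" "sets M = sets borel" and N: "finite_measure N" "sets N = sets borel"
    and eq: "\<And>f. continuous_on UNIV f \<Longrightarrow> (\<And>x. 0 \<le> f x) \<Longrightarrow> (\<And>x. f x \<le> 1) \<Longrightarrow>
      (\<integral>x. f x \<partial>M) = (\<integral>x. f x \<partial>N :: real)"
  shows "M = N"
proof (rule measure_eqI_generator_eq[where E="Collect closed" and A="\<lambda>_::nat. UNIV" and \<Omega>=UNIV])
  interpret M: finite_measure M by fact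
  interpret N: finite_measure N by fact
  fix A :: "'a set" assume "A \<in> Collect closed"
  then have cl: "closed A" by simp
  obtain f :: "nat \<Rightarrow> 'a \<Rightarrow> real" where f: "\<And>n. continuous_on UNIV (f n)"
    "\<And>n x. 0 \<le> f n x" "\<And>n x. f n x \<le> 1" "\<And>x. (\<lambda>n. f n x) \<longlonglongrightarrow> indicator A x"
    by (rule closed_indicator_approx[OF cl]) (rule that)
  have "(\<lambda>n. \<integral>x. f n x \<partial>M) \<longlonglongrightarrow> measure M A" "(\<lambda>n. \<integral>x. f n x \<partial>N) \<longlonglongrightarrow> measure N A"
    by (rule measure_closed_limit[OF M borel_closed[OF cl] f] measure_closed_limit[OF N borel_closed[OF cl] f])+
  then have "measure M A = measure N A"
    unfolding eq[OF f(1-3)] by (rule LIMSEQ_unique)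
  then show "emeasure M A = emeasure N A"
    by (simp add: M.emeasure_eq_measure N.emeasure_eq_measure)
qed (use assms in \<open>auto simp: borel_eq_closed Int_stable_def finite_measure.emeasure_finite\<close>)

lemma continuous_compact_bounded:
  fixes f :: "'a::metric_space \<Rightarrow> real"
  assumes "compact (UNIV :: 'a set)" "continuous_on UNIV f"
  obtains B where "0 \<le> B" "\<And>x. \<bar>f x\<bar> \<le> B"
proof -
  obtain B where B: "\<And>x. \<bar>f x\<bar> \<le> B"
    using compact_imp_bounded[OF compact_continuous_image[OF assms(2,1)]] unfolding bounded_iff by auto
  moreover have "0 \<le> B" using B[of undefined] by linarith
  ultimately show thesis using that by blast
qed

lemma integrable_continuous_compact:
  fixes f :: "'a::metric_space \<Rightarrow> real"
  assumes "compact (UNIV :: 'a set)" "finite_measure M" "sets M = sets borel" "continuous_on UNIV f"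
  shows "integrable M f"
proof -
  obtain B where B: "\<And>x. \<bar>f x\<bar> \<le> B"
    using continuous_compact_bounded[OF assms(1,4)] by blast
  have "f \<in> borel_measurable M"
    using borel_measurable_continuous_onI[OF assms(4)] assms(3) by (simp cong: measurable_cong_sets)
  then show ?thesis
    by (intro finite_measure.integrable_const_bound[OF assms(2), of _ B]) (use B in auto)
qed

text \<open>Weak compactness is borrowed from the line: the coded measures are tight, a subsequence
  of them converges weakly, and its limit is decoded by \<open>g\<close>. The assumed convergence of
  all integrals then identifies the limit along the whole sequence.\<close>

lemma compact_weak_limit:
  fixes \<mu> :: "nat \<Rightarrow> 'a::metric_space measure"
  assumes comp: "compact (UNIV :: 'a set)"
    and pr: "\<And>n. prob_space (\<mu> n)" and se: "\<And>n. sets (\<mu> n) = sets borel"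
    and conv: "\<And>f::'a \<Rightarrow> real. continuous_on UNIV f \<Longrightarrow> convergent (\<lambda>n. \<integral>x. f x \<partial>\<mu> n)"
  obtains \<nu> :: "'a measure" where "prob_space \<nu>" "sets \<nu> = sets borel"
    "\<And>f. continuous_on UNIV f \<Longrightarrow> (\<lambda>n. \<integral>x. f x \<partial>\<mu> n) \<longlonglongrightarrow> (\<integral>x. f x \<partial>\<nu> :: real)"
proof -
  obtain C and s :: "'a \<Rightarrow> real" and g where C: "compact C" "C \<subseteq> {0..1}"
    and s: "s \<in> borel_measurable borel" "\<And>x. s x \<in> C"
    and g: "continuous_on C g" "\<And>x. g (s x) = x" "g \<in> borel_measurable borel"
    by (rule real_coding[OF comp]) (rule that)
  have clC: "closed C" using C by (auto intro: compact_imp_closed)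
  have sm: "s \<in> borel_measurable (\<mu> n)" for n
    using s(1) se by (simp cong: measurable_cong_sets)
  define N where "N n = distr (\<mu> n) borel s" for n
  have spN: "space (\<mu> n) = UNIV" for n
    using sets_eq_imp_space_eq[OF se] by simp
  have rd: "real_distribution (N n)" for n
    unfolding N_def real_distribution_def real_distribution_axioms_def
    using prob_space.prob_space_distr[OF pr sm] by simp
  have "tight N"
    unfolding tight_def
  proof (intro conjI allI impI)
    fix \<epsilon> :: real assume "0 < \<epsilon>"
    have "measure (N n) {-1<..1} = 1" for n
    proof -
      have "s x \<in> {0..1}" for x using s(2) C(2) by (rule subsetD[rotated])
      then have "s x \<in> {-1<..1}" for x by (smt (verit) atLeastAtMost_iff greaterThanAtMost_iff)
      then have "s -` {-1<..1} = UNIV" by blast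
      then show ?thesis
        unfolding N_def using sm prob_space.prob_space[OF pr] by (simp add: measure_distr spN)
    qed
    then show "\<exists>a b. a < b \<and> (\<forall>n. 1 - \<epsilon> < measure (N n) {a<..b})"
      using \<open>0 < \<epsilon>\<close> by (intro exI[of _ "-1"] exI[of _ 1]) auto
  qed (rule rd)
  then obtain r M where r: "strict_mono r" and M: "real_distribution M" and wk: "weak_conv_m (N \<circ> id \<circ> r) M"
    using tight_imp_convergent_subsubsequence[OF _ strict_mono_id] by blast
  interpret M: real_distribution M by fact
  have lim: "(\<lambda>n. \<integral>x. F (s x) \<partial>\<mu> (r n)) \<longlonglongrightarrow> (\<integral>t. F t \<partial>M)"
    if F: "continuous_on UNIV F" "\<And>t. \<bar>F t\<bar> \<le> B" for F :: "real \<Rightarrow> real" and B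
  proof -
    have "(\<lambda>n. integral\<^sup>L ((N \<circ> id \<circ> r) n) F) \<longlonglongrightarrow> integral\<^sup>L M F"
      by (rule weak_conv_imp_integral_bdd_continuous_conv[OF _ M wk, of _ B])
        (use rd F in \<open>auto simp: continuous_on_eq_continuous_within\<close>)
    moreover have "integral\<^sup>L (N k) F = (\<integral>x. F (s x) \<partial>\<mu> k)" for k
      unfolding N_def by (intro integral_distr sm borel_measurable_continuous_onI F)
    ultimately show ?thesis by (simp add: o_def)
  qed
  have ne: "C \<noteq> {}" using s(2) by blast
  \<comment> \<open>Decoding is meaningful only on \<open>C\<close>. The function tested here
    vanishes exactly on \<open>C\<close>; its integral is 0 for every coded measure, hence also for
    the limit.\<close>
  have AEC: "AE t in M. t \<in> C"
  proof -
    let ?F = "\<lambda>t. min 1 (infdist t C)"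
    have F: "\<bar>?F t\<bar> \<le> 1" "0 \<le> ?F t" for t
      using infdist_nonneg[of t C] by auto
    have Fc: "continuous_on UNIV ?F"
      by (intro continuous_on_min continuous_on_infdist continuous_on_const continuous_on_id)
    have int: "integrable M ?F"
      using F borel_measurable_continuous_onI[OF Fc] by (intro M.integrable_const_bound[where B=1]) auto
    have "(\<lambda>n. \<integral>x. ?F (s x) \<partial>\<mu> (r n)) \<longlonglongrightarrow> (\<integral>t. ?F t \<partial>M)"
      by (rule lim[OF Fc F(1)])
    moreover have "?F (s x) = 0" for x
      using s(2) by simp
    ultimately have "(\<integral>t. ?F t \<partial>M) = 0"
      by (simp add: LIMSEQ_const_iff)
    then have "AE t in M. ?F t = 0"
      using integral_nonneg_eq_0_iff_AE[OF int] F(2) by simp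
    then show ?thesis
    proof (rule AE_mp, intro AE_I2 impI)
      fix t assume "?F t = 0"
      then have "infdist t C = 0" by (auto simp: min_def split: if_splits)
      then show "t \<in> C" using clC ne in_closed_iff_infdist_zero by blast
    qed
  qed
  have gM: "g \<in> measurable M borel"
    using g(3) by (simp cong: measurable_cong_sets)
  define \<nu> where "\<nu> = distr M borel g"
  show thesis
  proof (rule that[of \<nu>])
    show "prob_space \<nu>" unfolding \<nu>_def by (rule M.prob_space_distr[OF gM])
    show "sets \<nu> = sets borel" by (simp add: \<nu>_def)
    fix f :: "'a \<Rightarrow> real" assume f: "continuous_on UNIV f"
    obtain B where B0: "0 \<le> B" and B: "\<And>x. \<bar>f x\<bar> \<le> B"
      using continuous_compact_bounded[OF comp f] by blast
    have "continuous_on C (\<lambda>t. f (g t))"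
      using continuous_on_compose2[OF f g(1)] by simp
    \<comment> \<open>A test function on \<open>'a\<close> is transported only to \<open>C\<close>;
      Tietze extends it to the line without enlarging its bound, so that weak convergence
      applies.\<close>
    then obtain F :: "real \<Rightarrow> real" where F: "continuous_on UNIV F" "\<And>t. t \<in> C \<Longrightarrow> F t = f (g t)" "\<And>t. norm (F t) \<le> B"
      by (rule Tietze[of C "\<lambda>t. f (g t)" UNIV B]) (use clC B B0 in auto)
    have "(\<lambda>n. \<integral>x. F (s x) \<partial>\<mu> (r n)) \<longlonglongrightarrow> (\<integral>t. F t \<partial>M)"
      by (rule lim) (use F in auto)
    moreover have "F (s x) = f x" for x
      using F(2) s(2) g(2) by simp
    moreover have "(\<integral>t. F t \<partial>M) = (\<integral>t. f (g t) \<partial>M)"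
    proof (rule integral_cong_AE)
      show "F \<in> borel_measurable M"
        using borel_measurable_continuous_onI[OF F(1)] by simp
      show "(\<lambda>t. f (g t)) \<in> borel_measurable M"
        by (rule borel_measurable_continuous_on[OF f gM])
      show "AE x in M. F x = f (g x)"
        using AEC by eventually_elim (rule F(2))
    qed
    moreover have "(\<integral>t. f (g t) \<partial>M) = (\<integral>x. f x \<partial>\<nu>)"
      unfolding \<nu>_def using gM f by (intro integral_distr[symmetric] borel_measurable_continuous_onI)
    ultimately have sub: "(\<lambda>n. \<integral>x. f x \<partial>\<mu> (r n)) \<longlonglongrightarrow> (\<integral>x. f x \<partial>\<nu>)"
      by simp
    obtain L where L: "(\<lambda>n. \<integral>x. f x \<partial>\<mu> n) \<longlonglongrightarrow> L"
      using conv[OF f] unfolding convergent_def by blast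
    with LIMSEQ_unique[OF sub, of L] LIMSEQ_subseq_LIMSEQ[OF L r] show "(\<lambda>n. \<integral>x. f x \<partial>\<mu> n) \<longlonglongrightarrow> (\<integral>x. f x \<partial>\<nu>)"
      by (simp add: o_def)
  qed
qed

section \<open>Conditional distributions and disintegration\<close>

lemma AE_le_of_nn_integral_le:
  assumes [measurable]: "f \<in> borel_measurable M" "g \<in> borel_measurable M"
    and fin: "(\<integral>\<^sup>+x. f x \<partial>M) \<noteq> \<infinity>"
    and le: "\<And>A. A \<in> sets M \<Longrightarrow> (\<integral>\<^sup>+x. f x * indicator A x \<partial>M) \<le> (\<integral>\<^sup>+x. g x * indicator A x \<partial>M)"
  shows "AE x in M. f x \<le> (g x :: ennreal)"
proof -
  \<comment> \<open>On this set the difference of the two functions is strictly positive, while the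
    assumption forces its integral over the set to vanish.\<close>
  define A where "A = {x \<in> space M. g x < f x}"
  have [measurable]: "A \<in> sets M" unfolding A_def by measurable
  have "(\<integral>\<^sup>+x. g x * indicator A x \<partial>M) \<le> (\<integral>\<^sup>+x. f x \<partial>M)"
    by (intro nn_integral_mono) (auto simp: A_def indicator_def)
  then have fin': "(\<integral>\<^sup>+x. g x * indicator A x \<partial>M) \<noteq> \<infinity>"
    using fin by (auto simp: top_unique)
  have "(\<integral>\<^sup>+x. f x * indicator A x - g x * indicator A x \<partial>M) =
      (\<integral>\<^sup>+x. f x * indicator A x \<partial>M) - (\<integral>\<^sup>+x. g x * indicator A x \<partial>M)"
    by (intro nn_integral_diff fin') (auto simp: A_def indicator_def)
  also have "\<dots> = 0"
    using le[of A] fin' by (intro diff_eq_0_ennreal) (auto simp: less_top intro: le_less_trans)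
  finally have "AE x in M. f x * indicator A x - g x * indicator A x = 0"
    by (subst (asm) nn_integral_0_iff_AE) auto
  then show ?thesis
  proof (rule AE_mp, intro AE_I2 impI)
    fix x assume x: "x \<in> space M" "f x * indicator A x - g x * indicator A x = 0"
    show "f x \<le> g x"
    proof (rule ccontr)
      assume "\<not> f x \<le> g x"
      then have "g x < f x" by simp
      then have "0 < f x - g x" by (simp add: diff_gt_0_iff_gt_ennreal)
      with x \<open>g x < f x\<close> show False by (simp add: A_def)
    qed
  qed
qed

lemma AE_eq_of_nn_integral_eq:
  assumes "f \<in> borel_measurable M" "g \<in> borel_measurable M"
    and fin: "(\<integral>\<^sup>+x. f x \<partial>M) \<noteq> \<infinity>" "(\<integral>\<^sup>+x. g x \<partial>M) \<noteq> \<infinity>"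
    and eq: "\<And>A. A \<in> sets M \<Longrightarrow> (\<integral>\<^sup>+x. f x * indicator A x \<partial>M) = (\<integral>\<^sup>+x. g x * indicator A x \<partial>M)"
  shows "AE x in M. f x = (g x :: ennreal)"
  using AE_le_of_nn_integral_le[OF assms(1,2) fin(1)] AE_le_of_nn_integral_le[OF assms(2,1) fin(2)] eq
  by (auto intro: antisym)

text \<open>The kernel is the image of the uniform distribution under the conditional quantile function.\<close>

lemma real_conditional_quantile:
  fixes P :: "'b measure" and m :: "('b \<times> 'a) measure" and s :: "'b \<times> 'a \<Rightarrow> real"
  assumes P: "prob_space P" and m: "prob_space m"
    and fst [measurable]: "fst \<in> measurable m P" and mP: "distr m P fst = P"
    and s [measurable]: "s \<in> borel_measurable m" and s01: "\<And>p. s p \<in> {0..1}"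
  obtains Q :: "'b \<Rightarrow> real \<Rightarrow> real" where
    "case_prod Q \<in> borel_measurable (P \<Otimes>\<^sub>M uniform_measure lborel {0..1})"
    "distr m (P \<Otimes>\<^sub>M borel) (\<lambda>p. (fst p, s p)) =
      distr (P \<Otimes>\<^sub>M uniform_measure lborel {0..1}) (P \<Otimes>\<^sub>M borel) (\<lambda>(\<omega>, u). (\<omega>, Q \<omega> u))"
proof -
  interpret P: prob_space P by fact
  interpret m: prob_space m by fact
  define U where "U = uniform_measure lborel {0..1::real}"
  interpret U: prob_space U
    unfolding U_def by (rule prob_space_uniform_measure) auto
  have U_eq: "emeasure U A = emeasure lborel ({0..1} \<inter> A)" if "A \<in> sets borel" for A
    using that unfolding U_def by (simp add: divide_ennreal_def)
  have setsU [measurable_cong]: "sets U = sets borel" by (simp add: U_def)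
  \<comment> \<open>Rational thresholds only: monotonicity of the conditional distribution function
    holds almost everywhere for each pair of thresholds, and countably many pairs leave a single
    null set.\<close>
  define I where "I = \<rat> \<inter> {0..1::real}"
  have cI: "countable I" unfolding I_def by (simp add: countable_rat countable_Int1)
  define S where "S E q = fst -` E \<inter> {p \<in> space m. s p \<le> q}" for E q
  have S_m [measurable]: "E \<in> sets P \<Longrightarrow> S E q \<in> sets m" for E q
  proof -
    assume [measurable]: "E \<in> sets P"
    have "S E q = (fst -` E \<inter> space m) \<inter> {p \<in> space m. s p \<le> q}" by (auto simp: S_def)
    also have "\<dots> \<in> sets m" by measurable
    finally show ?thesis .
  qed
  have mE: "emeasure m (fst -` E \<inter> space m) = emeasure P E" if "E \<in> sets P" for E
    using arg_cong[OF mP, of "\<lambda>M. emeasure M E"] that by (simp add: emeasure_distr)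
  \<comment> \<open>\<open>F q \<omega>\<close> is the conditional probability of
    \<open>s \<le> q\<close> given the base point \<open>\<omega>\<close>, obtained as a
    Radon-Nikodym derivative with respect to \<open>P\<close>.\<close>
  have "\<exists>F. F \<in> borel_measurable P \<and> (\<forall>E\<in>sets P. (\<integral>\<^sup>+\<omega>. F \<omega> * indicator E \<omega> \<partial>P) = emeasure m (S E q))" for q
  proof -
    define \<mu> where "\<mu> = distr (density m (indicator {p \<in> space m. s p \<le> q})) P fst"
    have \<mu>: "emeasure \<mu> E = emeasure m (S E q)" if "E \<in> sets P" for E
    proof -
      have [measurable]: "E \<in> sets P" by fact
      have "emeasure \<mu> E = (\<integral>\<^sup>+p. indicator {p \<in> space m. s p \<le> q} p * indicator (fst -` E \<inter> space m) p \<partial>m)"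
        unfolding \<mu>_def by (subst emeasure_distr) (auto simp: emeasure_density)
      also have "\<dots> = (\<integral>\<^sup>+p. indicator (S E q) p \<partial>m)"
        by (intro nn_integral_cong) (auto simp: S_def indicator_def)
      finally show ?thesis by simp
    qed
    have "absolutely_continuous P \<mu>"
      unfolding absolutely_continuous_def
    proof
      fix E assume "E \<in> null_sets P"
      then have E: "E \<in> sets P" "emeasure P E = 0" by auto
      have "emeasure \<mu> E \<le> emeasure P E"
        unfolding \<mu>[OF E(1)] mE[OF E(1), symmetric]
        using E(1) by (intro emeasure_mono) (auto simp: S_def)
      with E show "E \<in> null_sets \<mu>" by (auto simp: \<mu>_def)
    qed
    from P.density_RN_deriv[OF this] have d: "density P (RN_deriv P \<mu>) = \<mu>"
      by (simp add: \<mu>_def)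
    have "(\<integral>\<^sup>+\<omega>. RN_deriv P \<mu> \<omega> * indicator E \<omega> \<partial>P) = emeasure m (S E q)" if "E \<in> sets P" for E
      using that by (simp add: \<mu>[OF that, symmetric] emeasure_density[symmetric] d)
    then show ?thesis by (intro exI[of _ "RN_deriv P \<mu>"]) auto
  qed
  then obtain F where F [measurable]: "\<And>q. F q \<in> borel_measurable P"
    and FE: "\<And>q E. E \<in> sets P \<Longrightarrow> (\<integral>\<^sup>+\<omega>. F q \<omega> * indicator E \<omega> \<partial>P) = emeasure m (S E q)"
    by metis
  have Ffin: "(\<integral>\<^sup>+\<omega>. F q \<omega> \<partial>P) \<noteq> \<infinity>" for q
  proof -
    have "(\<integral>\<^sup>+\<omega>. F q \<omega> \<partial>P) = (\<integral>\<^sup>+\<omega>. F q \<omega> * indicator (space P) \<omega> \<partial>P)"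
      by (intro nn_integral_cong) simp
    then show ?thesis using FE[of "space P" q] by simp
  qed
  have mono: "AE \<omega> in P. F q \<omega> \<le> F q' \<omega>" if "q \<le> q'" for q q'
    by (rule AE_le_of_nn_integral_le[OF F F Ffin])
      (auto simp: FE S_def intro!: emeasure_mono order_trans[OF _ that] S_m[unfolded S_def])
  have le1: "AE \<omega> in P. F q \<omega> \<le> 1" for q
    by (rule AE_le_of_nn_integral_le[OF F _ Ffin])
      (auto simp: FE S_def mE[symmetric] intro!: emeasure_mono)
  have AEF: "AE \<omega> in P. (\<forall>q\<in>I. F q \<omega> \<le> 1) \<and> (\<forall>q\<in>I. \<forall>q'\<in>I. q \<le> q' \<longrightarrow> F q \<omega> \<le> F q' \<omega>)"
    using mono le1 cI by (simp add: AE_ball_countable AE_conj_iff AE_impI)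
  \<comment> \<open>The generalized inverse of the conditional distribution function at level
    \<open>u\<close>. The inserted 1 keeps the infimum over a nonempty set. By \<open>Q_less\<close>
    the condition \<open>Q \<omega> u < t\<close> involves countably many rationals, which gives
    joint measurability even at those \<open>\<omega>\<close> where \<open>F\<close> is not
    monotone.\<close>
  define Q where "Q \<omega> u = Inf (insert 1 {q \<in> I. ennreal u \<le> F q \<omega>})" for \<omega> u
  have Q_less: "Q \<omega> u < t \<longleftrightarrow> 1 < t \<or> (\<exists>q\<in>I. q < t \<and> ennreal u \<le> F q \<omega>)" for \<omega> u t
    unfolding Q_def
    by (subst cInf_less_iff) (auto intro!: bdd_belowI[of _ 0] simp: I_def)
  have Qm: "case_prod Q \<in> borel_measurable (P \<Otimes>\<^sub>M U)"
  proof (rule borel_measurableI_less)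
    fix t
    have "{p \<in> space (P \<Otimes>\<^sub>M U). case_prod Q p < t} =
        {p \<in> space (P \<Otimes>\<^sub>M U). 1 < t \<or> (\<exists>q\<in>I. q < t \<and> ennreal (snd p) \<le> F q (fst p))}"
      by (auto simp: Q_less split_beta')
    also have "\<dots> \<in> sets (P \<Otimes>\<^sub>M U)"
      using cI by measurable
    finally show "{p \<in> space (P \<Otimes>\<^sub>M U). case_prod Q p < t} \<in> sets (P \<Otimes>\<^sub>M U)" .
  qed
  \<comment> \<open>Within \<open>[0,1]\<close> the levels below some \<open>f q\<close> form an
    initial segment whose right end is the supremum; whether the end point belongs to it has no
    effect on the length.\<close>
  have U_seg: "emeasure U {u. \<exists>q\<in>J. ennreal u \<le> f q} = (SUP q\<in>J. f q)"
    if "countable J" and f1: "\<And>q. q \<in> J \<Longrightarrow> f q \<le> 1" for J and f :: "real \<Rightarrow> ennreal"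
  proof -
    define a where "a = enn2real (SUP q\<in>J. f q)"
    have le: "(SUP q\<in>J. f q) \<le> 1" using f1 by (intro SUP_least)
    then have aS: "ennreal a = (SUP q\<in>J. f q)"
      unfolding a_def by (intro ennreal_enn2real) (rule le_less_trans[OF le], simp)
    have a: "0 \<le> a" "a \<le> 1"
      using le unfolding aS[symmetric] by (auto simp: a_def)
    have m1: "{u. \<exists>q\<in>J. ennreal u \<le> f q} \<in> sets borel"
      using \<open>countable J\<close> by measurable
    have "emeasure lborel {0..<a} \<le> emeasure U {u. \<exists>q\<in>J. ennreal u \<le> f q}"
      unfolding U_eq[OF m1]
    proof (intro emeasure_mono subsetI)
      fix u assume u: "u \<in> {0..<a}"
      then have "ennreal u < (SUP q\<in>J. f q)" unfolding aS[symmetric] by (auto simp: ennreal_less_iff)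
      then obtain q where "q \<in> J" "ennreal u < f q" by (auto simp: less_SUP_iff)
      with u a show "u \<in> {0..1} \<inter> {u. \<exists>q\<in>J. ennreal u \<le> f q}" by (auto intro: less_imp_le)
    qed (use m1 in auto)
    moreover have "emeasure U {u. \<exists>q\<in>J. ennreal u \<le> f q} \<le> emeasure lborel {0..a}"
      unfolding U_eq[OF m1]
    proof (intro emeasure_mono subsetI)
      fix u assume u: "u \<in> {0..1} \<inter> {u. \<exists>q\<in>J. ennreal u \<le> f q}"
      then obtain q where "q \<in> J" "ennreal u \<le> f q" by auto
      then have "ennreal u \<le> ennreal a" unfolding aS by (auto intro: SUP_upper2)
      with u a show "u \<in> {0..a}" by (auto simp: ennreal_le_iff)
    qed auto
    ultimately show ?thesis using a by (simp add: aS)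
  qed
  \<comment> \<open>Open half-lines are used because strict inequalities are what
    \<open>Q_less\<close> describes; the rectangles over them generate the product and are stable
    under intersection.\<close>
  have key: "emeasure (P \<Otimes>\<^sub>M U) {p \<in> space (P \<Otimes>\<^sub>M U). fst p \<in> E \<and> case_prod Q p < t} =
      emeasure m {p \<in> space m. fst p \<in> E \<and> s p < t}" if E [measurable]: "E \<in> sets P" for E t
  proof -
    have [measurable]: "case_prod Q \<in> borel_measurable (P \<Otimes>\<^sub>M U)" by (rule Qm)
    have X: "{p \<in> space (P \<Otimes>\<^sub>M U). fst p \<in> E \<and> case_prod Q p < t} \<in> sets (P \<Otimes>\<^sub>M U)"
      by measurable
    have UU: "space U = UNIV" using sets_eq_imp_space_eq[OF setsU] by simp
    have "emeasure (P \<Otimes>\<^sub>M U) {p \<in> space (P \<Otimes>\<^sub>M U). fst p \<in> E \<and> case_prod Q p < t} =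
        (\<integral>\<^sup>+\<omega>. emeasure U {u. Q \<omega> u < t} * indicator E \<omega> \<partial>P)"
      unfolding U.emeasure_pair_measure_alt[OF X]
      by (intro nn_integral_cong)
        (auto simp: space_pair_measure indicator_def UU intro!: arg_cong[where f="emeasure U"])
    also have "\<dots> = emeasure m {p \<in> space m. fst p \<in> E \<and> s p < t}"
    proof (cases "1 < t")
      case True
      have "{p \<in> space m. fst p \<in> E \<and> s p < t} = fst -` E \<inter> space m"
        using s01 True by (auto intro: le_less_trans)
      moreover have "emeasure U {u. Q \<omega> u < t} = 1" for \<omega>
        using True U.emeasure_space_1 by (simp add: Q_less UU)
      ultimately show ?thesis using mE[OF E] by simp
    next
      case t1: False
      define J where "J = {q \<in> I. q < t}"
      have cJ: "countable J" unfolding J_def using cI by (auto intro: countable_subset)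
      have AEU: "AE \<omega> in P. emeasure U {u. Q \<omega> u < t} = (SUP q\<in>J. F q \<omega>)"
        using AEF
      proof eventually_elim
        case (elim \<omega>)
        have "{u. Q \<omega> u < t} = {u. \<exists>q\<in>J. ennreal u \<le> F q \<omega>}"
          using t1 by (auto simp: Q_less J_def)
        moreover have "emeasure U {u. \<exists>q\<in>J. ennreal u \<le> F q \<omega>} = (SUP q\<in>J. F q \<omega>)"
          by (rule U_seg[OF cJ]) (use elim in \<open>auto simp: J_def\<close>)
        ultimately show ?case by simp
      qed
      show ?thesis
      \<comment> \<open>Below the case \<open>1 < t\<close>, no rational of the unit interval lies
        under \<open>t\<close> exactly when \<open>t \<le> 0\<close>, and then both sides are
        0.\<close>
      proof (cases "J = {}")
        case True
        have "\<not> 0 < t"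
        proof
          assume "0 < t"
          then have "0 \<in> J" using t1 by (auto simp: J_def I_def)
          with True show False by simp
        qed
        then have e0: "{p \<in> space m. fst p \<in> E \<and> s p < t} = {}"
          using s01 by (auto simp: not_less) (meson order_trans not_less)
        moreover have "(\<integral>\<^sup>+\<omega>. emeasure U {u. Q \<omega> u < t} * indicator E \<omega> \<partial>P) = (\<integral>\<^sup>+\<omega>. 0 \<partial>P)"
          using AEU by (intro nn_integral_cong_AE) (auto simp: True bot_ennreal)
        ultimately show ?thesis unfolding e0 by simp
      next
        case ne: False
        \<comment> \<open>An increasing sequence cofinal in \<open>J\<close>: monotone convergence
          needs a sequence, whereas the supremum runs over a countable set of rationals in no
          particular order.\<close>
        define r where "r n = Max (from_nat_into J ` {..n})" for n :: nat
        have rJ: "r n \<in> J" for n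
        proof -
          have "r n \<in> from_nat_into J ` {..n}" unfolding r_def by (intro Max_in) auto
          then show ?thesis using from_nat_into[OF ne] by auto
        qed
        have rmono: "r n \<le> r n'" if "n \<le> n'" for n n'
          unfolding r_def using that by (intro Max_mono) auto
        have r_dom: "\<exists>n. q \<le> r n" if "q \<in> J" for q
        proof -
          obtain n where "from_nat_into J n = q" using from_nat_into_surj[OF cJ \<open>q \<in> J\<close>] by blast
          then have "q \<le> r n" unfolding r_def by (intro Max_ge) auto
          then show ?thesis ..
        qed
        have "(\<integral>\<^sup>+\<omega>. emeasure U {u. Q \<omega> u < t} * indicator E \<omega> \<partial>P) =
            (\<integral>\<^sup>+\<omega>. (SUP n. F (r n) \<omega> * indicator E \<omega>) \<partial>P)"
        proof (rule nn_integral_cong_AE)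
          show "AE \<omega> in P. emeasure U {u. Q \<omega> u < t} * indicator E \<omega> = (SUP n. F (r n) \<omega> * indicator E \<omega>)"
            using AEU AEF
          proof eventually_elim
            case (elim \<omega>)
            have "(SUP q\<in>J. F q \<omega>) = (SUP n. F (r n) \<omega>)"
            proof (rule antisym)
              show "(SUP q\<in>J. F q \<omega>) \<le> (SUP n. F (r n) \<omega>)"
              proof (rule SUP_least)
                fix q assume q: "q \<in> J"
                obtain n where n: "q \<le> r n" using r_dom[OF q] by blast
                have "F q \<omega> \<le> F (r n) \<omega>"
                  using elim(2) q rJ[of n] n by (auto simp: J_def)
                then show "F q \<omega> \<le> (SUP n. F (r n) \<omega>)" by (rule SUP_upper2[OF UNIV_I])
              qed
              show "(SUP n. F (r n) \<omega>) \<le> (SUP q\<in>J. F q \<omega>)"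
                by (intro SUP_least SUP_upper rJ)
            qed
            then show ?case using elim(1) by (auto simp: indicator_def)
          qed
        qed
        also have "\<dots> = (SUP n. \<integral>\<^sup>+\<omega>. F (r n) \<omega> * indicator E \<omega> \<partial>P)"
        proof (rule nn_integral_monotone_convergence_SUP_AE)
          fix n
          show "AE \<omega> in P. F (r n) \<omega> * indicator E \<omega> \<le> F (r (Suc n)) \<omega> * indicator E \<omega>"
            using mono[OF rmono[of n "Suc n"]] by (auto simp: indicator_def)
        qed auto
        also have "\<dots> = (SUP n. emeasure m (S E (r n)))"
          by (simp add: FE)
        also have "\<dots> = emeasure m (\<Union>n. S E (r n))"
          by (intro SUP_emeasure_incseq)
            (auto simp: incseq_def S_def intro: order_trans[OF _ rmono] S_m[unfolded S_def])
        also have "(\<Union>n. S E (r n)) = {p \<in> space m. fst p \<in> E \<and> s p < t}"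
        proof (intro equalityI subsetI)
          fix p assume "p \<in> (\<Union>n. S E (r n))"
          then show "p \<in> {p \<in> space m. fst p \<in> E \<and> s p < t}"
            using rJ by (auto simp: S_def J_def intro: le_less_trans)
        next
          fix p assume p: "p \<in> {p \<in> space m. fst p \<in> E \<and> s p < t}"
          then obtain q where q: "q \<in> \<rat>" "s p < q" "q < t"
            using Rats_dense_in_real[of "s p" t] by auto
          then have "q \<in> J" using s01[of p] t1 by (auto simp: J_def I_def)
          then obtain n where "q \<le> r n" using r_dom by blast
          then show "p \<in> (\<Union>n. S E (r n))" using p q by (auto simp: S_def intro!: exI[of _ n])
        qed
        finally show ?thesis .
      qed
    qed
    finally show ?thesis .
  qed
  let ?G = "{E \<times> {..<t} | E t. E \<in> sets P} :: ('b \<times> real) set set"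
  have UN: "(\<Union>i::nat. {..<real i}) = UNIV"
    using reals_Archimedean2 by auto
  have gen: "sets (P \<Otimes>\<^sub>M borel) = sigma_sets (space P \<times> (UNIV :: real set)) ?G"
  proof -
    have "sets (P \<Otimes>\<^sub>M (borel :: real measure)) = sets (sigma (space P \<times> space (borel :: real measure)) {a \<times> b | a b. a \<in> sets P \<and> b \<in> range lessThan})"
    proof (rule sets_pair_eq[where Ca="{space P}" and Cb="(\<lambda>i::nat. {..<real i}) ` UNIV"])
      show "sets (borel :: real measure) = sigma_sets (space borel) (range lessThan)"
        by (subst borel_Iio) (simp add: sets_measure_of)
    qed (use UN in \<open>auto simp: sets.sigma_sets_eq dest: sets.sets_into_space\<close>)
    also have "{a \<times> b | a b. a \<in> sets P \<and> b \<in> range lessThan} = ?G" by auto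
    also have "sets (sigma (space P \<times> space (borel :: real measure)) ?G) = sigma_sets (space P \<times> UNIV) ?G"
      by (subst sets_measure_of) (auto dest: sets.sets_into_space)
    finally show ?thesis .
  qed
  have [measurable]: "case_prod Q \<in> borel_measurable (P \<Otimes>\<^sub>M U)" by (rule Qm)
  have Qp [measurable]: "(\<lambda>(\<omega>, u). (\<omega>, Q \<omega> u)) \<in> measurable (P \<Otimes>\<^sub>M U) (P \<Otimes>\<^sub>M borel)"
    using Qm by (simp add: split_beta')
  have "distr m (P \<Otimes>\<^sub>M borel) (\<lambda>p. (fst p, s p)) =
      distr (P \<Otimes>\<^sub>M U) (P \<Otimes>\<^sub>M borel) (\<lambda>(\<omega>, u). (\<omega>, Q \<omega> u))"
  proof (rule measure_eqI_generator_eq[where E="?G" and A="\<lambda>i::nat. space P \<times> {..<real i}"])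
    show "Int_stable ?G"
    proof (rule Int_stableI)
      fix a b assume "a \<in> ?G" "b \<in> ?G"
      then obtain E t E' t' where "a = E \<times> {..<t}" "b = E' \<times> {..<t'}" "E \<in> sets P" "E' \<in> sets P" by auto
      moreover from this have "a \<inter> b = (E \<inter> E') \<times> {..<min t t'}" by auto
      ultimately show "a \<inter> b \<in> ?G" by blast
    qed
    show "?G \<subseteq> Pow (space P \<times> UNIV)" by (auto dest: sets.sets_into_space)
    fix X assume "X \<in> ?G"
    then obtain E t where X: "X = E \<times> {..<t}" and E: "E \<in> sets P" by auto
    have "emeasure (distr m (P \<Otimes>\<^sub>M borel) (\<lambda>p. (fst p, s p))) X = emeasure m {p \<in> space m. fst p \<in> E \<and> s p < t}"
      using E by (subst emeasure_distr) (auto simp: X intro!: arg_cong[where f="emeasure m"])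
    moreover have "emeasure (distr (P \<Otimes>\<^sub>M U) (P \<Otimes>\<^sub>M borel) (\<lambda>(\<omega>, u). (\<omega>, Q \<omega> u))) X =
        emeasure (P \<Otimes>\<^sub>M U) {p \<in> space (P \<Otimes>\<^sub>M U). fst p \<in> E \<and> case_prod Q p < t}"
      using E by (subst emeasure_distr[OF Qp]) (auto simp: X split_beta' intro!: arg_cong[where f="emeasure (P \<Otimes>\<^sub>M U)"])
    ultimately show "emeasure (distr m (P \<Otimes>\<^sub>M borel) (\<lambda>p. (fst p, s p))) X =
        emeasure (distr (P \<Otimes>\<^sub>M U) (P \<Otimes>\<^sub>M borel) (\<lambda>(\<omega>, u). (\<omega>, Q \<omega> u))) X"
      using key[OF E] by simp
  next
    show "(\<Union>i::nat. space P \<times> {..<real i}) = space P \<times> UNIV" using UN by blast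
  next
    fix i :: nat
    show "emeasure (distr m (P \<Otimes>\<^sub>M borel) (\<lambda>p. (fst p, s p))) (space P \<times> {..<real i}) \<noteq> \<infinity>"
      using finite_measure.emeasure_finite[OF m.finite_measure_distr[of "\<lambda>p. (fst p, s p)" "P \<Otimes>\<^sub>M borel"]]
      by simp
  qed (use gen in auto)
  then show thesis
    using that Qm unfolding U_def by blast
qed

text \<open>Code the fibre by \<open>s\<close>, take the conditional quantile, and decode:
  \<open>\<kappa> \<omega>\<close> is the law of \<open>g (Q \<omega> u)\<close> for a uniform
  \<open>u\<close>. This is a probability measure for every \<open>\<omega>\<close>, without an
  exceptional set, and joint measurability of \<open>Q\<close> makes it a kernel.\<close>

lemma disintegration_exists:
  fixes P :: "'b measure" and m :: "('b \<times> 'a::metric_space) measure"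
  assumes comp: "compact (UNIV :: 'a set)" and P: "prob_space P" and m: "prob_space m"
    and sm: "sets m = sets (P \<Otimes>\<^sub>M borel)" and mP: "distr m P fst = P"
  obtains \<kappa> where "\<kappa> \<in> measurable P (prob_algebra borel)"
    "\<And>A. A \<in> sets m \<Longrightarrow> emeasure m A = (\<integral>\<^sup>+\<omega>. emeasure (\<kappa> \<omega>) {x. (\<omega>, x) \<in> A} \<partial>P)"
proof -
  interpret P: prob_space P by fact
  note [measurable_cong] = sm
  obtain C and s :: "'a \<Rightarrow> real" and g where C: "C \<subseteq> {0..1}"
    and s [measurable]: "s \<in> borel_measurable borel" and sC: "\<And>x. s x \<in> C"
    and gs: "\<And>x. g (s x) = x" and g [measurable]: "g \<in> borel_measurable borel"
    by (rule real_coding[OF comp]) (rule that)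
  define U where "U = uniform_measure lborel {0..1::real}"
  interpret U: prob_space U
    unfolding U_def by (rule prob_space_uniform_measure) auto
  have setsU [measurable_cong]: "sets U = sets borel" by (simp add: U_def)
  have UU: "space U = UNIV" using sets_eq_imp_space_eq[OF setsU] by simp
  have fst: "fst \<in> measurable m P" by measurable
  have s01: "s (snd p) \<in> {0..1}" for p :: "'b \<times> 'a"
    using sC C by (rule subsetD[rotated])
  have ss: "(\<lambda>p. s (snd p)) \<in> borel_measurable m" by measurable
  obtain Q where Q [measurable]: "case_prod Q \<in> borel_measurable (P \<Otimes>\<^sub>M U)"
    and eq: "distr m (P \<Otimes>\<^sub>M borel) (\<lambda>p. (fst p, s (snd p))) =
      distr (P \<Otimes>\<^sub>M U) (P \<Otimes>\<^sub>M borel) (\<lambda>(\<omega>, u). (\<omega>, Q \<omega> u))"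
    by (rule real_conditional_quantile[OF P m fst mP ss, OF s01, folded U_def]) (rule that)
  define \<kappa> where "\<kappa> \<omega> = distr U borel (\<lambda>u. g (Q \<omega> u))" for \<omega>
  have gQ [measurable]: "(\<lambda>(\<omega>, u). g (Q \<omega> u)) \<in> measurable (P \<Otimes>\<^sub>M U) borel"
    using measurable_compose[OF Q g] by (simp add: split_beta')
  show thesis
  proof (rule that[of \<kappa>])
    have "(\<lambda>_. U) \<in> measurable P (prob_algebra U)"
      by (rule measurable_const) (simp add: space_prob_algebra U.prob_space_axioms)
    then show "\<kappa> \<in> measurable P (prob_algebra borel)"
      unfolding \<kappa>_def by (rule measurable_distr_prob_space2) (rule gQ)
    fix A assume A: "A \<in> sets m"
    then have A' [measurable]: "A \<in> sets (P \<Otimes>\<^sub>M borel)" using sm by simp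
    define B where "B = (\<lambda>(\<omega>, t). (\<omega>, g t)) -` A \<inter> space (P \<Otimes>\<^sub>M (borel :: real measure))"
    have gp: "(\<lambda>(\<omega>, t). (\<omega>, g t)) \<in> measurable (P \<Otimes>\<^sub>M (borel :: real measure)) (P \<Otimes>\<^sub>M borel)"
      by measurable
    have B [measurable]: "B \<in> sets (P \<Otimes>\<^sub>M (borel :: real measure))"
      unfolding B_def by (rule measurable_sets[OF gp A'])
    have spm: "space m = space P \<times> UNIV"
      using sets_eq_imp_space_eq[OF sm] by (simp add: space_pair_measure)
    have "(\<lambda>p. (fst p, s (snd p))) -` B \<inter> space m = A"
      using sets.sets_into_space[OF A] unfolding spm B_def
      by (auto simp: space_pair_measure gs)
    then have "emeasure m A = emeasure (distr m (P \<Otimes>\<^sub>M borel) (\<lambda>p. (fst p, s (snd p)))) B"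
      by (subst emeasure_distr) auto
    also have "\<dots> = emeasure (P \<Otimes>\<^sub>M U) ((\<lambda>(\<omega>, u). (\<omega>, Q \<omega> u)) -` B \<inter> space (P \<Otimes>\<^sub>M U))"
      unfolding eq by (subst emeasure_distr) auto
    also have "\<dots> = (\<integral>\<^sup>+\<omega>. emeasure U (Pair \<omega> -` ((\<lambda>(\<omega>, u). (\<omega>, Q \<omega> u)) -` B \<inter> space (P \<Otimes>\<^sub>M U))) \<partial>P)"
      by (rule U.emeasure_pair_measure_alt) measurable
    also have "\<dots> = (\<integral>\<^sup>+\<omega>. emeasure (\<kappa> \<omega>) {x. (\<omega>, x) \<in> A} \<partial>P)"
    proof (rule nn_integral_cong)
      fix \<omega> assume \<omega>: "\<omega> \<in> space P"
      have "{x. (\<omega>, x) \<in> A} \<in> sets borel"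
        using sets_Pair1[OF A', of \<omega>] by (simp add: vimage_def)
      moreover have "(\<lambda>u. g (Q \<omega> u)) \<in> measurable U borel"
        using measurable_compose[OF measurable_Pair1'[OF \<omega>] gQ] by simp
      ultimately show "emeasure U (Pair \<omega> -` ((\<lambda>(\<omega>, u). (\<omega>, Q \<omega> u)) -` B \<inter> space (P \<Otimes>\<^sub>M U))) =
          emeasure (\<kappa> \<omega>) {x. (\<omega>, x) \<in> A}"
        unfolding \<kappa>_def using \<omega>
        by (subst emeasure_distr) (auto simp: B_def space_pair_measure UU intro!: arg_cong[where f="emeasure U"])
    qed
    finally show "emeasure m A = (\<integral>\<^sup>+\<omega>. emeasure (\<kappa> \<omega>) {x. (\<omega>, x) \<in> A} \<partial>P)" .
  qed
qed

section \<open>Inverse branches and preimage counts\<close>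

definition preim :: "(nat \<Rightarrow> 'a \<Rightarrow> 'a) \<Rightarrow> (int \<Rightarrow> nat) \<Rightarrow> nat \<Rightarrow> 'a \<Rightarrow> 'a set" where
  "preim T \<omega> n z = fiber_iter T \<omega> n -` {z}"

definition cnt :: "(nat \<Rightarrow> 'a \<Rightarrow> 'a) \<Rightarrow> (int \<Rightarrow> nat) \<Rightarrow> nat \<Rightarrow> 'a \<Rightarrow> real" where
  "cnt T \<omega> n z = real (card (preim T \<omega> n z))"

text \<open>The composition of \<open>n\<close> successive transfer operators along the orbit of
  \<open>\<omega>\<close>.\<close>

definition tsum :: "(nat \<Rightarrow> 'a \<Rightarrow> 'a) \<Rightarrow> (int \<Rightarrow> nat) \<Rightarrow> nat \<Rightarrow> ('a \<Rightarrow> real) \<Rightarrow> 'a \<Rightarrow> real" where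
  "tsum T \<omega> n \<psi> z = (\<Sum>y\<in>preim T \<omega> n z. \<psi> y)"

text \<open>Normalizing by the count instead of by eigenvalues gives a positive operator that fixes
  constants and is available before any eigenvalue has been constructed.\<close>

definition avg :: "(nat \<Rightarrow> 'a \<Rightarrow> 'a) \<Rightarrow> (int \<Rightarrow> nat) \<Rightarrow> nat \<Rightarrow> ('a \<Rightarrow> real) \<Rightarrow> 'a \<Rightarrow> real" where
  "avg T \<omega> n \<psi> z = tsum T \<omega> n \<psi> z / cnt T \<omega> n z"

lemma shift_pow_0 [simp]: "shift_pow 0 \<omega> = \<omega>"
  by (simp add: shift_pow_def)

lemma shift_pow_add [simp]: "shift_pow m (shift_pow n \<omega>) = shift_pow (m + n) \<omega>"
  by (auto simp: shift_pow_def fun_eq_iff algebra_simps)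

lemma shift_pow_apply: "shift_pow n \<omega> i = \<omega> (i + n)"
  by (simp add: shift_pow_def)

lemma shift_eq_shift_pow: "shift = shift_pow 1"
  by (auto simp: shift_def shift_pow_def fun_eq_iff)

lemma shift_pow_full_shift [simp]: "shift_pow n \<omega> \<in> full_shift l \<longleftrightarrow> \<omega> \<in> full_shift l"
  unfolding full_shift_def shift_pow_def
  by (auto, metis diff_add_cancel)

lemma fiber_iter_add:
  "fiber_iter T \<omega> (n + k) x = fiber_iter T (shift_pow (int n) \<omega>) k (fiber_iter T \<omega> n x)"
  by (induction k) (auto simp: shift_pow_apply add_ac)

lemma fiber_iter_cong:
  assumes "\<And>i. i < n \<Longrightarrow> \<omega> (int i) = \<omega>' (int i)"
  shows "fiber_iter T \<omega> n = fiber_iter T \<omega>' n"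
  using assms by (induction n) auto

lemma transfer_eq_tsum: "transfer T \<omega> \<psi> = tsum T \<omega> 1 \<psi>"
  by (auto simp: transfer_def tsum_def preim_def fun_eq_iff)

lemma cnt_eq_tsum: "cnt T \<omega> n z = tsum T \<omega> n (\<lambda>_. 1) z"
  by (simp add: cnt_def tsum_def)

lemma preim_0 [simp]: "preim T \<omega> 0 z = {z}"
  by (auto simp: preim_def)

lemma tsum_0 [simp]: "tsum T \<omega> 0 \<psi> z = \<psi> z"
  by (simp add: tsum_def)

lemma preim_add: "preim T \<omega> (n + k) z = (\<Union>w\<in>preim T (shift_pow (int n) \<omega>) k z. preim T \<omega> n w)"
  by (auto simp: preim_def fiber_iter_add)

text \<open>Conditions (A1) to (A3) in the form in which they are applied: per symbol instead of per
  sequence, and with a covering time \<open>N\<close> for the scale \<open>\<delta> / 2\<close>.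
  That is the scale at which inverse branches from neighbouring points can be matched.\<close>

locale expanding_ifs =
  fixes l :: nat and T :: "nat \<Rightarrow> 'a::metric_space \<Rightarrow> 'a" and D N :: nat and \<delta> \<rho> :: real
  assumes comp: "compact (UNIV :: 'a set)"
    and cont: "\<And>i. i < l \<Longrightarrow> continuous_on UNIV (T i)"
    and surj: "\<And>i. i < l \<Longrightarrow> surj (T i)"
    and fin: "\<And>i z. i < l \<Longrightarrow> finite (T i -` {z})"
    and card_le: "\<And>i z. i < l \<Longrightarrow> card (T i -` {z}) \<le> D"
    and \<delta>: "0 < \<delta>" and \<rho>: "0 < \<rho>" "\<rho> < 1"
    and expand: "\<And>i x x'. i < l \<Longrightarrow> dist x x' \<le> \<delta> \<Longrightarrow> dist x x' \<le> \<rho> * dist (T i x) (T i x')"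
    and ball_image: "\<And>i x. i < l \<Longrightarrow> ball (T i x) \<delta> \<subseteq> T i ` ball x \<delta>"
    and N: "0 < N"
    and cover: "\<And>\<omega> x. \<omega> \<in> full_shift l \<Longrightarrow> fiber_iter T \<omega> N ` ball x (\<delta> / 2) = UNIV"
begin

abbreviation "\<Sigma> \<equiv> full_shift l"

lemma \<Sigma>_less: "\<omega> \<in> \<Sigma> \<Longrightarrow> \<omega> i < l"
  by (simp add: full_shift_def)

lemma cont_iter: "\<omega> \<in> \<Sigma> \<Longrightarrow> continuous_on UNIV (fiber_iter T \<omega> n)"
proof (induction n)
  case (Suc n)
  then have "continuous_on UNIV (fiber_iter T \<omega> n)" "continuous_on UNIV (T (\<omega> (int n)))"
    using cont[OF \<Sigma>_less[OF Suc.prems]] by auto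
  then show ?case
    unfolding fiber_iter.simps by (intro continuous_on_compose) (auto intro: continuous_on_subset)
qed (auto intro: continuous_on_id simp: id_def)

lemma surj_iter: "\<omega> \<in> \<Sigma> \<Longrightarrow> surj (fiber_iter T \<omega> n)"
  by (induction n) (auto intro!: comp_surj surj \<Sigma>_less simp del: o_apply)

lemma finite_preim: "\<omega> \<in> \<Sigma> \<Longrightarrow> finite (preim T \<omega> n z)"
proof (induction n arbitrary: z)
  case (Suc n)
  have "preim T (shift_pow (int n) \<omega>) 1 z = T (\<omega> (int n)) -` {z}"
    by (auto simp: preim_def shift_pow_apply)
  then show ?case
    using Suc fin[OF \<Sigma>_less[OF Suc.prems]] preim_add[of T \<omega> n 1 z] by simp
qed auto

lemma preim_nonempty: "\<omega> \<in> \<Sigma> \<Longrightarrow> preim T \<omega> n z \<noteq> {}"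
  using surjD[OF surj_iter, of \<omega> z n] by (auto simp: preim_def)

lemma cnt_ge_1: "\<omega> \<in> \<Sigma> \<Longrightarrow> 1 \<le> cnt T \<omega> n z"
  unfolding cnt_def using finite_preim[of \<omega> n z] preim_nonempty[of \<omega> n z]
  by (simp add: Suc_le_eq card_gt_0_iff)

lemma cnt_pos: "\<omega> \<in> \<Sigma> \<Longrightarrow> 0 < cnt T \<omega> n z"
  using cnt_ge_1[of \<omega> n z] by linarith

lemma tsum_add:
  assumes \<omega>: "\<omega> \<in> \<Sigma>"
  shows "tsum T \<omega> (n + k) \<psi> z = tsum T (shift_pow (int n) \<omega>) k (tsum T \<omega> n \<psi>) z"
  unfolding tsum_def preim_add
  by (rule sum.UNION_disjoint) (use \<omega> in \<open>auto simp: finite_preim\<close>, auto simp: preim_def)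

lemma cnt_add:
  assumes \<omega>: "\<omega> \<in> \<Sigma>"
  shows "cnt T \<omega> (n + k) z = (\<Sum>y\<in>preim T (shift_pow (int n) \<omega>) k z. cnt T \<omega> n y)"
  unfolding cnt_eq_tsum tsum_add[OF \<omega>] unfolding tsum_def ..

lemma cnt_le_D: "\<omega> \<in> \<Sigma> \<Longrightarrow> cnt T \<omega> n z \<le> real D ^ n"
proof (induction n arbitrary: z)
  case (Suc n)
  have eq: "preim T (shift_pow (int n) \<omega>) 1 z = T (\<omega> (int n)) -` {z}"
    by (auto simp: preim_def shift_pow_apply)
  have "cnt T \<omega> (n + 1) z \<le> (\<Sum>y\<in>T (\<omega> (int n)) -` {z}. real D ^ n)"
    unfolding cnt_add[OF Suc.prems] eq by (intro sum_mono Suc)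
  also have "\<dots> \<le> real D * real D ^ n"
    using card_le[OF \<Sigma>_less[OF Suc.prems]] by (simp add: mult_right_mono)
  finally show ?case by simp
qed (simp add: cnt_def)

lemma D_ge_1: "\<omega> \<in> \<Sigma> \<Longrightarrow> 1 \<le> real D"
  using cnt_ge_1[of \<omega> 1 undefined] cnt_le_D[of \<omega> 1 undefined] by simp

text \<open>Lift one step at a time, backward from the end. \<open>ball_image\<close> finds a
  preimage within \<open>\<delta>\<close> of the orbit; expansion then improves this to
  \<open>\<rho>\<close> times the distance just treated, so the strict bound by
  \<open>\<delta>\<close> is available again for the next lift.\<close>

lemma inverse_branch:
  assumes \<omega>: "\<omega> \<in> \<Sigma>" and d: "dist (fiber_iter T \<omega> n y) z < \<delta>"
  shows "\<exists>y'. fiber_iter T \<omega> n y' = z \<and>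
    (\<forall>k\<le>n. dist (fiber_iter T \<omega> k y) (fiber_iter T \<omega> k y') \<le> \<rho> ^ (n - k) * dist (fiber_iter T \<omega> n y) z)"
  using d
proof (induction n arbitrary: z)
  case (Suc n)
  let ?i = "\<omega> (int n)" and ?w = "fiber_iter T \<omega> n y"
  have i: "?i < l" using \<omega> by (rule \<Sigma>_less)
  have "z \<in> ball (T ?i ?w) \<delta>" using Suc.prems by simp
  then obtain w' where w': "w' \<in> ball ?w \<delta>" "z = T ?i w'"
    using ball_image[OF i] by blast
  then have le: "dist ?w w' \<le> \<rho> * dist (T ?i ?w) z"
    using expand[OF i, of ?w w'] by simp
  also have "\<dots> \<le> 1 * dist (T ?i ?w) z"
    using \<rho> by (intro mult_right_mono) auto
  also have "\<dots> < \<delta>" using Suc.prems by simp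
  finally obtain y' where y': "fiber_iter T \<omega> n y' = w'"
    "\<And>k. k \<le> n \<Longrightarrow> dist (fiber_iter T \<omega> k y) (fiber_iter T \<omega> k y') \<le> \<rho> ^ (n - k) * dist ?w w'"
    using Suc.IH[of w'] by blast
  show ?case
  proof (intro exI[of _ y'] conjI allI impI)
    show "fiber_iter T \<omega> (Suc n) y' = z" using y' w' by simp
    fix k assume k: "k \<le> Suc n"
    show "dist (fiber_iter T \<omega> k y) (fiber_iter T \<omega> k y') \<le> \<rho> ^ (Suc n - k) * dist (fiber_iter T \<omega> (Suc n) y) z"
    proof (cases "k = Suc n")
      case True then show ?thesis using y' w' by simp
    next
      case False
      then have "k \<le> n" using k by simp
      then have "dist (fiber_iter T \<omega> k y) (fiber_iter T \<omega> k y') \<le> \<rho> ^ (n - k) * (\<rho> * dist (T ?i ?w) z)"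
        by (intro order_trans[OF y'(2)] mult_left_mono le) (use \<rho> in auto)
      also have "\<dots> = \<rho> ^ (Suc n - k) * dist (fiber_iter T \<omega> (Suc n) y) z"
        using \<open>k \<le> n\<close> by (simp add: Suc_diff_le)
      finally show ?thesis .
    qed
  qed
qed auto

text \<open>Two points within \<open>\<delta>\<close> of each other and with the same image coincide
  by expansion; this makes the images agree one step earlier, and so on back to time 0.\<close>

lemma backward_unique:
  assumes \<omega>: "\<omega> \<in> \<Sigma>" and eq: "fiber_iter T \<omega> n x = fiber_iter T \<omega> n y"
    and d: "\<And>k. k < n \<Longrightarrow> dist (fiber_iter T \<omega> k x) (fiber_iter T \<omega> k y) \<le> \<delta>"
  shows "x = y"
  using eq d
proof (induction n)
  case (Suc n)
  let ?x = "fiber_iter T \<omega> n x" and ?y = "fiber_iter T \<omega> n y"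
  have "dist ?x ?y \<le> \<rho> * dist (T (\<omega> (int n)) ?x) (T (\<omega> (int n)) ?y)"
    by (rule expand[OF \<Sigma>_less[OF \<omega>]]) (use Suc.prems in auto)
  then have "?x = ?y" using Suc.prems(1) by simp
  then show ?case using Suc by auto
qed auto

text \<open>Sending \<open>y\<close> to its lift over \<open>z'\<close> is injective: two points
  with the same lift both stay within \<open>\<delta> / 2\<close> of its orbit, hence within
  \<open>\<delta>\<close> of each other, and \<open>backward_unique\<close> applies. The same
  construction from \<open>z'\<close> to \<open>z\<close> equalizes the finite cardinalities, so the
  injection is onto.\<close>

lemma branch_bij:
  assumes \<omega>: "\<omega> \<in> \<Sigma>" and d: "dist z z' < \<delta> / 2"
  obtains f where "bij_betw f (preim T \<omega> n z) (preim T \<omega> n z')"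
    "\<And>y. y \<in> preim T \<omega> n z \<Longrightarrow> dist y (f y) \<le> \<rho> ^ n * dist z z'"
proof -
  have ex: "\<exists>f. inj_on f (preim T \<omega> n z) \<and> f ` preim T \<omega> n z \<subseteq> preim T \<omega> n z' \<and>
      (\<forall>y\<in>preim T \<omega> n z. dist y (f y) \<le> \<rho> ^ n * dist z z')" if d: "dist z z' < \<delta> / 2" for z z'
  proof -
    have dz: "dist z z' < \<delta>" using d \<delta> by simp
    have "\<forall>y\<in>preim T \<omega> n z. \<exists>y'. fiber_iter T \<omega> n y' = z' \<and>
        (\<forall>k\<le>n. dist (fiber_iter T \<omega> k y) (fiber_iter T \<omega> k y') \<le> \<rho> ^ (n - k) * dist z z')"
    proof
      fix y assume "y \<in> preim T \<omega> n z"
      then have "fiber_iter T \<omega> n y = z" by (simp add: preim_def)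
      then show "\<exists>y'. fiber_iter T \<omega> n y' = z' \<and>
        (\<forall>k\<le>n. dist (fiber_iter T \<omega> k y) (fiber_iter T \<omega> k y') \<le> \<rho> ^ (n - k) * dist z z')"
        using inverse_branch[OF \<omega>, of n y z'] dz by simp
    qed
    from bchoice[OF this] obtain f where f: "\<And>y. y \<in> preim T \<omega> n z \<Longrightarrow> fiber_iter T \<omega> n (f y) = z'"
      "\<And>y k. y \<in> preim T \<omega> n z \<Longrightarrow> k \<le> n \<Longrightarrow>
        dist (fiber_iter T \<omega> k y) (fiber_iter T \<omega> k (f y)) \<le> \<rho> ^ (n - k) * dist z z'"
      by blast
    have "inj_on f (preim T \<omega> n z)"
    proof (rule inj_onI)
      fix y1 y2 assume y: "y1 \<in> preim T \<omega> n z" "y2 \<in> preim T \<omega> n z" and e: "f y1 = f y2"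
      show "y1 = y2"
      proof (rule backward_unique[OF \<omega>])
        show "fiber_iter T \<omega> n y1 = fiber_iter T \<omega> n y2" using y by (simp add: preim_def)
        fix k assume k: "k < n"
        have p: "\<rho> ^ (n - k) * dist z z' \<le> 1 * (\<delta> / 2)"
          using \<rho> d by (intro mult_mono power_le_one) auto
        have "dist (fiber_iter T \<omega> k y1) (fiber_iter T \<omega> k (f y1)) \<le> \<delta> / 2"
          by (rule order_trans[OF f(2)[OF y(1)]]) (use k p in auto)
        moreover have "dist (fiber_iter T \<omega> k y2) (fiber_iter T \<omega> k (f y1)) \<le> \<delta> / 2"
          unfolding e by (rule order_trans[OF f(2)[OF y(2)]]) (use k p in auto)
        ultimately show "dist (fiber_iter T \<omega> k y1) (fiber_iter T \<omega> k y2) \<le> \<delta>"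
          using dist_triangle2[of "fiber_iter T \<omega> k y1" "fiber_iter T \<omega> k y2" "fiber_iter T \<omega> k (f y1)"]
          by linarith
      qed
    qed
    moreover have "f ` preim T \<omega> n z \<subseteq> preim T \<omega> n z'"
      using f(1) by (auto simp: preim_def)
    moreover have "\<forall>y\<in>preim T \<omega> n z. dist y (f y) \<le> \<rho> ^ n * dist z z'"
      using f(2)[of _ 0] by simp
    ultimately show ?thesis by blast
  qed
  obtain f where f: "inj_on f (preim T \<omega> n z)" "f ` preim T \<omega> n z \<subseteq> preim T \<omega> n z'"
    "\<forall>y\<in>preim T \<omega> n z. dist y (f y) \<le> \<rho> ^ n * dist z z'"
    using ex[OF d] by blast
  obtain g where g: "inj_on g (preim T \<omega> n z')" "g ` preim T \<omega> n z' \<subseteq> preim T \<omega> n z"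
    using ex[of z' z] d by (auto simp: dist_commute)
  have "card (preim T \<omega> n z) = card (preim T \<omega> n z')"
    by (intro antisym card_inj_on_le[OF f(1,2)] card_inj_on_le[OF g] finite_preim \<omega>)
  then have "f ` preim T \<omega> n z = preim T \<omega> n z'"
    using f(1,2) by (intro card_subset_eq) (auto simp: card_image finite_preim \<omega>)
  then show thesis
    using that[of f] f by (simp add: bij_betw_def)
qed

lemma cnt_local: "\<omega> \<in> \<Sigma> \<Longrightarrow> dist z z' < \<delta> / 2 \<Longrightarrow> cnt T \<omega> n z = cnt T \<omega> n z'"
  unfolding cnt_def by (rule branch_bij[of \<omega> z z' n]) (auto dest: bij_betw_same_card)

lemma tsum_close:
  assumes \<omega>: "\<omega> \<in> \<Sigma>" and d: "dist z z' < \<delta> / 2"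
    and e: "\<And>y y'. dist y y' \<le> \<rho> ^ n * dist z z' \<Longrightarrow> \<bar>\<psi> y - \<psi> y'\<bar> \<le> e"
  shows "\<bar>tsum T \<omega> n \<psi> z - tsum T \<omega> n \<psi> z'\<bar> \<le> cnt T \<omega> n z * e"
proof -
  obtain f where f: "bij_betw f (preim T \<omega> n z) (preim T \<omega> n z')"
    "\<And>y. y \<in> preim T \<omega> n z \<Longrightarrow> dist y (f y) \<le> \<rho> ^ n * dist z z'"
    using branch_bij[OF \<omega> d] by blast
  have "tsum T \<omega> n \<psi> z' = (\<Sum>y\<in>preim T \<omega> n z. \<psi> (f y))"
    unfolding tsum_def by (rule sum.reindex_bij_betw[OF f(1), symmetric])
  then have "\<bar>tsum T \<omega> n \<psi> z - tsum T \<omega> n \<psi> z'\<bar> = \<bar>\<Sum>y\<in>preim T \<omega> n z. \<psi> y - \<psi> (f y)\<bar>"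
    by (simp add: tsum_def sum_subtractf)
  also have "\<dots> \<le> (\<Sum>y\<in>preim T \<omega> n z. e)"
    by (intro order_trans[OF sum_abs] sum_mono e f(2))
  finally show ?thesis by (simp add: cnt_def)
qed

lemma avg_close:
  assumes \<omega>: "\<omega> \<in> \<Sigma>" and d: "dist z z' < \<delta> / 2"
    and e: "\<And>y y'. dist y y' \<le> \<rho> ^ n * dist z z' \<Longrightarrow> \<bar>\<psi> y - \<psi> y'\<bar> \<le> e"
  shows "\<bar>avg T \<omega> n \<psi> z - avg T \<omega> n \<psi> z'\<bar> \<le> e"
proof -
  have "avg T \<omega> n \<psi> z - avg T \<omega> n \<psi> z' = (tsum T \<omega> n \<psi> z - tsum T \<omega> n \<psi> z') / cnt T \<omega> n z"
    unfolding avg_def cnt_local[OF \<omega> d] by (simp add: diff_divide_distrib)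
  then show ?thesis
    using tsum_close[OF assms] cnt_pos[OF \<omega>, of n z] by (simp add: pos_divide_le_eq mult.commute[of e])
qed

lemma tsum_continuous:
  assumes \<omega>: "\<omega> \<in> \<Sigma>" and \<psi>: "continuous_on UNIV \<psi>"
  shows "continuous_on UNIV (tsum T \<omega> n \<psi>)"
  unfolding continuous_on_iff
proof (intro ballI allI impI)
  fix z :: 'a and e :: real assume "0 < e"
  define e' where "e' = e / (2 * cnt T \<omega> n z)"
  have c: "0 < cnt T \<omega> n z" by (rule cnt_pos[OF \<omega>])
  have "0 < e'" unfolding e'_def using \<open>0 < e\<close> c by simp
  then obtain d where d: "d > 0" "\<And>x x'. dist x' x < d \<Longrightarrow> dist (\<psi> x') (\<psi> x) < e'"
    using compact_uniformly_continuous[OF \<psi> comp] unfolding uniformly_continuous_on_def by blast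
  show "\<exists>d>0. \<forall>x'\<in>UNIV. dist x' z < d \<longrightarrow> dist (tsum T \<omega> n \<psi> x') (tsum T \<omega> n \<psi> z) < e"
  proof (intro exI[of _ "min d (\<delta> / 2)"] conjI ballI impI)
    fix z' assume z': "dist z' z < min d (\<delta> / 2)"
    have "\<bar>tsum T \<omega> n \<psi> z - tsum T \<omega> n \<psi> z'\<bar> \<le> cnt T \<omega> n z * e'"
    proof (rule tsum_close[OF \<omega>])
      show "dist z z' < \<delta> / 2" using z' by (simp add: dist_commute)
      fix y y' :: 'a assume "dist y y' \<le> \<rho> ^ n * dist z z'"
      also have "\<dots> \<le> 1 * dist z z'"
        using \<rho> by (intro mult_right_mono power_le_one) auto
      also have "\<dots> < d" using z' by (simp add: dist_commute)
      finally show "\<bar>\<psi> y - \<psi> y'\<bar> \<le> e'" using d(2)[of y y'] by (simp add: dist_real_def)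
    qed
    also have "\<dots> < e" unfolding e'_def using c \<open>0 < e\<close> by simp
    finally show "dist (tsum T \<omega> n \<psi> z') (tsum T \<omega> n \<psi> z) < e"
      by (simp add: dist_real_def abs_minus_commute)
  qed (use d \<delta> in auto)
qed

section \<open>Comparability of preimage counts\<close>

definition K :: real where "K = max 1 (real D ^ N)"

text \<open>The \<open>max\<close> with 1 in \<open>K\<close> takes care of \<open>l = 0\<close>,
  where \<open>\<Sigma>\<close> is empty and \<open>D\<close> may be 0. Otherwise \<open>K\<close>
  is the bound \<open>D ^ N\<close> for the number of \<open>N\<close>-step preimages.\<close>

lemma K_ge_1: "1 \<le> K" by (simp add: K_def)

lemma cover_preim: "\<omega> \<in> \<Sigma> \<Longrightarrow> \<exists>y\<in>preim T \<omega> N z. dist w y < \<delta> / 2"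
proof -
  assume "\<omega> \<in> \<Sigma>"
  then have "z \<in> fiber_iter T \<omega> N ` ball w (\<delta> / 2)" by (simp add: cover)
  then show ?thesis by (auto simp: preim_def)
qed

text \<open>Some \<open>N\<close>-step preimage \<open>y\<close> of \<open>z\<close> lies within
  \<open>\<delta> / 2\<close> of \<open>w\<close>, where the count is the same as at
  \<open>w\<close>; the \<open>n\<close>-step preimages of \<open>y\<close> are among the points
  counted at \<open>z\<close>.\<close>

lemma cnt_mono:
  assumes \<omega>: "\<omega> \<in> \<Sigma>"
  shows "cnt T \<omega> n w \<le> cnt T \<omega> (n + N) z"
proof -
  have \<omega>': "shift_pow (int n) \<omega> \<in> \<Sigma>" using \<omega> by simp
  obtain y where y: "y \<in> preim T (shift_pow (int n) \<omega>) N z" "dist w y < \<delta> / 2"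
    using cover_preim[OF \<omega>'] by blast
  have "cnt T \<omega> n w = cnt T \<omega> n y" by (rule cnt_local[OF \<omega> y(2)])
  also have "\<dots> \<le> (\<Sum>y\<in>preim T (shift_pow (int n) \<omega>) N z. cnt T \<omega> n y)"
    by (intro member_le_sum y finite_preim \<omega>' less_imp_le[OF cnt_pos] \<omega>)
  finally show ?thesis by (simp add: cnt_add[OF \<omega>])
qed

lemma card_preim_N_le: "\<omega> \<in> \<Sigma> \<Longrightarrow> real (card (preim T \<omega> N z)) \<le> K"
  unfolding K_def by (rule max.coboundedI2) (use cnt_le_D[of \<omega> N z, unfolded cnt_def] in blast)

text \<open>For \<open>n = m + N\<close>, each of the at most \<open>K\<close> preimages of
  \<open>z\<close> under the last \<open>N\<close> steps contributes a count over \<open>m\<close>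
  steps, and \<open>cnt_mono\<close> bounds that by the full count at \<open>z'\<close>. For
  \<open>n < N\<close> the crude bound \<open>D ^ N\<close> is enough.\<close>

lemma cnt_ratio:
  assumes \<omega>: "\<omega> \<in> \<Sigma>"
  shows "cnt T \<omega> n z \<le> K * cnt T \<omega> n z'"
proof (cases "n < N")
  case True
  have "cnt T \<omega> n z \<le> real D ^ n" by (rule cnt_le_D[OF \<omega>])
  also have "\<dots> \<le> real D ^ N" using True D_ge_1[OF \<omega>] by (intro power_increasing) auto
  also have "\<dots> \<le> K * 1" by (simp add: K_def)
  also have "\<dots> \<le> K * cnt T \<omega> n z'" using cnt_ge_1[OF \<omega>] K_ge_1 by (intro mult_left_mono) auto
  finally show ?thesis .
next
  case False
  then obtain m where n: "n = m + N" by (metis le_add_diff_inverse2 not_less)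
  have \<omega>': "shift_pow (int m) \<omega> \<in> \<Sigma>" using \<omega> by simp
  have "cnt T \<omega> n z \<le> (\<Sum>y\<in>preim T (shift_pow (int m) \<omega>) N z. cnt T \<omega> n z')"
    unfolding n cnt_add[OF \<omega>, of m N z] by (intro sum_mono cnt_mono[OF \<omega>])
  also have "\<dots> \<le> K * cnt T \<omega> n z'"
    using card_preim_N_le[OF \<omega>', of z] cnt_pos[OF \<omega>, of n z'] by (simp add: mult_right_mono)
  finally show ?thesis .
qed

section \<open>Averages over preimages as expectations of a backward walk\<close>

lemma avg_bounds:
  assumes \<omega>: "\<omega> \<in> \<Sigma>" and b: "\<And>x. a \<le> \<psi> x" "\<And>x. \<psi> x \<le> b"
  shows "a \<le> avg T \<omega> n \<psi> z" "avg T \<omega> n \<psi> z \<le> b"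
proof -
  have "(\<Sum>y\<in>preim T \<omega> n z. a) \<le> tsum T \<omega> n \<psi> z" "tsum T \<omega> n \<psi> z \<le> (\<Sum>y\<in>preim T \<omega> n z. b)"
    unfolding tsum_def by (intro sum_mono b)+
  then show "a \<le> avg T \<omega> n \<psi> z" "avg T \<omega> n \<psi> z \<le> b"
    using cnt_pos[OF \<omega>, of n z] unfolding avg_def by (auto simp: field_simps cnt_def)
qed

text \<open>The probability that a uniformly chosen preimage of \<open>z\<close> under
  \<open>n + k\<close> steps is mapped to \<open>y\<close> by the first \<open>n\<close> of them,
  that is, the law of the backward walk from \<open>z\<close> after \<open>k\<close> steps.\<close>

definition wt :: "(int \<Rightarrow> nat) \<Rightarrow> nat \<Rightarrow> nat \<Rightarrow> 'a \<Rightarrow> 'a \<Rightarrow> real" where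
  "wt \<omega> n k z y = cnt T \<omega> n y / cnt T \<omega> (n + k) z"

lemma wt_nonneg: "\<omega> \<in> \<Sigma> \<Longrightarrow> 0 \<le> wt \<omega> n k z y"
  unfolding wt_def using cnt_pos[of \<omega>] by (simp add: less_imp_le)

lemma wt_sum: "\<omega> \<in> \<Sigma> \<Longrightarrow> (\<Sum>y\<in>preim T (shift_pow (int n) \<omega>) k z. wt \<omega> n k z y) = 1"
  unfolding wt_def sum_divide_distrib[symmetric] cnt_add[symmetric] using cnt_pos[of \<omega> "n + k" z] by simp

lemma avg_add:
  assumes \<omega>: "\<omega> \<in> \<Sigma>"
  shows "avg T \<omega> (n + k) \<psi> z = (\<Sum>y\<in>preim T (shift_pow (int n) \<omega>) k z. wt \<omega> n k z y * avg T \<omega> n \<psi> y)"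
proof -
  have "avg T \<omega> n \<psi> y * cnt T \<omega> n y = tsum T \<omega> n \<psi> y" for y
    unfolding avg_def using cnt_pos[OF \<omega>, of n y] by simp
  then show ?thesis
    unfolding avg_def[of T \<omega> "n + k"] tsum_add[OF \<omega>] wt_def
    by (simp add: tsum_def[of T "shift_pow (int n) \<omega>"] sum_divide_distrib mult.commute)
qed

text \<open>The two factors \<open>K\<close> have different sources: comparability of counts at
  different points, and the number of \<open>N\<close>-step preimages.\<close>

lemma wt_lower:
  assumes \<omega>: "\<omega> \<in> \<Sigma>"
  shows "1 / K\<^sup>2 \<le> wt \<omega> n N z y"
proof -
  have \<omega>': "shift_pow (int n) \<omega> \<in> \<Sigma>" using \<omega> by simp
  have "cnt T \<omega> (n + N) z \<le> (\<Sum>y'\<in>preim T (shift_pow (int n) \<omega>) N z. K * cnt T \<omega> n y)"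
    unfolding cnt_add[OF \<omega>] by (intro sum_mono cnt_ratio[OF \<omega>])
  also have "\<dots> \<le> K * (K * cnt T \<omega> n y)"
    using card_preim_N_le[OF \<omega>', of z] cnt_pos[OF \<omega>, of n y] K_ge_1 by (simp add: mult_right_mono)
  finally show ?thesis
    unfolding wt_def using cnt_pos[OF \<omega>, of "n + N" z] K_ge_1 by (simp add: field_simps power2_eq_square)
qed

end

section \<open>Fibre measures and eigenvalues\<close>

lemma sum_nonpos_le_member:
  fixes g :: "'b \<Rightarrow> real"
  assumes "finite A" "a \<in> A" "\<And>x. x \<in> A \<Longrightarrow> g x \<le> 0"
  shows "sum g A \<le> g a"
  using sum.remove[OF assms(1,2), of g] sum_nonpos[of "A - {a}" g] assms(3) by auto

context expanding_ifs
begin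

text \<open>Two independent walks, each hitting a prescribed point with probability at least
  \<open>1 / K\<^sup>2\<close>.\<close>

definition c :: real where "c = 1 / K ^ 4"

lemma c_pos: "0 < c" and c_le_1: "c \<le> 1"
  using K_ge_1 by (auto simp: c_def)

text \<open>
  Coupling the backward walks from \<open>z\<close> and \<open>z'\<close> independently: by the covering property they
  reach neighbouring points with probability at least \<open>c\<close>.
\<close>

lemma osc_step:
  assumes \<omega>: "\<omega> \<in> \<Sigma>" and t: "\<And>z z'. avg T \<omega> n \<psi> z - avg T \<omega> n \<psi> z' \<le> t"
    and e: "\<And>z z'. dist z z' < \<delta> / 2 \<Longrightarrow> \<bar>avg T \<omega> n \<psi> z - avg T \<omega> n \<psi> z'\<bar> \<le> e"
  shows "avg T \<omega> (n + N) \<psi> z - avg T \<omega> (n + N) \<psi> z' \<le> (1 - c) * t + 2 * e"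
proof -
  let ?\<sigma> = "shift_pow (int n) \<omega>"
  have \<omega>': "?\<sigma> \<in> \<Sigma>" using \<omega> by simp
  define A where "A = preim T ?\<sigma> N z"
  define B where "B = preim T ?\<sigma> N z'"
  define p where "p = wt \<omega> n N z"
  define q where "q = wt \<omega> n N z'"
  define f where "f = avg T \<omega> n \<psi>"
  have fin: "finite A" "finite B" unfolding A_def B_def using \<omega>' by (auto simp: finite_preim)
  have p: "sum p A = 1" "\<And>y. 0 \<le> p y" "\<And>y. 1 / K\<^sup>2 \<le> p y"
    unfolding p_def A_def using \<omega> by (auto simp: wt_sum wt_nonneg wt_lower)
  have q: "sum q B = 1" "\<And>y. 0 \<le> q y" "\<And>y. 1 / K\<^sup>2 \<le> q y"
    unfolding q_def B_def using \<omega> by (auto simp: wt_sum wt_nonneg wt_lower)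
  have t0: "0 \<le> t" using t[of z z] by simp
  have e0: "0 \<le> e" using e[of z z] \<delta> by simp
  \<comment> \<open>The point \<open>z\<close> serves as meeting place for both walks. Comparing the
    averages at \<open>y\<close> and at \<open>y'\<close> with the one at \<open>z\<close> costs
    \<open>e\<close> twice.\<close>
  obtain y where y: "y \<in> A" "dist z y < \<delta> / 2" using cover_preim[OF \<omega>'] unfolding A_def by blast
  obtain y' where y': "y' \<in> B" "dist z y' < \<delta> / 2" using cover_preim[OF \<omega>'] unfolding B_def by blast
  \<comment> \<open>The integrand of the product coupling minus its upper bound \<open>t\<close>.
    All terms are nonpositive, so the whole sum is at most the single term at the meeting
    pair.\<close>
  define g where "g = (\<lambda>(a, b). p a * q b * (f a - f b - t))"
  have g0: "g x \<le> 0" for x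
  proof -
    obtain a b where x: "x = (a, b)" by (cases x)
    have "f a - f b - t \<le> 0" using t[of a b] by (simp add: f_def)
    then show ?thesis
      unfolding x g_def using p(2)[of a] q(2)[of b] by (simp add: mult_nonneg_nonpos)
  qed
  have "(\<Sum>x\<in>A \<times> B. g x) = (\<Sum>a\<in>A. \<Sum>b\<in>B. p a * q b * f a) - (\<Sum>a\<in>A. \<Sum>b\<in>B. p a * q b * f b)
      - (\<Sum>a\<in>A. \<Sum>b\<in>B. p a * q b * t)"
    unfolding g_def by (simp add: sum.cartesian_product[symmetric] algebra_simps sum_subtractf sum.distrib)
  also have "(\<Sum>a\<in>A. \<Sum>b\<in>B. p a * q b * f a) = (\<Sum>a\<in>A. p a * f a)"
  proof (rule sum.cong[OF refl])
    fix a
    have "(\<Sum>b\<in>B. p a * q b * f a) = p a * f a * sum q B"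
      unfolding sum_distrib_left by (simp add: mult_ac)
    then show "(\<Sum>b\<in>B. p a * q b * f a) = p a * f a" by (simp add: q)
  qed
  also have "(\<Sum>a\<in>A. \<Sum>b\<in>B. p a * q b * f b) = (\<Sum>b\<in>B. q b * f b)"
  proof -
    have "(\<Sum>a\<in>A. \<Sum>b\<in>B. p a * q b * f b) = sum p A * (\<Sum>b\<in>B. q b * f b)"
      unfolding sum_product by (simp add: mult_ac)
    then show ?thesis by (simp add: p)
  qed
  also have "(\<Sum>a\<in>A. \<Sum>b\<in>B. p a * q b * t) = t"
  proof -
    have "(\<Sum>a\<in>A. \<Sum>b\<in>B. p a * q b * t) = sum p A * (\<Sum>b\<in>B. q b * t)"
      unfolding sum_product by (simp add: mult_ac)
    then show ?thesis by (simp add: p q sum_distrib_right[symmetric])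
  qed
  finally have "(\<Sum>x\<in>A \<times> B. g x) = avg T \<omega> (n + N) \<psi> z - avg T \<omega> (n + N) \<psi> z' - t"
    unfolding avg_add[OF \<omega>] A_def B_def p_def q_def f_def .
  moreover have "(\<Sum>x\<in>A \<times> B. g x) \<le> g (y, y')"
    by (rule sum_nonpos_le_member) (use fin y y' g0 in auto)
  ultimately have main: "avg T \<omega> (n + N) \<psi> z - avg T \<omega> (n + N) \<psi> z' \<le> t + g (y, y')" by linarith
  show ?thesis
  \<comment> \<open>If \<open>t < 2 * e\<close> the meeting gains nothing, but then the bound
    \<open>t\<close> alone already implies the claim.\<close>
  proof (cases "2 * e \<le> t")
    case True
    have "f y - f y' \<le> 2 * e"
      using e[OF y(2)] e[OF y'(2)] unfolding f_def by linarith
    then have neg: "f y - f y' - t \<le> 2 * e - t" "2 * e - t \<le> 0" using True by auto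
    have pq: "c \<le> p y * q y'"
    proof -
      have "c = (1 / K\<^sup>2) * (1 / K\<^sup>2)" by (simp add: c_def power2_eq_square numeral_eq_Suc)
      also have "\<dots> \<le> p y * q y'" using p q by (intro mult_mono) auto
      finally show ?thesis .
    qed
    have "g (y, y') \<le> p y * q y' * (2 * e - t)"
      unfolding g_def using neg p(2)[of y] q(2)[of y'] by (simp add: mult_left_mono)
    also have "\<dots> \<le> c * (2 * e - t)"
      using pq neg by (intro mult_right_mono_neg) auto
    also have "c * (2 * e - t) \<le> 2 * e - c * t"
      using mult_right_mono[OF c_le_1 e0] by (simp add: algebra_simps)
    finally show ?thesis using main by (simp add: algebra_simps)
  next
    case False
    have "c * t \<le> 1 * t" using t0 c_le_1 by (intro mult_right_mono)
    then have "t \<le> (1 - c) * t + 2 * e" using False by (simp add: algebra_simps)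
    then show ?thesis using main g0[of "(y, y')"] by linarith
  qed
qed

section \<open>Decay of oscillation and convergence of averages\<close>

lemma avg_osc_le:
  assumes \<omega>: "\<omega> \<in> \<Sigma>" and t: "\<And>x y. \<psi> x - \<psi> y \<le> t"
  shows "avg T \<omega> n \<psi> z - avg T \<omega> n \<psi> z' \<le> t"
proof -
  have "\<psi> x \<le> \<psi> y + t" for x y using t[of x y] by simp
  moreover have "\<psi> y - t \<le> \<psi> x" for x y using t[of y x] by simp
  ultimately have 1: "avg T \<omega> n \<psi> z \<le> \<psi> y + t" for y
    by (rule avg_bounds(2)[OF \<omega>, rotated])
  have "avg T \<omega> n \<psi> z - t \<le> \<psi> y" for y using 1[of y] by simp
  moreover have "\<psi> y \<le> \<psi> undefined + t" for y using t[of y undefined] by simp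
  ultimately have "avg T \<omega> n \<psi> z - t \<le> avg T \<omega> n \<psi> z'"
    by (rule avg_bounds(1)[OF \<omega>])
  then show ?thesis by simp
qed

text \<open>With at least \<open>m\<close> backward steps, neighbouring end points have preimages so
  close that \<open>\<psi>\<close> changes by at most \<open>e\<close>. Each further
  \<open>N\<close> steps turn a bound \<open>t\<close> into \<open>(1 - c) * t + 2 * e\<close>; the
  fixed point of this map is \<open>2 * e / c\<close>, so the errors do not accumulate.\<close>

lemma osc_bound:
  assumes \<omega>: "\<omega> \<in> \<Sigma>" and t: "\<And>x y. \<psi> x - \<psi> y \<le> t"
    and e: "\<And>y y'. dist y y' < \<rho> ^ m * (\<delta> / 2) \<Longrightarrow> \<bar>\<psi> y - \<psi> y'\<bar> \<le> e"
  shows "avg T \<omega> (m + n) \<psi> z - avg T \<omega> (m + n) \<psi> z' \<le> (1 - c) ^ (n div N) * t + 2 * e / c"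
proof (induction n arbitrary: z z' rule: less_induct)
  case (less n)
  have e0: "0 \<le> e" using e[of z z] \<delta> \<rho> by simp
  show ?case
  proof (cases "n < N")
    case True
    have "avg T \<omega> (m + n) \<psi> z - avg T \<omega> (m + n) \<psi> z' \<le> t" by (rule avg_osc_le[OF \<omega> t])
    then show ?thesis using True e0 c_pos by (simp add: add_increasing2)
  next
    case False
    then obtain k where n: "n = k + N" by (metis le_add_diff_inverse2 not_less)
    have k: "k < n" using n N by simp
    have "avg T \<omega> (m + k + N) \<psi> z - avg T \<omega> (m + k + N) \<psi> z' \<le> (1 - c) * ((1 - c) ^ (k div N) * t + 2 * e / c) + 2 * e"
    proof (rule osc_step[OF \<omega>])
      show "avg T \<omega> (m + k) \<psi> z - avg T \<omega> (m + k) \<psi> z' \<le> (1 - c) ^ (k div N) * t + 2 * e / c" for z z'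
        by (rule less.IH[OF k])
      fix z z' :: 'a assume d: "dist z z' < \<delta> / 2"
      show "\<bar>avg T \<omega> (m + k) \<psi> z - avg T \<omega> (m + k) \<psi> z'\<bar> \<le> e"
      proof (rule avg_close[OF \<omega> d])
        fix y y' :: 'a assume "dist y y' \<le> \<rho> ^ (m + k) * dist z z'"
        also have "\<dots> \<le> \<rho> ^ m * dist z z'"
          using \<rho> by (intro mult_right_mono power_decreasing) auto
        also have "\<dots> < \<rho> ^ m * (\<delta> / 2)"
          using d \<rho> by simp
        finally show "\<bar>\<psi> y - \<psi> y'\<bar> \<le> e" by (rule e)
      qed
    qed
    also have "\<dots> = (1 - c) ^ (n div N) * t + 2 * e / c"
      using N c_pos by (simp add: n field_simps)
    finally show ?thesis by (simp add: n add.assoc)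
  qed
qed

text \<open>A longer average is a weighted mean of shorter ones over different end points, so the
  oscillation at stage \<open>n\<close> controls all later stages.\<close>

lemma avg_tail:
  assumes \<omega>: "\<omega> \<in> \<Sigma>" and o: "\<And>z z'. avg T \<omega> n \<psi> z - avg T \<omega> n \<psi> z' \<le> b"
  shows "\<bar>avg T \<omega> (n + k) \<psi> z - avg T \<omega> n \<psi> z'\<bar> \<le> b"
proof -
  let ?A = "preim T (shift_pow (int n) \<omega>) k z"
  have "avg T \<omega> (n + k) \<psi> z - avg T \<omega> n \<psi> z' =
      (\<Sum>y\<in>?A. wt \<omega> n k z y * avg T \<omega> n \<psi> y) - (\<Sum>y\<in>?A. wt \<omega> n k z y) * avg T \<omega> n \<psi> z'"
    by (simp add: avg_add[OF \<omega>] wt_sum[OF \<omega>])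
  also have "\<dots> = (\<Sum>y\<in>?A. wt \<omega> n k z y * (avg T \<omega> n \<psi> y - avg T \<omega> n \<psi> z'))"
    by (simp add: sum_distrib_right right_diff_distrib sum_subtractf)
  also have "\<bar>\<dots>\<bar> \<le> (\<Sum>y\<in>?A. wt \<omega> n k z y * b)"
  proof (intro order_trans[OF sum_abs] sum_mono)
    fix y
    have "\<bar>avg T \<omega> n \<psi> y - avg T \<omega> n \<psi> z'\<bar> \<le> b" using o[of y z'] o[of z' y] by linarith
    then show "\<bar>wt \<omega> n k z y * (avg T \<omega> n \<psi> y - avg T \<omega> n \<psi> z')\<bar> \<le> wt \<omega> n k z y * b"
      using wt_nonneg[OF \<omega>, of n k z y] by (simp add: abs_mult mult_left_mono)
  qed
  also have "\<dots> = b"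
    using arg_cong[OF wt_sum[OF \<omega>, of n k z], of "\<lambda>s. s * b"] by (simp only: sum_distrib_right mult_1)
  finally show ?thesis .
qed

lemma contraction_tendsto_0: "(\<lambda>n. (1 - c) ^ (n div N) * t) \<longlonglongrightarrow> 0"
proof -
  have "filterlim (\<lambda>n. n div N) sequentially sequentially"
    unfolding filterlim_at_top
  proof
    fix M
    show "eventually (\<lambda>n. M \<le> n div N) sequentially"
      using eventually_ge_at_top[of "M * N"]
      by eventually_elim (use N in \<open>simp add: less_eq_div_iff_mult_less_eq\<close>)
  qed
  moreover have "(\<lambda>n. (1 - c) ^ n) \<longlonglongrightarrow> 0"
    using c_pos c_le_1 by (intro LIMSEQ_power_zero) auto
  ultimately have "(\<lambda>n. (1 - c) ^ (n div N)) \<longlonglongrightarrow> 0"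
    by (rule filterlim_compose[rotated])
  then show ?thesis by (rule tendsto_mult_left_zero)
qed

lemma osc_eventually:
  assumes \<omega>: "\<omega> \<in> \<Sigma>" and \<psi>: "continuous_on UNIV \<psi>" and \<epsilon>: "0 < \<epsilon>"
  shows "\<exists>n0. \<forall>n\<ge>n0. \<forall>z z'. avg T \<omega> n \<psi> z - avg T \<omega> n \<psi> z' \<le> \<epsilon>"
proof -
  obtain B where B: "\<And>x. \<bar>\<psi> x\<bar> \<le> B"
    using continuous_compact_bounded[OF comp \<psi>] by blast
  have t: "\<psi> x - \<psi> y \<le> 2 * B" for x y using B[of x] B[of y] by linarith
  \<comment> \<open>With this choice the error term \<open>2 * e / c\<close> of
    \<open>osc_bound\<close> equals \<open>\<epsilon> / 2\<close>.\<close>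
  define e where "e = \<epsilon> * c / 4"
  have "0 < e" using \<epsilon> c_pos by (simp add: e_def)
  then obtain d where d: "d > 0" "\<And>x x'. dist x' x < d \<Longrightarrow> dist (\<psi> x') (\<psi> x) < e"
    using compact_uniformly_continuous[OF \<psi> comp] unfolding uniformly_continuous_on_def by blast
  have "(\<lambda>m. \<rho> ^ m * (\<delta> / 2)) \<longlonglongrightarrow> 0"
    using \<rho> by (intro tendsto_mult_left_zero LIMSEQ_power_zero) auto
  then have "eventually (\<lambda>m. \<rho> ^ m * (\<delta> / 2) < d) sequentially"
    using d(1) by (rule order_tendstoD)
  then obtain m where m: "\<rho> ^ m * (\<delta> / 2) < d" by (auto simp: eventually_sequentially)
  have e': "\<bar>\<psi> y - \<psi> y'\<bar> \<le> e" if "dist y y' < \<rho> ^ m * (\<delta> / 2)" for y y'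
    using d(2)[of y y'] that m by (simp add: dist_real_def)
  have "eventually (\<lambda>n. (1 - c) ^ (n div N) * (2 * B) < \<epsilon> / 2) sequentially"
    using contraction_tendsto_0 by (rule order_tendstoD) (use \<epsilon> in auto)
  then obtain n1 where n1: "\<And>n. n1 \<le> n \<Longrightarrow> (1 - c) ^ (n div N) * (2 * B) < \<epsilon> / 2"
    by (auto simp: eventually_sequentially)
  have "avg T \<omega> n \<psi> z - avg T \<omega> n \<psi> z' \<le> \<epsilon>" if n: "m + n1 \<le> n" for n z z'
  proof -
    obtain k where k: "n = m + k" "n1 \<le> k" using n by (metis add_le_cancel_left le_Suc_ex le_add1 order_trans)
    have "avg T \<omega> n \<psi> z - avg T \<omega> n \<psi> z' \<le> (1 - c) ^ (k div N) * (2 * B) + 2 * e / c"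
      unfolding k(1) by (rule osc_bound[OF \<omega> t e'])
    also have "2 * e / c = \<epsilon> / 2" using c_pos by (simp add: e_def)
    finally show ?thesis using n1[OF k(2)] by linarith
  qed
  then show ?thesis by blast
qed

lemma avg_converges:
  assumes \<omega>: "\<omega> \<in> \<Sigma>" and \<psi>: "continuous_on UNIV \<psi>"
  obtains L where "\<And>z. (\<lambda>n. avg T \<omega> n \<psi> z) \<longlonglongrightarrow> L"
proof -
  have C: "Cauchy (\<lambda>n. avg T \<omega> n \<psi> z)" for z
    unfolding Cauchy_def
  proof (intro allI impI)
    fix e :: real assume "0 < e"
    obtain n0 where n0: "\<And>z z'. avg T \<omega> n0 \<psi> z - avg T \<omega> n0 \<psi> z' \<le> e / 3"
      using osc_eventually[OF \<omega> \<psi>, of "e / 3"] \<open>0 < e\<close> by auto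
    have tail: "\<bar>avg T \<omega> n \<psi> z - avg T \<omega> n0 \<psi> z\<bar> \<le> e / 3" if "n0 \<le> n" for n
      using avg_tail[OF \<omega> n0, of "n - n0" z z] that by simp
    show "\<exists>M. \<forall>m\<ge>M. \<forall>n\<ge>M. dist (avg T \<omega> m \<psi> z) (avg T \<omega> n \<psi> z) < e"
    proof (intro exI[of _ n0] allI impI)
      fix m n assume "n0 \<le> m" "n0 \<le> n"
      from tail[OF this(1)] tail[OF this(2)] \<open>0 < e\<close>
      show "dist (avg T \<omega> m \<psi> z) (avg T \<omega> n \<psi> z) < e" unfolding dist_real_def by linarith
    qed
  qed
  obtain L where L: "(\<lambda>n. avg T \<omega> n \<psi> undefined) \<longlonglongrightarrow> L"
    using C[of undefined] by (auto simp: Cauchy_convergent_iff convergent_def)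
  have "(\<lambda>n. avg T \<omega> n \<psi> z) \<longlonglongrightarrow> L" for z
  proof -
    have "(\<lambda>n. avg T \<omega> n \<psi> z - avg T \<omega> n \<psi> undefined) \<longlonglongrightarrow> 0"
      unfolding LIMSEQ_iff
    proof (intro allI impI)
      fix e :: real assume "0 < e"
      then obtain n0 where n0: "\<And>n z z'. n0 \<le> n \<Longrightarrow> avg T \<omega> n \<psi> z - avg T \<omega> n \<psi> z' \<le> e / 2"
        using osc_eventually[OF \<omega> \<psi>, of "e / 2"] by auto
      show "\<exists>no. \<forall>n\<ge>no. norm (avg T \<omega> n \<psi> z - avg T \<omega> n \<psi> undefined - 0) < e"
      proof (intro exI[of _ n0] allI impI)
        fix n assume "n0 \<le> n"
        from n0[OF this, of z undefined] n0[OF this, of undefined z] \<open>0 < e\<close>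
        show "norm (avg T \<omega> n \<psi> z - avg T \<omega> n \<psi> undefined - 0) < e" by (simp add: abs_less_iff)
      qed
    qed
    from tendsto_add[OF this L] show ?thesis by simp
  qed
  then show thesis by (rule that)
qed

section \<open>Fibre measures and the dual equation\<close>

definition is_nu :: "(int \<Rightarrow> nat) \<Rightarrow> 'a measure \<Rightarrow> bool" where
  "is_nu \<omega> \<nu> \<longleftrightarrow> prob_space \<nu> \<and> sets \<nu> = sets borel \<and>
    (\<forall>\<psi>. continuous_on UNIV \<psi> \<longrightarrow> (\<forall>z. (\<lambda>n. avg T \<omega> n \<psi> z) \<longlonglongrightarrow> (\<integral>x. \<psi> x \<partial>\<nu>)))"

definition nu :: "(int \<Rightarrow> nat) \<Rightarrow> 'a measure" where
  "nu \<omega> = (SOME \<nu>. is_nu \<omega> \<nu>)"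

lemma is_nu_nu:
  assumes \<omega>: "\<omega> \<in> \<Sigma>"
  shows "is_nu \<omega> (nu \<omega>)"
proof -
  \<comment> \<open>Uniform distributions on preimage sets live on the full power set; the identity
    map carries them to the Borel sets.\<close>
  define \<mu> where "\<mu> n = distr (measure_pmf (pmf_of_set (preim T \<omega> n undefined))) borel (\<lambda>x. x)" for n
  have int: "(\<integral>x. \<psi> x \<partial>\<mu> n) = avg T \<omega> n \<psi> undefined" if "continuous_on UNIV \<psi>" for n and \<psi> :: "'a \<Rightarrow> real"
  proof -
    have "(\<integral>x. \<psi> x \<partial>\<mu> n) = (\<integral>x. \<psi> x \<partial>measure_pmf (pmf_of_set (preim T \<omega> n undefined)))"
      unfolding \<mu>_def by (rule integral_distr) (use that in \<open>auto intro: borel_measurable_continuous_onI\<close>)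
    also have "\<dots> = avg T \<omega> n \<psi> undefined"
      using finite_preim[OF \<omega>] preim_nonempty[OF \<omega>]
      by (simp add: integral_pmf_of_set avg_def tsum_def cnt_def)
    finally show ?thesis .
  qed
  have \<mu>: "prob_space (\<mu> n)" "sets (\<mu> n) = sets borel" for n
    unfolding \<mu>_def by (auto intro!: prob_space.prob_space_distr prob_space_measure_pmf)
  have conv: "convergent (\<lambda>n. \<integral>x. \<psi> x \<partial>\<mu> n)" if \<psi>: "continuous_on UNIV \<psi>" for \<psi> :: "'a \<Rightarrow> real"
    unfolding int[OF \<psi>] convergent_def by (rule avg_converges[OF \<omega> \<psi>]) blast
  obtain \<nu> where \<nu>: "prob_space \<nu>" "sets \<nu> = sets borel"
    "\<And>f. continuous_on UNIV f \<Longrightarrow> (\<lambda>n. \<integral>x. f x \<partial>\<mu> n) \<longlonglongrightarrow> (\<integral>x. f x \<partial>\<nu> :: real)"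
    by (rule compact_weak_limit[OF comp \<mu>], erule conv) (rule that)
  have "is_nu \<omega> \<nu>"
    unfolding is_nu_def
  proof (intro conjI allI impI \<nu>(1,2))
    fix \<psi> :: "'a \<Rightarrow> real" and z assume \<psi>: "continuous_on UNIV \<psi>"
    obtain L where L: "\<And>z. (\<lambda>n. avg T \<omega> n \<psi> z) \<longlonglongrightarrow> L" by (rule avg_converges[OF \<omega> \<psi>]) (rule that)
    from LIMSEQ_unique[OF \<nu>(3)[OF \<psi>, unfolded int[OF \<psi>]] L] L
    show "(\<lambda>n. avg T \<omega> n \<psi> z) \<longlonglongrightarrow> (\<integral>x. \<psi> x \<partial>\<nu>)" by simp
  qed
  then show ?thesis unfolding nu_def by (rule someI)
qed

lemma
  assumes \<omega>: "\<omega> \<in> \<Sigma>"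
  shows prob_nu: "prob_space (nu \<omega>)" and sets_nu: "sets (nu \<omega>) = sets borel"
    and avg_tendsto_nu: "continuous_on UNIV \<psi> \<Longrightarrow> (\<lambda>n. avg T \<omega> n \<psi> z) \<longlonglongrightarrow> (\<integral>x. \<psi> x \<partial>nu \<omega>)"
  using is_nu_nu[OF \<omega>] by (auto simp: is_nu_def)

lemma integrable_borel:
  assumes "prob_space \<nu>" "sets \<nu> = sets borel" "continuous_on UNIV (\<psi> :: 'a \<Rightarrow> real)"
  shows "integrable \<nu> \<psi>"
  using assms by (intro integrable_continuous_compact[OF comp]) (auto simp: prob_space_def)

text \<open>The mean number of one-step preimages. Testing the dual equation on the constant 1
  forces this value on any eigenvalue, the fibre measures having mass 1.\<close>

definition lam :: "(int \<Rightarrow> nat) \<Rightarrow> real" where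
  "lam \<omega> = (\<integral>z. tsum T \<omega> 1 (\<lambda>_. 1) z \<partial>nu (shift_pow 1 \<omega>))"

definition Lam :: "(int \<Rightarrow> nat) \<Rightarrow> nat \<Rightarrow> real" where
  "Lam \<omega> n = (\<Prod>k<n. lam (shift_pow (int k) \<omega>))"

text \<open>An average over \<open>n + 1\<close> steps along \<open>\<omega>\<close> is a quotient
  of two averages over \<open>n\<close> steps along the shifted sequence, those of the transfers of
  \<open>\<psi>\<close> and of 1. With the denominator cleared, all three converge.\<close>

lemma nu_dual_1:
  assumes \<omega>: "\<omega> \<in> \<Sigma>" and \<psi>: "continuous_on UNIV \<psi>"
  shows "(\<integral>z. tsum T \<omega> 1 \<psi> z \<partial>nu (shift_pow 1 \<omega>)) = lam \<omega> * (\<integral>x. \<psi> x \<partial>nu \<omega>)"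
proof -
  have \<omega>': "shift_pow 1 \<omega> \<in> \<Sigma>" using \<omega> by simp
  let ?z = "undefined :: 'a"
  have lim: "(\<lambda>n. avg T (shift_pow 1 \<omega>) n (tsum T \<omega> 1 \<phi>) ?z) \<longlonglongrightarrow> (\<integral>z. tsum T \<omega> 1 \<phi> z \<partial>nu (shift_pow 1 \<omega>))"
    if "continuous_on UNIV \<phi>" for \<phi>
    by (rule avg_tendsto_nu[OF \<omega>' tsum_continuous[OF \<omega> that]])
  have "avg T (shift_pow 1 \<omega>) n (tsum T \<omega> 1 \<psi>) ?z =
      avg T (shift_pow 1 \<omega>) n (tsum T \<omega> 1 (\<lambda>_. 1)) ?z * avg T \<omega> (Suc n) \<psi> ?z" for n
    using tsum_add[OF \<omega>, of 1 n] cnt_pos[OF \<omega>, of "Suc n" ?z]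
    by (simp add: avg_def cnt_eq_tsum)
  moreover have "(\<lambda>n. avg T (shift_pow 1 \<omega>) n (tsum T \<omega> 1 (\<lambda>_. 1)) ?z * avg T \<omega> (Suc n) \<psi> ?z)
      \<longlonglongrightarrow> lam \<omega> * (\<integral>x. \<psi> x \<partial>nu \<omega>)"
    unfolding lam_def
    by (intro tendsto_mult lim LIMSEQ_Suc avg_tendsto_nu \<omega> \<psi>) auto
  ultimately show ?thesis
    using LIMSEQ_unique[OF lim[OF \<psi>]] by simp
qed

text \<open>Stated for arbitrary measures and factors, because it serves both the constructed
  measures and a competing eigen system in the uniqueness argument.\<close>

lemma iterate_dual:
  assumes \<omega>: "\<omega> \<in> \<Sigma>" and \<psi>: "continuous_on UNIV \<psi>"
    and dual: "\<And>k \<phi>. continuous_on UNIV \<phi> \<Longrightarrow>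
      (\<integral>z. tsum T (shift_pow (int k) \<omega>) 1 \<phi> z \<partial>\<nu> (Suc k)) = a k * (\<integral>x. \<phi> x \<partial>\<nu> k)"
  shows "(\<integral>z. tsum T \<omega> n \<psi> z \<partial>\<nu> n) = (\<Prod>k<n. a k) * (\<integral>x. \<psi> x \<partial>\<nu> 0)"
proof (induction n)
  case (Suc n)
  have "(\<integral>z. tsum T \<omega> (n + 1) \<psi> z \<partial>\<nu> (Suc n)) = a n * (\<integral>x. tsum T \<omega> n \<psi> x \<partial>\<nu> n)"
    unfolding tsum_add[OF \<omega>] by (rule dual[OF tsum_continuous[OF \<omega> \<psi>]])
  then show ?case by (simp add: Suc mult_ac)
qed simp

lemma nu_dual:
  assumes \<omega>: "\<omega> \<in> \<Sigma>" and \<psi>: "continuous_on UNIV \<psi>"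
  shows "(\<integral>z. tsum T \<omega> n \<psi> z \<partial>nu (shift_pow (int n) \<omega>)) = Lam \<omega> n * (\<integral>x. \<psi> x \<partial>nu \<omega>)"
  using iterate_dual[OF \<omega> \<psi>, of "\<lambda>n. nu (shift_pow (int n) \<omega>)" "\<lambda>k. lam (shift_pow (int k) \<omega>)" n]
    nu_dual_1[of "shift_pow (int _) \<omega>"] \<omega>
  by (simp add: Lam_def add.commute)

lemma dual_total:
  assumes \<omega>: "\<omega> \<in> \<Sigma>" and "prob_space \<nu>"
    and dual: "\<And>\<psi>. continuous_on UNIV \<psi> \<Longrightarrow> (\<integral>z. tsum T \<omega> n \<psi> z \<partial>\<nu>') = \<Lambda> * (\<integral>x. \<psi> x \<partial>\<nu>)"
  shows "\<Lambda> = (\<integral>z. cnt T \<omega> n z \<partial>\<nu>')"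
  using dual[of "\<lambda>_. 1"] prob_space.prob_space[OF assms(2)] by (simp add: cnt_eq_tsum)

lemma cnt_continuous: "\<omega> \<in> \<Sigma> \<Longrightarrow> continuous_on UNIV (cnt T \<omega> n)"
  using tsum_continuous[of \<omega> "\<lambda>_. 1" n] by (simp add: cnt_eq_tsum[abs_def])

lemma prob_integral_bounds:
  assumes \<nu>: "prob_space \<nu>" "sets \<nu> = sets borel" and \<psi>: "continuous_on UNIV (\<psi> :: 'a \<Rightarrow> real)"
  shows "(\<And>x. a \<le> \<psi> x) \<Longrightarrow> a \<le> (\<integral>x. \<psi> x \<partial>\<nu>)" "(\<And>x. \<psi> x \<le> a) \<Longrightarrow> (\<integral>x. \<psi> x \<partial>\<nu>) \<le> a"
proof -
  interpret prob_space \<nu> by fact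
  note int = integrable_borel[OF \<nu> \<psi>]
  show "(\<And>x. a \<le> \<psi> x) \<Longrightarrow> a \<le> (\<integral>x. \<psi> x \<partial>\<nu>)" using int by (intro integral_ge_const) auto
  show "(\<And>x. \<psi> x \<le> a) \<Longrightarrow> (\<integral>x. \<psi> x \<partial>\<nu>) \<le> a" using int by (intro integral_le_const) auto
qed

text \<open>The dual equation exhibits the integral of \<open>\<psi>\<close> as the mean of
  \<open>avg T \<omega> n \<psi>\<close> under the probability measure with density
  \<open>cnt T \<omega> n / \<Lambda>\<close> relative to \<open>\<nu>'\<close>. Averages that
  hardly depend on their end point therefore determine it.\<close>

lemma dual_approx:
  assumes \<omega>: "\<omega> \<in> \<Sigma>" and \<nu>: "prob_space \<nu>" and \<nu>': "prob_space \<nu>'" "sets \<nu>' = sets borel"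
    and dual: "\<And>\<psi>. continuous_on UNIV \<psi> \<Longrightarrow> (\<integral>z. tsum T \<omega> n \<psi> z \<partial>\<nu>') = \<Lambda> * (\<integral>x. \<psi> x \<partial>\<nu>)"
    and \<psi>: "continuous_on UNIV \<psi>" and e: "\<And>z. \<bar>avg T \<omega> n \<psi> z - a\<bar> \<le> e"
  shows "\<bar>(\<integral>x. \<psi> x \<partial>\<nu>) - a\<bar> \<le> e"
proof -
  have \<Lambda>: "\<Lambda> = (\<integral>z. cnt T \<omega> n z \<partial>\<nu>')" by (rule dual_total[OF \<omega> \<nu> dual])
  have int: "integrable \<nu>' (tsum T \<omega> n \<psi>)" "integrable \<nu>' (cnt T \<omega> n)"
    by (intro integrable_borel \<nu>' tsum_continuous cnt_continuous \<omega> \<psi>)+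
  have "1 \<le> \<Lambda>" unfolding \<Lambda>
    by (rule prob_integral_bounds(1)[OF \<nu>' cnt_continuous[OF \<omega>] cnt_ge_1[OF \<omega>]])
  have pt: "(a - e) * cnt T \<omega> n z \<le> tsum T \<omega> n \<psi> z" "tsum T \<omega> n \<psi> z \<le> (a + e) * cnt T \<omega> n z" for z
  proof -
    have "tsum T \<omega> n \<psi> z = avg T \<omega> n \<psi> z * cnt T \<omega> n z"
      unfolding avg_def using cnt_pos[OF \<omega>, of n z] by simp
    moreover have "a - e \<le> avg T \<omega> n \<psi> z" "avg T \<omega> n \<psi> z \<le> a + e" using e[of z] by linarith+
    ultimately show "(a - e) * cnt T \<omega> n z \<le> tsum T \<omega> n \<psi> z" "tsum T \<omega> n \<psi> z \<le> (a + e) * cnt T \<omega> n z"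
      using cnt_pos[OF \<omega>, of n z] by (auto intro!: mult_right_mono)
  qed
  have "(\<integral>z. (a - e) * cnt T \<omega> n z \<partial>\<nu>') \<le> (\<integral>z. tsum T \<omega> n \<psi> z \<partial>\<nu>')"
    by (intro integral_mono int integrable_mult_right pt)
  then have "(a - e) * \<Lambda> \<le> \<Lambda> * (\<integral>x. \<psi> x \<partial>\<nu>)" by (simp add: dual[OF \<psi>] \<Lambda>)
  moreover have "(\<integral>z. tsum T \<omega> n \<psi> z \<partial>\<nu>') \<le> (\<integral>z. (a + e) * cnt T \<omega> n z \<partial>\<nu>')"
    by (intro integral_mono int integrable_mult_right pt)
  then have "\<Lambda> * (\<integral>x. \<psi> x \<partial>\<nu>) \<le> (a + e) * \<Lambda>" by (simp add: dual[OF \<psi>] \<Lambda>)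
  ultimately have "a - e \<le> (\<integral>x. \<psi> x \<partial>\<nu>)" "(\<integral>x. \<psi> x \<partial>\<nu>) \<le> a + e"
    using \<open>1 \<le> \<Lambda>\<close> by (simp_all add: mult.commute[of \<Lambda>])
  then show ?thesis by linarith
qed

lemma lam_ge_1:
  assumes \<omega>: "\<omega> \<in> \<Sigma>"
  shows "1 \<le> lam \<omega>" "lam \<omega> \<le> real D"
proof -
  have \<omega>': "shift_pow 1 \<omega> \<in> \<Sigma>" using \<omega> by simp
  have "lam \<omega> = (\<integral>z. cnt T \<omega> 1 z \<partial>nu (shift_pow 1 \<omega>))" by (simp add: lam_def cnt_eq_tsum)
  then show "1 \<le> lam \<omega>" "lam \<omega> \<le> real D"
    using prob_integral_bounds[OF prob_nu[OF \<omega>'] sets_nu[OF \<omega>'] cnt_continuous[OF \<omega>]]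
      cnt_ge_1[OF \<omega>] cnt_le_D[OF \<omega>, of 1] by auto
qed

lemma Lam_pos: "\<omega> \<in> \<Sigma> \<Longrightarrow> 0 < Lam \<omega> n"
  unfolding Lam_def by (intro prod_pos ballI less_le_trans[OF zero_less_one lam_ge_1(1)]) simp

text \<open>By the dual equation \<open>Lam \<omega> n\<close> is the mean of the count under a
  probability measure, and the count varies by at most the factor \<open>K\<close>.\<close>

lemma Lam_cnt:
  assumes \<omega>: "\<omega> \<in> \<Sigma>"
  shows "Lam \<omega> n \<le> K * cnt T \<omega> n z" "cnt T \<omega> n z \<le> K * Lam \<omega> n"
proof -
  have \<omega>': "shift_pow (int n) \<omega> \<in> \<Sigma>" using \<omega> by simp
  have L: "Lam \<omega> n = (\<integral>z. cnt T \<omega> n z \<partial>nu (shift_pow (int n) \<omega>))"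
    by (rule dual_total[OF \<omega> prob_nu[OF \<omega>]]) (rule nu_dual[OF \<omega>])
  note b = prob_integral_bounds[OF prob_nu[OF \<omega>'] sets_nu[OF \<omega>'] cnt_continuous[OF \<omega>]]
  show "Lam \<omega> n \<le> K * cnt T \<omega> n z" unfolding L by (rule b(2)[OF cnt_ratio[OF \<omega>]])
  have "cnt T \<omega> n z / K \<le> cnt T \<omega> n z'" for z'
    using cnt_ratio[OF \<omega>, of n z z'] K_ge_1 by (simp add: field_simps)
  then have "cnt T \<omega> n z / K \<le> Lam \<omega> n" unfolding L by (rule b(1))
  then show "cnt T \<omega> n z \<le> K * Lam \<omega> n" using K_ge_1 by (simp add: field_simps)
qed

lemma eigen_system_nu:
  assumes \<omega>: "\<omega> \<in> \<Sigma>"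
  shows "eigen_system T \<omega> (\<lambda>n. lam (shift_pow n \<omega>)) (\<lambda>n. nu (shift_pow n \<omega>))"
  unfolding eigen_system_def dual_eq_def transfer_eq_tsum
proof (intro allI conjI impI)
  fix n
  have \<omega>': "shift_pow n \<omega> \<in> \<Sigma>" using \<omega> by simp
  show "0 < lam (shift_pow n \<omega>)" using lam_ge_1(1)[OF \<omega>'] by linarith
  show "prob_space (nu (shift_pow n \<omega>))" "sets (nu (shift_pow n \<omega>)) = sets borel"
    by (rule prob_nu[OF \<omega>'] sets_nu[OF \<omega>'])+
  fix \<psi> :: "'a \<Rightarrow> real" assume "continuous_on UNIV \<psi>"
  from nu_dual_1[OF \<omega>' this]
  show "(\<integral>z. tsum T (shift_pow n \<omega>) 1 \<psi> z \<partial>nu (shift_pow (n + 1) \<omega>)) =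
      lam (shift_pow n \<omega>) * (\<integral>x. \<psi> x \<partial>nu (shift_pow n \<omega>))"
    by (simp add: add.commute)
qed

text \<open>The measure on fibre \<open>k\<close> is determined by looking \<open>n\<close> fibres
  ahead: whatever the measure there may be, averages over \<open>n\<close> steps are nearly
  constant, so the dual equation leaves the integral no choice as \<open>n\<close> grows.\<close>

lemma eigen_system_integral:
  assumes \<omega>: "\<omega> \<in> \<Sigma>" and es: "eigen_system T \<omega> a \<nu>"
    and \<psi>: "continuous_on UNIV (\<psi> :: 'a \<Rightarrow> real)"
  shows "(\<integral>x. \<psi> x \<partial>\<nu> k) = (\<integral>x. \<psi> x \<partial>nu (shift_pow k \<omega>))"
proof -
  let ?\<omega> = "shift_pow k \<omega>"
  have \<omega>': "?\<omega> \<in> \<Sigma>" using \<omega> by simp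
  have \<nu>: "prob_space (\<nu> n)" "sets (\<nu> n) = sets borel" for n
    using es by (auto simp: eigen_system_def)
  have dual1: "(\<integral>z. tsum T (shift_pow (int i) ?\<omega>) 1 \<phi> z \<partial>\<nu> (k + int (Suc i))) = a (k + int i) * (\<integral>x. \<phi> x \<partial>\<nu> (k + int i))"
    if "continuous_on UNIV \<phi>" for i \<phi>
  proof -
    have "dual_eq T (shift_pow (k + int i) \<omega>) (\<nu> (k + int i + 1)) (a (k + int i)) (\<nu> (k + int i))"
      using es unfolding eigen_system_def by blast
    then show ?thesis
      using that unfolding dual_eq_def transfer_eq_tsum by (simp add: add_ac)
  qed
  have dual: "(\<integral>z. tsum T ?\<omega> n \<phi> z \<partial>\<nu> (k + int n)) = (\<Prod>i<n. a (k + int i)) * (\<integral>x. \<phi> x \<partial>\<nu> k)"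
    if "continuous_on UNIV \<phi>" for n \<phi>
    using iterate_dual[OF \<omega>' that, of "\<lambda>n. \<nu> (k + int n)" "\<lambda>i. a (k + int i)" n] dual1 by simp
  have "(\<lambda>n. avg T ?\<omega> n \<psi> undefined) \<longlonglongrightarrow> (\<integral>x. \<psi> x \<partial>\<nu> k)"
    unfolding LIMSEQ_iff
  proof (intro allI impI)
    fix e :: real assume "0 < e"
    then obtain n0 where n0: "\<And>n z z'. n0 \<le> n \<Longrightarrow> avg T ?\<omega> n \<psi> z - avg T ?\<omega> n \<psi> z' \<le> e / 2"
      using osc_eventually[OF \<omega>' \<psi>, of "e / 2"] by auto
    show "\<exists>n0. \<forall>n\<ge>n0. norm (avg T ?\<omega> n \<psi> undefined - (\<integral>x. \<psi> x \<partial>\<nu> k)) < e"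
    proof (intro exI[of _ n0] allI impI)
      fix n assume n: "n0 \<le> n"
      have "\<bar>avg T ?\<omega> n \<psi> z - avg T ?\<omega> n \<psi> undefined\<bar> \<le> e / 2" for z
        using n0[OF n, of z undefined] n0[OF n, of undefined z] by linarith
      from dual_approx[OF \<omega>' \<nu>(1) \<nu> dual \<psi> this] \<open>0 < e\<close>
      show "norm (avg T ?\<omega> n \<psi> undefined - (\<integral>x. \<psi> x \<partial>\<nu> k)) < e"
        by (simp add: abs_minus_commute)
    qed
  qed
  from LIMSEQ_unique[OF this avg_tendsto_nu[OF \<omega>' \<psi>]] show ?thesis .
qed

lemma eigenvalue_eq_lam:
  assumes \<omega>: "\<omega> \<in> \<Sigma>"
  shows "eigenvalue T \<omega> = lam \<omega>"
  unfolding eigenvalue_def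
proof (rule the_equality)
  show "\<exists>a \<nu>. eigen_system T \<omega> a \<nu> \<and> lam \<omega> = a 0"
    using eigen_system_nu[OF \<omega>] by (intro exI[of _ "\<lambda>n. lam (shift_pow n \<omega>)"] exI[of _ "\<lambda>n. nu (shift_pow n \<omega>)"]) simp
  fix b assume "\<exists>a \<nu>. eigen_system T \<omega> a \<nu> \<and> b = a 0"
  then obtain a \<nu> where es: "eigen_system T \<omega> a \<nu>" and b: "b = a 0" by blast
  have p: "prob_space (\<nu> 0)" using es by (simp add: eigen_system_def)
  \<comment> \<open>Tested on the constant 1, the equation recovers \<open>a 0\<close> from the
    measure on fibre 1, whose integrals of continuous functions are already determined.\<close>
  have "dual_eq T (shift_pow 0 \<omega>) (\<nu> (0 + 1)) (a 0) (\<nu> 0)" using es unfolding eigen_system_def by blast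
  then have "(\<integral>z. tsum T \<omega> 1 (\<lambda>_. 1) z \<partial>\<nu> 1) = a 0 * (\<integral>x. 1 \<partial>\<nu> 0)"
    unfolding dual_eq_def transfer_eq_tsum by simp
  also have "\<dots> = a 0" using prob_space.prob_space[OF p] by simp
  finally show "b = lam \<omega>"
    unfolding b lam_def using eigen_system_integral[OF \<omega> es tsum_continuous[OF \<omega>], of "\<lambda>_. 1" 1 1] by simp
qed

section \<open>Invariant densities\<close>

lemma Lam_add: "Lam \<omega> (k + n) = Lam \<omega> k * Lam (shift_pow (int k) \<omega>) n"
proof -
  have "{..<k + n} = {..<k} \<union> {k..<k + n}" by auto
  then have "Lam \<omega> (k + n) = Lam \<omega> k * (\<Prod>i\<in>{k..<k + n}. lam (shift_pow (int i) \<omega>))"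
    unfolding Lam_def by (simp add: prod.union_disjoint ivl_disj_int)
  also have "(\<Prod>i\<in>{k..<k + n}. lam (shift_pow (int i) \<omega>)) = Lam (shift_pow (int k) \<omega>) n"
    unfolding Lam_def using prod.shift_bounds_nat_ivl[of "\<lambda>i. lam (shift_pow (int i) \<omega>)" 0 k n]
    by (simp add: add_ac lessThan_atLeast0)
  finally show ?thesis .
qed

lemma Lam_1 [simp]: "Lam \<omega> (Suc 0) = lam \<omega>"
  by (simp add: Lam_def)

lemma locally_constant_continuous:
  fixes f :: "'a \<Rightarrow> real"
  assumes "\<And>z z'. dist z z' < \<delta> / 2 \<Longrightarrow> f z = f z'"
  shows "continuous_on UNIV f"
  unfolding continuous_on_iff using assms \<delta> by (force intro!: exI[of _ "\<delta> / 2"])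

text \<open>The density with respect to \<open>nu \<omega>\<close> of the image of \<open>nu (shift_pow (- int k) \<omega>)\<close> under \<open>k\<close> steps.\<close>

definition h_approx :: "(int \<Rightarrow> nat) \<Rightarrow> nat \<Rightarrow> 'a \<Rightarrow> real" where
  "h_approx \<omega> k z = cnt T (shift_pow (- int k) \<omega>) k z / Lam (shift_pow (- int k) \<omega>) k"

lemma h_approx_bounds:
  assumes \<omega>: "\<omega> \<in> \<Sigma>"
  shows "1 / K \<le> h_approx \<omega> k z" "h_approx \<omega> k z \<le> K"
proof -
  have \<omega>': "shift_pow (- int k) \<omega> \<in> \<Sigma>" using \<omega> by simp
  show "1 / K \<le> h_approx \<omega> k z" "h_approx \<omega> k z \<le> K"
    using Lam_cnt[OF \<omega>', of k z] Lam_pos[OF \<omega>', of k] K_ge_1 unfolding h_approx_def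
    by (auto simp: field_simps)
qed

lemma h_approx_nonneg: "\<omega> \<in> \<Sigma> \<Longrightarrow> 0 \<le> h_approx \<omega> k z"
  using h_approx_bounds(1)[of \<omega> k z] K_ge_1 by (auto intro: order_trans[of 0 "1 / K"])

lemma h_approx_local: "\<omega> \<in> \<Sigma> \<Longrightarrow> dist z z' < \<delta> / 2 \<Longrightarrow> h_approx \<omega> k z = h_approx \<omega> k z'"
  unfolding h_approx_def by (subst cnt_local[of _ z z']) auto

lemma h_approx_continuous: "\<omega> \<in> \<Sigma> \<Longrightarrow> continuous_on UNIV (h_approx \<omega> k)"
  by (rule locally_constant_continuous) (rule h_approx_local)

lemma h_approx_integral:
  assumes \<omega>: "\<omega> \<in> \<Sigma>"
  shows "(\<integral>z. h_approx \<omega> k z \<partial>nu \<omega>) = 1"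
proof -
  have \<omega>': "shift_pow (- int k) \<omega> \<in> \<Sigma>" using \<omega> by simp
  have "(\<integral>z. cnt T (shift_pow (- int k) \<omega>) k z \<partial>nu \<omega>) = Lam (shift_pow (- int k) \<omega>) k"
    using dual_total[OF \<omega>' prob_nu[OF \<omega>'] nu_dual[OF \<omega>', of _ k]] by simp
  then show ?thesis
    using Lam_pos[OF \<omega>', of k] by (simp add: h_approx_def)
qed

text \<open>At every finite stage the eigenfunction equation is exact, except that the length of the
  past moves from \<open>k\<close> to \<open>k + n\<close>; the limit in \<open>k\<close> absorbs
  this shift.\<close>

lemma tsum_h_approx:
  assumes \<omega>: "\<omega> \<in> \<Sigma>"
  shows "tsum T \<omega> n (h_approx \<omega> k) z = Lam \<omega> n * h_approx (shift_pow (int n) \<omega>) (k + n) z"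
proof -
  have \<omega>': "shift_pow (- int k) \<omega> \<in> \<Sigma>" using \<omega> by simp
  have "tsum T \<omega> n (h_approx \<omega> k) z = tsum T \<omega> n (cnt T (shift_pow (- int k) \<omega>) k) z / Lam (shift_pow (- int k) \<omega>) k"
    by (simp add: tsum_def h_approx_def sum_divide_distrib)
  also have "tsum T \<omega> n (cnt T (shift_pow (- int k) \<omega>) k) z = cnt T (shift_pow (- int k) \<omega>) (k + n) z"
    by (simp add: cnt_eq_tsum[abs_def] tsum_add[OF \<omega>'])
  finally show ?thesis
    using Lam_pos[OF \<omega>', of k] Lam_pos[OF \<omega>, of n] Lam_add[of "shift_pow (- int k) \<omega>" k n]
    by (simp add: h_approx_def[of "shift_pow (int n) \<omega>"])
qed

text \<open>Splitting the preimages at the last \<open>n\<close> steps shows the effect of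
  lengthening the past: the density is multiplied by an average over these \<open>n\<close> steps,
  to which the contraction applies.\<close>

lemma h_approx_add:
  assumes \<omega>: "\<omega> \<in> \<Sigma>"
  shows "h_approx \<omega> (k + n) z = avg T (shift_pow (- int n) \<omega>) n (h_approx (shift_pow (- int n) \<omega>) k) z * h_approx \<omega> n z"
proof -
  have \<omega>': "shift_pow (- int n) \<omega> \<in> \<Sigma>" using \<omega> by simp
  show ?thesis
    using tsum_h_approx[OF \<omega>', of n k z] Lam_pos[OF \<omega>', of n] cnt_pos[OF \<omega>', of n z]
    unfolding avg_def h_approx_def[of \<omega> n] by simp
qed

text \<open>The extra factor is an average of a density of integral 1, so it is near 1 as soon as
  averages forget their end point. Since the densities are constant at the scale
  \<open>\<delta> / 2\<close>, \<open>osc_bound\<close> applies with \<open>m = 0\<close> and error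
  0, and the rate is uniform in \<open>k\<close>. One factor \<open>K\<close> bounds the oscillation
  of the density, the other its size.\<close>

lemma h_approx_diff:
  assumes \<omega>: "\<omega> \<in> \<Sigma>"
  shows "\<bar>h_approx \<omega> (k + n) z - h_approx \<omega> n z\<bar> \<le> K * ((1 - c) ^ (n div N) * K)"
proof -
  let ?\<omega> = "shift_pow (- int n) \<omega>" let ?\<psi> = "h_approx ?\<omega> k"
  have \<omega>': "?\<omega> \<in> \<Sigma>" using \<omega> by simp
  have b: "0 \<le> ?\<psi> x" "?\<psi> x \<le> K" for x
    using h_approx_bounds(2)[OF \<omega>', of k x] h_approx_nonneg[OF \<omega>', of k x] by auto
  have "avg T ?\<omega> (0 + n) ?\<psi> z - avg T ?\<omega> (0 + n) ?\<psi> z' \<le> (1 - c) ^ (n div N) * K + 2 * 0 / c" for z z'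
  proof (rule osc_bound[OF \<omega>'])
    show "?\<psi> x - ?\<psi> y \<le> K" for x y using b[of x] b[of y] by linarith
    show "dist y y' < \<rho> ^ 0 * (\<delta> / 2) \<Longrightarrow> \<bar>?\<psi> y - ?\<psi> y'\<bar> \<le> 0" for y y'
      using h_approx_local[OF \<omega>', of y y' k] by simp
  qed
  then have osc: "avg T ?\<omega> n ?\<psi> z - avg T ?\<omega> n ?\<psi> z' \<le> (1 - c) ^ (n div N) * K" for z z' by simp
  have "\<bar>avg T ?\<omega> n ?\<psi> z' - avg T ?\<omega> n ?\<psi> z\<bar> \<le> (1 - c) ^ (n div N) * K" for z'
    using osc[of z z'] osc[of z' z] by linarith
  from dual_approx[OF \<omega>' prob_nu[OF \<omega>'] prob_nu sets_nu nu_dual[OF \<omega>', of _ n] h_approx_continuous[OF \<omega>'] this]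
  have "\<bar>1 - avg T ?\<omega> n ?\<psi> z\<bar> \<le> (1 - c) ^ (n div N) * K"
    using \<omega> by (simp add: h_approx_integral[OF \<omega>'])
  moreover have "\<bar>h_approx \<omega> (k + n) z - h_approx \<omega> n z\<bar> = \<bar>h_approx \<omega> n z\<bar> * \<bar>1 - avg T ?\<omega> n ?\<psi> z\<bar>"
    unfolding h_approx_add[OF \<omega>] abs_mult[symmetric] by (subst abs_minus_commute) (simp add: algebra_simps)
  moreover have "\<bar>h_approx \<omega> n z\<bar> \<le> K"
    using h_approx_bounds[OF \<omega>, of n z] h_approx_nonneg[OF \<omega>, of n z] by simp
  ultimately show ?thesis
    using K_ge_1 by (auto intro!: mult_mono)
qed

definition h :: "(int \<Rightarrow> nat) \<Rightarrow> 'a \<Rightarrow> real" where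
  "h \<omega> z = lim (\<lambda>k. h_approx \<omega> k z)"

lemma h_approx_tendsto:
  assumes \<omega>: "\<omega> \<in> \<Sigma>"
  shows "(\<lambda>k. h_approx \<omega> k z) \<longlonglongrightarrow> h \<omega> z"
proof -
  have "Cauchy (\<lambda>k. h_approx \<omega> k z)"
    unfolding Cauchy_def
  proof (intro allI impI)
    fix e :: real assume "0 < e"
    have "(\<lambda>n. K * ((1 - c) ^ (n div N) * K)) \<longlonglongrightarrow> 0"
      by (intro tendsto_mult_right_zero contraction_tendsto_0)
    then have "eventually (\<lambda>n. K * ((1 - c) ^ (n div N) * K) < e / 2) sequentially"
      by (rule order_tendstoD) (use \<open>0 < e\<close> in simp)
    then obtain n0 where n0: "K * ((1 - c) ^ (n0 div N) * K) < e / 2"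
      by (auto simp: eventually_sequentially)
    have tail: "\<bar>h_approx \<omega> n z - h_approx \<omega> n0 z\<bar> < e / 2" if "n0 \<le> n" for n
      using h_approx_diff[OF \<omega>, of "n - n0" n0 z] n0 that by simp
    show "\<exists>M. \<forall>m\<ge>M. \<forall>n\<ge>M. dist (h_approx \<omega> m z) (h_approx \<omega> n z) < e"
    proof (intro exI[of _ n0] allI impI)
      fix m n assume "n0 \<le> m" "n0 \<le> n"
      from tail[OF this(1)] tail[OF this(2)]
      show "dist (h_approx \<omega> m z) (h_approx \<omega> n z) < e" unfolding dist_real_def by linarith
    qed
  qed
  then show ?thesis
    unfolding h_def by (simp add: Cauchy_convergent_iff convergent_LIMSEQ_iff)
qed

lemma h_bounds:
  assumes \<omega>: "\<omega> \<in> \<Sigma>"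
  shows "1 / K \<le> h \<omega> z" "h \<omega> z \<le> K" "0 < h \<omega> z"
proof -
  show 1: "1 / K \<le> h \<omega> z"
    by (rule tendsto_lowerbound[OF h_approx_tendsto[OF \<omega>]]) (auto simp: h_approx_bounds[OF \<omega>])
  show "h \<omega> z \<le> K"
    by (rule tendsto_upperbound[OF h_approx_tendsto[OF \<omega>]]) (auto simp: h_approx_bounds[OF \<omega>])
  have "0 < 1 / K" using K_ge_1 by simp
  then show "0 < h \<omega> z" using 1 by linarith
qed

lemma h_continuous: "\<omega> \<in> \<Sigma> \<Longrightarrow> continuous_on UNIV (h \<omega>)"
  unfolding h_def by (rule locally_constant_continuous) (simp cong: h_approx_local)

lemma h_eigen:
  assumes \<omega>: "\<omega> \<in> \<Sigma>"
  shows "tsum T \<omega> 1 (h \<omega>) z = lam \<omega> * h (shift_pow 1 \<omega>) z"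
proof -
  have \<omega>': "shift_pow 1 \<omega> \<in> \<Sigma>" using \<omega> by simp
  have "(\<lambda>k. tsum T \<omega> 1 (h_approx \<omega> k) z) \<longlonglongrightarrow> tsum T \<omega> 1 (h \<omega>) z"
    unfolding tsum_def by (intro tendsto_sum h_approx_tendsto[OF \<omega>])
  moreover have "(\<lambda>k. lam \<omega> * h_approx (shift_pow 1 \<omega>) (Suc k) z) \<longlonglongrightarrow> lam \<omega> * h (shift_pow 1 \<omega>) z"
    by (intro tendsto_mult tendsto_const LIMSEQ_Suc h_approx_tendsto[OF \<omega>'])
  ultimately show ?thesis
    unfolding tsum_h_approx[OF \<omega>] using LIMSEQ_unique by simp
qed

lemma h_approx_integral_tendsto:
  assumes \<omega>: "\<omega> \<in> \<Sigma>" and \<psi>: "continuous_on UNIV (\<psi> :: 'a \<Rightarrow> real)"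
  shows "(\<lambda>k. \<integral>x. \<psi> x * h_approx \<omega> k x \<partial>nu \<omega>) \<longlonglongrightarrow> (\<integral>x. \<psi> x * h \<omega> x \<partial>nu \<omega>)"
proof -
  interpret prob_space "nu \<omega>" by (rule prob_nu[OF \<omega>])
  obtain B where B: "0 \<le> B" "\<And>x. \<bar>\<psi> x\<bar> \<le> B"
    using continuous_compact_bounded[OF comp \<psi>] by blast
  have m: "f \<in> borel_measurable (nu \<omega>)" if "continuous_on UNIV f" for f :: "'a \<Rightarrow> real"
    using borel_measurable_continuous_onI[OF that] sets_nu[OF \<omega>] by (simp cong: measurable_cong_sets)
  show ?thesis
  proof (rule integral_dominated_convergence[where w="\<lambda>_. B * K"])
    show "AE x in nu \<omega>. (\<lambda>k. \<psi> x * h_approx \<omega> k x) \<longlonglongrightarrow> \<psi> x * h \<omega> x"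
      by (intro AE_I2 tendsto_mult tendsto_const h_approx_tendsto[OF \<omega>])
    fix k
    show "AE x in nu \<omega>. norm (\<psi> x * h_approx \<omega> k x) \<le> B * K"
    proof (rule AE_I2)
      fix x
      show "norm (\<psi> x * h_approx \<omega> k x) \<le> B * K"
        using B h_approx_bounds(2)[OF \<omega>, of k x] h_approx_nonneg[OF \<omega>, of k x] by (auto simp: abs_mult intro!: mult_mono)
    qed
  qed (auto intro!: m continuous_on_mult \<psi> h_approx_continuous h_continuous \<omega>)
qed

lemma h_integral: "\<omega> \<in> \<Sigma> \<Longrightarrow> (\<integral>x. h \<omega> x \<partial>nu \<omega>) = 1"
  using h_approx_integral_tendsto[of \<omega> "\<lambda>_. 1"] by (simp add: h_approx_integral LIMSEQ_const_iff)

section \<open>Equivariant fibre measures and the mass of small sets\<close>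

definition mu :: "(int \<Rightarrow> nat) \<Rightarrow> 'a measure" where
  "mu \<omega> = density (nu \<omega>) (\<lambda>x. ennreal (h \<omega> x))"

lemma
  assumes \<omega>: "\<omega> \<in> \<Sigma>"
  shows sets_mu: "sets (mu \<omega>) = sets borel"
    and mu_integral: "continuous_on UNIV (\<psi> :: 'a \<Rightarrow> real) \<Longrightarrow> (\<integral>x. \<psi> x \<partial>mu \<omega>) = (\<integral>x. \<psi> x * h \<omega> x \<partial>nu \<omega>)"
    and prob_mu: "prob_space (mu \<omega>)"
proof -
  have m: "f \<in> borel_measurable (nu \<omega>)" if "continuous_on UNIV f" for f :: "'a \<Rightarrow> real"
    using borel_measurable_continuous_onI[OF that] sets_nu[OF \<omega>] by (simp cong: measurable_cong_sets)
  have hm: "h \<omega> \<in> borel_measurable (nu \<omega>)" by (rule m[OF h_continuous[OF \<omega>]])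
  have h0: "0 \<le> h \<omega> x" for x using h_bounds(3)[OF \<omega>, of x] by simp
  show "sets (mu \<omega>) = sets borel" by (simp add: mu_def sets_nu[OF \<omega>])
  show "(\<integral>x. \<psi> x \<partial>mu \<omega>) = (\<integral>x. \<psi> x * h \<omega> x \<partial>nu \<omega>)" if "continuous_on UNIV \<psi>" for \<psi> :: "'a \<Rightarrow> real"
    unfolding mu_def using hm m[OF that] h0 by (subst integral_real_density) (auto simp: mult.commute)
  show "prob_space (mu \<omega>)"
  proof (rule prob_spaceI)
    have "emeasure (mu \<omega>) (space (mu \<omega>)) = (\<integral>\<^sup>+x. ennreal (h \<omega> x) \<partial>nu \<omega>)"
      unfolding mu_def using hm by (subst emeasure_density) (auto intro!: nn_integral_cong)
    also have "\<dots> = ennreal (\<integral>x. h \<omega> x \<partial>nu \<omega>)"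
      by (intro nn_integral_eq_integral integrable_borel prob_nu sets_nu h_continuous \<omega>) (simp add: h0)
    finally show "emeasure (mu \<omega>) (space (mu \<omega>)) = 1" by (simp add: h_integral[OF \<omega>])
  qed
qed

text \<open>A function composed with the fibre map passes through the transfer operator:
  transferring \<open>(f \<circ> T) h\<close> gives \<open>f\<close> times the transfer of
  \<open>h\<close>. With the eigenfunction equation and duality, the factor
  \<open>lam \<omega>\<close> appears on both sides and cancels.\<close>

lemma mu_image:
  assumes \<omega>: "\<omega> \<in> \<Sigma>"
  shows "distr (mu \<omega>) borel (T (\<omega> 0)) = mu (shift_pow 1 \<omega>)"
proof (rule borel_eqI_continuous)
  have \<omega>': "shift_pow 1 \<omega> \<in> \<Sigma>" using \<omega> by simp
  have Tc: "continuous_on UNIV (T (\<omega> 0))" by (rule cont[OF \<Sigma>_less[OF \<omega>]])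
  have Tm: "T (\<omega> 0) \<in> measurable (mu \<omega>) borel"
    using borel_measurable_continuous_onI[OF Tc] sets_mu[OF \<omega>] by (simp cong: measurable_cong_sets)
  show "finite_measure (distr (mu \<omega>) borel (T (\<omega> 0)))" "finite_measure (mu (shift_pow 1 \<omega>))"
    using prob_space.prob_space_distr[OF prob_mu[OF \<omega>] Tm] prob_mu[OF \<omega>'] by (auto simp: prob_space_def)
  show "sets (mu (shift_pow 1 \<omega>)) = sets borel" by (rule sets_mu[OF \<omega>'])
  fix f :: "'a \<Rightarrow> real" assume f: "continuous_on UNIV f"
  have fT: "continuous_on UNIV (\<lambda>x. f (T (\<omega> 0) x))"
    by (rule continuous_on_compose2[OF f Tc]) auto
  have ts: "tsum T \<omega> 1 (\<lambda>x. f (T (\<omega> 0) x) * h \<omega> x) z = f z * (lam \<omega> * h (shift_pow 1 \<omega>) z)" for z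
    unfolding h_eigen[OF \<omega>, symmetric] tsum_def preim_def by (simp add: sum_distrib_left)
  have "lam \<omega> * (\<integral>x. f (T (\<omega> 0) x) * h \<omega> x \<partial>nu \<omega>) = (\<integral>z. f z * (lam \<omega> * h (shift_pow 1 \<omega>) z) \<partial>nu (shift_pow 1 \<omega>))"
    unfolding ts[symmetric] by (intro nu_dual_1[symmetric] \<omega> continuous_on_mult fT h_continuous)
  also have "\<dots> = lam \<omega> * (\<integral>z. f z * h (shift_pow 1 \<omega>) z \<partial>nu (shift_pow 1 \<omega>))"
    by (subst integral_mult_right_zero[symmetric]) (rule Bochner_Integration.integral_cong, simp_all add: mult_ac)
  finally have "(\<integral>x. f (T (\<omega> 0) x) * h \<omega> x \<partial>nu \<omega>) = (\<integral>z. f z * h (shift_pow 1 \<omega>) z \<partial>nu (shift_pow 1 \<omega>))"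
    using lam_ge_1(1)[OF \<omega>] by simp
  then show "(\<integral>x. f x \<partial>distr (mu \<omega>) borel (T (\<omega> 0))) = (\<integral>x. f x \<partial>mu (shift_pow 1 \<omega>))"
    by (simp add: integral_distr[OF Tm borel_measurable_continuous_onI[OF f]] mu_integral[OF \<omega> fT] mu_integral[OF \<omega>' f])
qed simp

text \<open>By duality the left side is the mean number of \<open>n\<close>-step preimages lying in
  \<open>A\<close>, and \<open>backward_unique\<close> allows at most one of them. Duality holds for
  continuous functions, which is why closed sets, approximated by such functions, are treated before
  Borel sets.\<close>

lemma nu_small_closed:
  assumes \<omega>: "\<omega> \<in> \<Sigma>" and cl: "closed A"
    and A: "\<And>x y k. x \<in> A \<Longrightarrow> y \<in> A \<Longrightarrow> k < n \<Longrightarrow> dist (fiber_iter T \<omega> k x) (fiber_iter T \<omega> k y) \<le> \<delta>"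
  shows "Lam \<omega> n * measure (nu \<omega>) A \<le> 1"
proof -
  let ?\<nu> = "nu (shift_pow (int n) \<omega>)"
  have \<omega>': "shift_pow (int n) \<omega> \<in> \<Sigma>" using \<omega> by simp
  interpret \<nu>: prob_space ?\<nu> by (rule prob_nu[OF \<omega>'])
  obtain f :: "nat \<Rightarrow> 'a \<Rightarrow> real" where f: "\<And>n. continuous_on UNIV (f n)"
    "\<And>n x. 0 \<le> f n x" "\<And>n x. f n x \<le> 1" "\<And>x. (\<lambda>n. f n x) \<longlonglongrightarrow> indicator A x"
    by (rule closed_indicator_approx[OF cl]) (rule that)
  have "(\<lambda>j. \<integral>x. f j x \<partial>nu \<omega>) \<longlonglongrightarrow> measure (nu \<omega>) A"
    using prob_nu[OF \<omega>] sets_nu[OF \<omega>] borel_closed[OF cl] f by (intro measure_closed_limit) (auto simp: prob_space_def)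
  then have "(\<lambda>j. Lam \<omega> n * (\<integral>x. f j x \<partial>nu \<omega>)) \<longlonglongrightarrow> Lam \<omega> n * measure (nu \<omega>) A"
    by (intro tendsto_mult tendsto_const)
  then have 1: "(\<lambda>j. \<integral>z. tsum T \<omega> n (f j) z \<partial>?\<nu>) \<longlonglongrightarrow> Lam \<omega> n * measure (nu \<omega>) A"
    by (simp add: nu_dual[OF \<omega> f(1)])
  have lim: "(\<lambda>j. tsum T \<omega> n (f j) z) \<longlonglongrightarrow> tsum T \<omega> n (indicator A) z" for z
    unfolding tsum_def by (intro tendsto_sum f(4))
  have m: "tsum T \<omega> n (f j) \<in> borel_measurable ?\<nu>" for j
    using borel_measurable_continuous_onI[OF tsum_continuous[OF \<omega> f(1)]] sets_nu[OF \<omega>'] by (simp cong: measurable_cong_sets)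
  have m': "tsum T \<omega> n (indicator A) \<in> borel_measurable ?\<nu>"
    by (rule borel_measurable_LIMSEQ_real[OF lim m])
  have bd: "norm (tsum T \<omega> n (f j) z) \<le> real D ^ n" for j z
  proof -
    have "norm (tsum T \<omega> n (f j) z) \<le> (\<Sum>y\<in>preim T \<omega> n z. 1)"
      unfolding tsum_def by (rule sum_norm_le) (use f(2,3) in auto)
    also have "\<dots> \<le> real D ^ n" using cnt_le_D[OF \<omega>, of n z] by (simp add: cnt_def)
    finally show ?thesis .
  qed
  have 2: "(\<lambda>j. \<integral>z. tsum T \<omega> n (f j) z \<partial>?\<nu>) \<longlonglongrightarrow> (\<integral>z. tsum T \<omega> n (indicator A) z \<partial>?\<nu>)"
    by (rule integral_dominated_convergence[where w="\<lambda>_. real D ^ n"]) (use m m' lim bd in auto)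
  have le: "tsum T \<omega> n (indicator A) z \<le> 1" "0 \<le> tsum T \<omega> n (indicator A) z" for z
  proof -
    have "tsum T \<omega> n (indicator A) z = real (card (preim T \<omega> n z \<inter> A))"
      unfolding tsum_def indicator_def of_bool_def
      by (simp add: sum.If_cases[OF finite_preim[OF \<omega>]])
    moreover have "x = y" if "x \<in> preim T \<omega> n z \<inter> A" "y \<in> preim T \<omega> n z \<inter> A" for x y
      by (rule backward_unique[OF \<omega>, of n]) (use that A in \<open>auto simp: preim_def\<close>)
    then have "card (preim T \<omega> n z \<inter> A) \<le> 1"
      using finite_preim[OF \<omega>] by (intro card_le_Suc0_iff_eq[THEN iffD2, folded One_nat_def]) auto
    ultimately show "tsum T \<omega> n (indicator A) z \<le> 1" "0 \<le> tsum T \<omega> n (indicator A) z" by auto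
  qed
  have "(\<integral>z. tsum T \<omega> n (indicator A) z \<partial>?\<nu>) \<le> 1"
    using m' le by (intro \<nu>.integral_le_const \<nu>.integrable_const_bound[where B=1]) auto
  then show ?thesis using LIMSEQ_unique[OF 1 2] by simp
qed

text \<open>A closed subset inherits the smallness of \<open>A\<close>, so inner regularity carries
  the bound over from closed sets.\<close>

lemma nu_small:
  assumes \<omega>: "\<omega> \<in> \<Sigma>" and Ab: "A \<in> sets borel"
    and A: "\<And>x y k. x \<in> A \<Longrightarrow> y \<in> A \<Longrightarrow> k < n \<Longrightarrow> dist (fiber_iter T \<omega> k x) (fiber_iter T \<omega> k y) \<le> \<delta>"
  shows "measure (nu \<omega>) A \<le> 1 / Lam \<omega> n"
proof (rule ccontr)
  interpret prob_space "nu \<omega>" by (rule prob_nu[OF \<omega>])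
  assume "\<not> measure (nu \<omega>) A \<le> 1 / Lam \<omega> n"
  then have gt: "0 < measure (nu \<omega>) A - 1 / Lam \<omega> n" by simp
  obtain C where C: "closed C" "C \<subseteq> A" "measure (nu \<omega>) (A - C) < measure (nu \<omega>) A - 1 / Lam \<omega> n"
    by (rule closed_inner_approx[OF comp finite_measure_axioms sets_nu[OF \<omega>] Ab gt]) (rule that)
  have "measure (nu \<omega>) (A - C) = measure (nu \<omega>) A - measure (nu \<omega>) C"
    using C Ab sets_nu[OF \<omega>] by (intro finite_measure_Diff) auto
  then have "1 / Lam \<omega> n < measure (nu \<omega>) C" using C(3) by simp
  moreover have "Lam \<omega> n * measure (nu \<omega>) C \<le> 1"
    by (rule nu_small_closed[OF \<omega> C(1)]) (use A C(2) in blast)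
  ultimately show False using Lam_pos[OF \<omega>, of n] by (simp add: field_simps)
qed

lemma mu_small:
  assumes \<omega>: "\<omega> \<in> \<Sigma>" and Ab: "A \<in> sets borel"
    and A: "\<And>x y k. x \<in> A \<Longrightarrow> y \<in> A \<Longrightarrow> k < n \<Longrightarrow> dist (fiber_iter T \<omega> k x) (fiber_iter T \<omega> k y) \<le> \<delta>"
  shows "measure (mu \<omega>) A \<le> K / Lam \<omega> n"
proof -
  interpret nu: prob_space "nu \<omega>" by (rule prob_nu[OF \<omega>])
  interpret mu: prob_space "mu \<omega>" by (rule prob_mu[OF \<omega>])
  have hm: "h \<omega> \<in> borel_measurable (nu \<omega>)"
    using borel_measurable_continuous_onI[OF h_continuous[OF \<omega>]] sets_nu[OF \<omega>] by (simp cong: measurable_cong_sets)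
  have A': "A \<in> sets (nu \<omega>)" using Ab sets_nu[OF \<omega>] by simp
  have "emeasure (mu \<omega>) A = (\<integral>\<^sup>+x. ennreal (h \<omega> x) * indicator A x \<partial>nu \<omega>)"
    unfolding mu_def using hm A' by (intro emeasure_density) auto
  also have "\<dots> \<le> (\<integral>\<^sup>+x. ennreal K * indicator A x \<partial>nu \<omega>)"
    by (intro nn_integral_mono mult_right_mono ennreal_leI h_bounds \<omega>) simp
  also have "\<dots> = ennreal (K * measure (nu \<omega>) A)"
    using A' K_ge_1 by (simp add: nn_integral_cmult_indicator nu.emeasure_eq_measure ennreal_mult')
  finally have "measure (mu \<omega>) A \<le> K * measure (nu \<omega>) A"
    using K_ge_1 by (simp add: mu.emeasure_eq_measure ennreal_le_iff)
  also have "\<dots> \<le> K * (1 / Lam \<omega> n)"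
    using K_ge_1 by (intro mult_left_mono nu_small \<omega> Ab A) auto
  finally show ?thesis by simp
qed

end

section \<open>Measurability over the shift\<close>

lemma coordinate_measurable: "(\<lambda>\<omega>. \<omega> i) \<in> measurable (borel :: (int \<Rightarrow> nat) measure) borel"
  by (rule borel_measurable_continuous_onI) simp

lemma shift_pow_borel_measurable: "shift_pow k \<in> measurable borel borel"
  unfolding shift_pow_def[abs_def]
  by (intro borel_measurable_continuous_onI continuous_on_coordinatewise_then_product) simp

text \<open>The parameter matters only through its word of length \<open>n\<close>. There are
  countably many words, and for a fixed word the function is measurable. The argument
  \<open>x\<close> is kept apart from the parameter so that both may vary together.\<close>

lemma measurable_finite_coordinates:
  fixes g :: "'b \<Rightarrow> int \<Rightarrow> nat"
  assumes g: "g \<in> measurable M (restrict_space borel S)"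
    and f: "\<And>\<omega>. \<omega> \<in> S \<Longrightarrow> f \<omega> \<in> measurable M N"
    and eq: "\<And>\<omega> \<omega>' x. (\<And>i. i < n \<Longrightarrow> \<omega> (int i) = \<omega>' (int i)) \<Longrightarrow> f \<omega> x = f \<omega>' x"
  shows "(\<lambda>x. f (g x) x) \<in> measurable M N"
proof -
  define W where "W \<omega> = map (\<lambda>i. \<omega> (int i)) [0..<n]" for \<omega> :: "int \<Rightarrow> nat"
  \<comment> \<open>The representative of a word is taken in \<open>S\<close>, since measurability
    is assumed only for parameters there.\<close>
  define r where "r w = (SOME \<omega>. \<omega> \<in> S \<and> W \<omega> = w)" for w
  have gS: "g x \<in> S" if "x \<in> space M" for x
    using measurable_space[OF g that] by (simp add: space_restrict_space)
  have r: "r (W \<omega>) \<in> S \<and> W (r (W \<omega>)) = W \<omega>" if "\<omega> \<in> S" for \<omega>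
    unfolding r_def by (rule someI[of _ \<omega>]) (use that in simp)
  have "f \<omega> x = f (r (W \<omega>)) x" if "\<omega> \<in> S" for \<omega> x
    by (rule eq) (use r[OF that] in \<open>auto simp: W_def\<close>)
  then have "(\<lambda>x. f (g x) x) \<in> measurable M N \<longleftrightarrow> (\<lambda>x. f (r (W (g x))) x) \<in> measurable M N"
    using gS by (intro measurable_cong) blast
  also have "\<dots>"
  proof (rule measurable_compose_countable'[where I="W ` S" and g="\<lambda>x. W (g x)" and f="\<lambda>w. f (r w)"])
    show "countable (W ` S)" by (rule countable_subset[OF subset_UNIV]) simp
    then show "(\<lambda>x. W (g x)) \<in> measurable M (count_space (W ` S))"
    proof (subst measurable_count_space_eq_countable, safe)
      fix x assume "x \<in> space M" then show "W (g x) \<in> W ` S" using gS by blast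
    next
      fix \<omega> assume "\<omega> \<in> S"
      have gb: "g \<in> measurable M borel"
        using g by (simp add: measurable_restrict_space2_iff)
      have "(\<lambda>x. W (g x)) -` {W \<omega>} \<inter> space M = {x \<in> space M. \<forall>i\<in>{..<n}. g x (int i) = \<omega> (int i)}"
        by (auto simp: W_def)
      also have "\<dots> \<in> sets M"
      proof (rule sets.sets_Collect_finite_All)
        fix i
        have "(\<lambda>x. g x (int i)) \<in> measurable M borel"
          by (rule measurable_compose[OF gb coordinate_measurable])
        from measurable_sets[OF this, of "{\<omega> (int i)}"]
        show "{x \<in> space M. g x (int i) = \<omega> (int i)} \<in> sets M"
          by (simp add: vimage_def Int_def conj_commute)
      qed auto
      finally show "(\<lambda>x. W (g x)) -` {W \<omega>} \<inter> space M \<in> sets M" .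
    qed
    show "f (r w) \<in> measurable M N" if "w \<in> W ` S" for w
      using that r by (auto intro!: f)
  qed
  finally show ?thesis .
qed

text \<open>One countable basis is enough. For each basic \<open>b\<close> in the first factor, the
  union of all open \<open>V\<close> with \<open>b \<times> V \<subseteq> W\<close> is again open,
  and these countably many rectangles fill \<open>W\<close>.\<close>

lemma sets_borel_prod:
  "sets (borel :: ('b::second_countable_topology \<times> 'a::topological_space) measure) = sets (borel \<Otimes>\<^sub>M borel)"
proof (rule antisym)
  show "sets (borel :: ('b \<times> 'a) measure) \<subseteq> sets (borel \<Otimes>\<^sub>M borel)"
    unfolding borel_def[where 'a="'b \<times> 'a"]
  proof (subst sets_measure_of, simp, rule sets.sigma_sets_subset', safe)
    fix W :: "('b \<times> 'a) set" assume W: "open W"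
    obtain B :: "'b set set" where B: "countable B" "topological_basis B"
      using ex_countable_basis by blast
    have "W = (\<Union>b\<in>B. b \<times> \<Union>{V. open V \<and> b \<times> V \<subseteq> W})"
    proof (intro equalityI subsetI)
      fix p assume "p \<in> W"
      then obtain U V where UV: "open U" "open V" "p \<in> U \<times> V" "U \<times> V \<subseteq> W"
        using W by (auto simp: open_prod_def)
      then obtain b where b: "b \<in> B" "fst p \<in> b" "b \<subseteq> U"
        using topological_basisE[OF B(2) UV(1), of "fst p"] by (auto simp: mem_Times_iff)
      have "b \<times> V \<subseteq> W" using b(3) UV(4) by blast
      then have "snd p \<in> \<Union>{V. open V \<and> b \<times> V \<subseteq> W}" using UV by (auto intro!: exI[of _ V])
      with b show "p \<in> (\<Union>b\<in>B. b \<times> \<Union>{V. open V \<and> b \<times> V \<subseteq> W})" by (auto simp: mem_Times_iff)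
    qed auto
    also have "\<dots> \<in> sets (borel \<Otimes>\<^sub>M borel)"
      using B by (intro sets.countable_UN'' pair_measureI borel_open open_Union) (auto intro: topological_basis_open)
    finally show "W \<in> sets (borel \<Otimes>\<^sub>M borel)" .
  next
    show "UNIV \<in> sets (borel \<Otimes>\<^sub>M borel :: ('b \<times> 'a) measure)"
      using sets.top[of "borel \<Otimes>\<^sub>M borel :: ('b \<times> 'a) measure"] by (simp add: space_pair_measure)
  qed
  have "fst \<in> measurable (borel :: ('b \<times> 'a) measure) borel" "snd \<in> measurable (borel :: ('b \<times> 'a) measure) borel"
    by (auto intro!: borel_measurable_continuous_onI continuous_intros)
  then have id: "(\<lambda>p. (fst p, snd p)) \<in> measurable (borel :: ('b \<times> 'a) measure) (borel \<Otimes>\<^sub>M borel)"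
    by measurable
  show "sets (borel \<Otimes>\<^sub>M borel) \<subseteq> sets (borel :: ('b \<times> 'a) measure)"
    using measurable_sets[OF id] by auto
qed

text \<open>Turns the \<sigma>-algebra of \<open>invariant_measures\<close> into a product, so that
  kernels and sections become available.\<close>

lemma sets_restrict_prod:
  fixes P :: "'b::second_countable_topology measure"
  assumes P: "sets P = sets (restrict_space borel S)"
  shows "sets (restrict_space (borel :: ('b \<times> 'a::topological_space) measure) (S \<times> UNIV)) = sets (P \<Otimes>\<^sub>M borel)"
proof (rule antisym)
  have spP: "space P = S" using sets_eq_imp_space_eq[OF P] by (simp add: space_restrict_space)
  have PP: "measurable M P = measurable M (restrict_space borel S)" for M :: "'c measure"
    using P by (intro measurable_cong_sets) auto
  have Pid: "(\<lambda>x. x) \<in> measurable P borel"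
    using P by (simp cong: measurable_cong_sets add: measurable_restrict_space1)
  have fsb: "fst \<in> measurable (borel :: ('b \<times> 'a) measure) borel" "snd \<in> measurable (borel :: ('b \<times> 'a) measure) borel"
    by (auto intro!: borel_measurable_continuous_onI continuous_intros)
  have 1: "(\<lambda>p. p) \<in> measurable (P \<Otimes>\<^sub>M borel) (borel :: ('b \<times> 'a) measure)"
  proof -
    have f: "fst \<in> measurable (P \<Otimes>\<^sub>M (borel :: 'a measure)) borel"
      by (rule measurable_compose[OF measurable_fst Pid])
    have s: "snd \<in> measurable (P \<Otimes>\<^sub>M (borel :: 'a measure)) borel" by measurable
    have "(\<lambda>p. (fst p, snd p)) \<in> measurable (P \<Otimes>\<^sub>M borel) (borel \<Otimes>\<^sub>M (borel :: 'a measure))"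
      by (rule measurable_Pair[OF f s])
    then show ?thesis using sets_borel_prod[where 'b='b and 'a='a] by (simp cong: measurable_cong_sets)
  qed
  show "sets (restrict_space (borel :: ('b \<times> 'a) measure) (S \<times> UNIV)) \<subseteq> sets (P \<Otimes>\<^sub>M borel)"
  proof
    fix A :: "('b \<times> 'a) set" assume "A \<in> sets (restrict_space borel (S \<times> UNIV))"
    then obtain B where "A = (S \<times> UNIV) \<inter> B" "B \<in> sets borel" by (auto simp: sets_restrict_space)
    then show "A \<in> sets (P \<Otimes>\<^sub>M borel)"
      using measurable_sets[OF 1, of B] by (simp add: space_pair_measure spP Int_commute)
  qed
  let ?R = "restrict_space (borel :: ('b \<times> 'a) measure) (S \<times> UNIV)"
  have f: "fst \<in> measurable ?R P"
    unfolding PP by (intro measurable_restrict_space2 measurable_restrict_space1 fsb) (auto simp: space_restrict_space)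
  have s: "snd \<in> measurable ?R borel"
    by (intro measurable_restrict_space1 fsb)
  have 2: "(\<lambda>p. (fst p, snd p)) \<in> measurable ?R (P \<Otimes>\<^sub>M borel)"
    by (rule measurable_Pair[OF f s])
  show "sets (P \<Otimes>\<^sub>M borel) \<subseteq> sets ?R"
  proof
    fix A assume A: "A \<in> sets (P \<Otimes>\<^sub>M (borel :: 'a measure))"
    from measurable_sets[OF 2 this] sets.sets_into_space[OF A]
    show "A \<in> sets ?R" by (simp add: space_restrict_space space_pair_measure spP Int_absorb2)
  qed
qed

lemma kernel_section_measurable:
  assumes \<kappa>: "\<kappa> \<in> measurable P (prob_algebra L)" and A: "A \<in> sets (P \<Otimes>\<^sub>M L)"
  shows "(\<lambda>\<omega>. emeasure (\<kappa> \<omega>) {x. (\<omega>, x) \<in> A}) \<in> borel_measurable P"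
proof (rule emeasure_measurable_subprob_algebra2[OF _ measurable_prob_algebraD[OF \<kappa>]])
  have "(SIGMA \<omega>:space P. {x. (\<omega>, x) \<in> A}) = A"
    using sets.sets_into_space[OF A] by (auto simp: space_pair_measure)
  then show "(SIGMA \<omega>:space P. {x. (\<omega>, x) \<in> A}) \<in> sets (P \<Otimes>\<^sub>M L)" using A by simp
qed

text \<open>Place \<open>\<kappa> \<omega>\<close> on the fibre over \<open>\<omega>\<close> and mix
  over \<open>P\<close> with the monadic \<open>bind\<close>.\<close>

lemma kernel_measure_exists:
  assumes P: "prob_space P" and \<kappa>: "\<kappa> \<in> measurable P (prob_algebra L)"
  obtains m where "sets m = sets (P \<Otimes>\<^sub>M L)" "prob_space m"
    "\<And>A. A \<in> sets m \<Longrightarrow> emeasure m A = (\<integral>\<^sup>+\<omega>. emeasure (\<kappa> \<omega>) {x. (\<omega>, x) \<in> A} \<partial>P)"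
proof -
  define k where "k \<omega> = distr (\<kappa> \<omega>) (P \<Otimes>\<^sub>M L) (Pair \<omega>)" for \<omega>
  have k: "k \<in> measurable P (prob_algebra (P \<Otimes>\<^sub>M L))"
    unfolding k_def by (rule measurable_distr_prob_space2[OF \<kappa>]) (simp add: split_beta')
  have P': "P \<in> space (prob_algebra P)" using P by (simp add: space_prob_algebra)
  have ne: "space P \<noteq> {}" by (rule prob_space.not_empty[OF P])
  define m where "m = bind P k"
  show thesis
  proof (rule that[of m])
    have "sets (k \<omega>) = sets (P \<Otimes>\<^sub>M L)" for \<omega> by (simp add: k_def)
    then show sm: "sets m = sets (P \<Otimes>\<^sub>M L)" unfolding m_def using ne by (rule sets_bind)
    show "prob_space m" unfolding m_def by (rule prob_space_bind'[OF P' k])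
    fix A assume "A \<in> sets m"
    then have A: "A \<in> sets (P \<Otimes>\<^sub>M L)" by (simp add: sm)
    have "emeasure m A = (\<integral>\<^sup>+\<omega>. emeasure (k \<omega>) A \<partial>P)"
      unfolding m_def by (rule emeasure_bind_prob_algebra[OF P' k A])
    also have "\<dots> = (\<integral>\<^sup>+\<omega>. emeasure (\<kappa> \<omega>) {x. (\<omega>, x) \<in> A} \<partial>P)"
    proof (rule nn_integral_cong)
      fix \<omega> assume \<omega>: "\<omega> \<in> space P"
      have s\<kappa>: "sets (\<kappa> \<omega>) = sets L"
        using measurable_space[OF \<kappa> \<omega>] by (simp add: space_prob_algebra)
      have "Pair \<omega> \<in> measurable (\<kappa> \<omega>) (P \<Otimes>\<^sub>M L)"
        using measurable_Pair1'[OF \<omega>, of L] s\<kappa> by (simp cong: measurable_cong_sets)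
      then show "emeasure (k \<omega>) A = emeasure (\<kappa> \<omega>) {x. (\<omega>, x) \<in> A}"
        unfolding k_def using A sets.sets_into_space[OF A] sets_eq_imp_space_eq[OF s\<kappa>]
        by (subst emeasure_distr) (auto simp: space_pair_measure intro!: arg_cong[where f="emeasure (\<kappa> \<omega>)"])
    qed
    finally show "emeasure m A = (\<integral>\<^sup>+\<omega>. emeasure (\<kappa> \<omega>) {x. (\<omega>, x) \<in> A} \<partial>P)" .
  qed
qed

lemma preim_cong:
  assumes "\<And>i. i < n \<Longrightarrow> \<omega> (int i) = \<omega>' (int i)"
  shows "preim T \<omega> n = preim T \<omega>' n"
proof
  fix z
  have "fiber_iter T \<omega> n = fiber_iter T \<omega>' n" by (rule fiber_iter_cong) (rule assms)
  then show "preim T \<omega> n z = preim T \<omega>' n z" by (simp add: preim_def)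
qed

locale shift_expanding_ifs = expanding_ifs +
  fixes P :: "(int \<Rightarrow> nat) measure"
  assumes sets_P: "sets P = sets (restrict_space borel (full_shift l))"
    and prob_P: "prob_space P" and shift_P: "distr P P shift = P"
begin

sublocale P: prob_space P by (rule prob_P)

lemma space_P: "space P = \<Sigma>"
  using sets_eq_imp_space_eq[OF sets_P] by (simp add: space_restrict_space)

lemma measurable_P_eq: "measurable M P = measurable M (restrict_space borel \<Sigma>)"
  using sets_P by (intro measurable_cong_sets) auto

lemma shift_pow_measurable [measurable]: "shift_pow k \<in> measurable P P"
proof -
  have "shift_pow k \<in> measurable (restrict_space borel \<Sigma>) (restrict_space borel \<Sigma>)"
    by (intro measurable_restrict_space3 shift_pow_borel_measurable) auto
  then show ?thesis using sets_P by (simp cong: measurable_cong_sets)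
qed

lemma finite_coordinates_P:
  assumes "g \<in> measurable M P" "\<And>\<omega>. \<omega> \<in> \<Sigma> \<Longrightarrow> f \<omega> \<in> measurable M L"
    "\<And>\<omega> \<omega>' x. (\<And>i. i < n \<Longrightarrow> \<omega> (int i) = \<omega>' (int i)) \<Longrightarrow> f \<omega> x = f \<omega>' x"
  shows "(\<lambda>x. f (g x) x) \<in> measurable M L"
  by (rule measurable_finite_coordinates[OF _ assms(2,3)]) (use assms(1) measurable_P_eq in auto)

lemma finite_coordinates_const:
  assumes "\<And>\<omega> \<omega>'. (\<And>i. i < n \<Longrightarrow> \<omega> (int i) = \<omega>' (int i)) \<Longrightarrow> f \<omega> = (f \<omega>' :: real)"
  shows "f \<in> borel_measurable P"
proof (rule finite_coordinates_P[of "\<lambda>\<omega>. \<omega>" P "\<lambda>\<omega> x. f \<omega>" borel n])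
  fix \<omega> \<omega>' :: "int \<Rightarrow> nat" assume "\<And>i. i < n \<Longrightarrow> \<omega> (int i) = \<omega>' (int i)"
  then show "f \<omega> = f \<omega>'" by (rule assms)
qed simp_all

lemma distr_shift_pow: "distr P P (shift_pow (int n)) = P"
proof (induction n)
  case 0
  have "shift_pow (int 0) = (\<lambda>\<omega>. \<omega>)" by (auto simp: fun_eq_iff)
  then show ?case by (simp add: distr_id)
next
  case (Suc n)
  have "shift_pow (int (Suc n)) = shift \<circ> shift_pow (int n)"
    by (auto simp: shift_eq_shift_pow fun_eq_iff)
  then have "distr P P (shift_pow (int (Suc n))) = distr (distr P P (shift_pow (int n))) P shift"
    by (subst distr_distr) (auto simp: shift_eq_shift_pow)
  then show ?case by (simp add: Suc shift_P)
qed

lemma nn_integral_shift_pow: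
  "f \<in> borel_measurable P \<Longrightarrow> (\<integral>\<^sup>+\<omega>. f (shift_pow (int n) \<omega>) \<partial>P) = (\<integral>\<^sup>+\<omega>. f \<omega> \<partial>P)"
  using nn_integral_distr[of "shift_pow (int n)" P P f] by (simp add: distr_shift_pow)

lemma integral_shift_pow:
  fixes f :: "_ \<Rightarrow> real"
  shows "f \<in> borel_measurable P \<Longrightarrow> (\<integral>\<omega>. f (shift_pow (int n) \<omega>) \<partial>P) = (\<integral>\<omega>. f \<omega> \<partial>P)"
  using integral_distr[of "shift_pow (int n)" P P f] by (simp add: distr_shift_pow)

text \<open>The eigenvalue may depend on the whole future of \<open>\<omega>\<close>, but it is a
  limit of averages each of which reads finitely many symbols.\<close>

lemma lam_measurable [measurable]: "lam \<in> borel_measurable P"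
proof (rule borel_measurable_LIMSEQ_real)
  let ?a = "\<lambda>n \<omega>. avg T (shift_pow 1 \<omega>) n (tsum T \<omega> 1 (\<lambda>_. 1)) undefined"
  show "(\<lambda>n. ?a n \<omega>) \<longlonglongrightarrow> lam \<omega>" if "\<omega> \<in> space P" for \<omega>
    unfolding lam_def using that by (intro avg_tendsto_nu tsum_continuous) (auto simp: space_P)
  fix n
  show "?a n \<in> borel_measurable P"
  proof (rule finite_coordinates_const)
    fix \<omega> \<omega>' :: "int \<Rightarrow> nat" assume eq: "\<And>i. i < Suc n \<Longrightarrow> \<omega> (int i) = \<omega>' (int i)"
    have "preim T (shift_pow 1 \<omega>) n = preim T (shift_pow 1 \<omega>') n"
      using eq[of "Suc _"] by (intro preim_cong) (simp add: shift_pow_apply add.commute)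
    moreover have "preim T \<omega> 1 = preim T \<omega>' 1" by (rule preim_cong) (rule eq, simp)
    ultimately show "?a n \<omega> = ?a n \<omega>'" by (simp add: avg_def tsum_def cnt_def)
  qed
qed

lemma Lam_measurable [measurable]: "(\<lambda>\<omega>. Lam \<omega> n) \<in> borel_measurable P"
  unfolding Lam_def by measurable

lemma ln_lam_bounds: "\<omega> \<in> \<Sigma> \<Longrightarrow> 0 \<le> ln (lam \<omega>)" "\<omega> \<in> \<Sigma> \<Longrightarrow> ln (lam \<omega>) \<le> ln (real D)"
  using lam_ge_1[of \<omega>] by auto

lemma ln_lam_integrable: "integrable P (\<lambda>\<omega>. ln (lam \<omega>))"
  by (rule P.integrable_const_bound[where B="ln (real D)"]) (auto simp: space_P ln_lam_bounds)

lemma ln_Lam: "\<omega> \<in> \<Sigma> \<Longrightarrow> ln (Lam \<omega> n) = (\<Sum>k<n. ln (lam (shift_pow (int k) \<omega>)))"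
  unfolding Lam_def
proof (rule ln_prod)
  fix k assume "\<omega> \<in> \<Sigma>"
  then show "lam (shift_pow (int k) \<omega>) \<noteq> 0"
    using lam_ge_1(1)[of "shift_pow (int k) \<omega>"] by simp
qed simp

text \<open>\<open>ln (Lam \<omega> n)\<close> is a sum of \<open>ln (lam \<omega>)\<close> along
  the orbit, and invariance of \<open>P\<close> gives every term the same integral. This is how the
  integral of the theorem arises as a growth rate.\<close>

lemma ln_Lam_integrable: "integrable P (\<lambda>\<omega>. ln (Lam \<omega> n))"
  and ln_Lam_integral: "(\<integral>\<omega>. ln (Lam \<omega> n) \<partial>P) = real n * (\<integral>\<omega>. ln (lam \<omega>) \<partial>P)"
proof -
  have 1: "integrable P (\<lambda>\<omega>. ln (lam (shift_pow (int k) \<omega>)))" for k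
    by (rule P.integrable_const_bound[where B="ln (real D)"]) (auto simp: space_P ln_lam_bounds)
  have "integrable P (\<lambda>\<omega>. ln (Lam \<omega> n)) \<longleftrightarrow> integrable P (\<lambda>\<omega>. \<Sum>k<n. ln (lam (shift_pow (int k) \<omega>)))"
    by (rule Bochner_Integration.integrable_cong) (auto simp: space_P ln_Lam)
  then show "integrable P (\<lambda>\<omega>. ln (Lam \<omega> n))" using 1 by simp
  have "(\<integral>\<omega>. ln (Lam \<omega> n) \<partial>P) = (\<integral>\<omega>. (\<Sum>k<n. ln (lam (shift_pow (int k) \<omega>))) \<partial>P)"
    by (rule Bochner_Integration.integral_cong) (auto simp: space_P ln_Lam)
  also have "\<dots> = (\<Sum>k<n. \<integral>\<omega>. ln (lam (shift_pow (int k) \<omega>)) \<partial>P)"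
    by (rule Bochner_Integration.integral_sum) (rule 1)
  also have "\<dots> = (\<Sum>k<n. \<integral>\<omega>. ln (lam \<omega>) \<partial>P)"
    by (intro sum.cong refl integral_shift_pow) measurable
  finally show "(\<integral>\<omega>. ln (Lam \<omega> n) \<partial>P) = real n * (\<integral>\<omega>. ln (lam \<omega>) \<partial>P)" by simp
qed

lemma eigenvalue_integral: "(\<integral>\<omega>. ln (eigenvalue T \<omega>) \<partial>P) = (\<integral>\<omega>. ln (lam \<omega>) \<partial>P)"
  by (rule Bochner_Integration.integral_cong) (auto simp: space_P eigenvalue_eq_lam)

lemma fiber_iter_measurable [measurable]:
  "(\<lambda>p. fiber_iter T (fst p) n (snd p)) \<in> measurable (P \<Otimes>\<^sub>M borel) borel"
proof (rule finite_coordinates_P[where f="\<lambda>\<omega> p. fiber_iter T \<omega> n (snd p)" and g=fst and n=n])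
  fix \<omega> assume "\<omega> \<in> \<Sigma>"
  from borel_measurable_continuous_onI[OF cont_iter[OF this]]
  show "(\<lambda>p. fiber_iter T \<omega> n (snd p)) \<in> measurable (P \<Otimes>\<^sub>M borel) borel"
    by (rule measurable_compose[OF measurable_snd])
next
  fix \<omega> \<omega>' :: "int \<Rightarrow> nat" and p :: "(int \<Rightarrow> nat) \<times> 'a"
  assume "\<And>i. i < n \<Longrightarrow> \<omega> (int i) = \<omega>' (int i)"
  then have "fiber_iter T \<omega> n = fiber_iter T \<omega>' n" by (rule fiber_iter_cong)
  then show "fiber_iter T \<omega> n (snd p) = fiber_iter T \<omega>' n (snd p)" by simp
qed simp

text \<open>Two nested limits reduce the integral to finitely many symbols: the density through
  \<open>h_approx\<close>, and integration against \<open>nu \<omega>\<close> through averages over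
  preimages.\<close>

lemma mu_integral_measurable:
  assumes \<psi>: "continuous_on UNIV (\<psi> :: 'a \<Rightarrow> real)"
  shows "(\<lambda>\<omega>. \<integral>x. \<psi> x \<partial>mu \<omega>) \<in> borel_measurable P"
proof (rule borel_measurable_LIMSEQ_real)
  show "(\<lambda>k. \<integral>x. \<psi> x * h_approx \<omega> k x \<partial>nu \<omega>) \<longlonglongrightarrow> (\<integral>x. \<psi> x \<partial>mu \<omega>)" if "\<omega> \<in> space P" for \<omega>
    using that h_approx_integral_tendsto[OF _ \<psi>] by (simp add: mu_integral[OF _ \<psi>] space_P)
  fix k
  show "(\<lambda>\<omega>. \<integral>x. \<psi> x * h_approx \<omega> k x \<partial>nu \<omega>) \<in> borel_measurable P"
  proof (rule borel_measurable_LIMSEQ_real)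
    show "(\<lambda>n. avg T \<omega> n (\<lambda>x. \<psi> x * h_approx \<omega> k x) undefined) \<longlonglongrightarrow> (\<integral>x. \<psi> x * h_approx \<omega> k x \<partial>nu \<omega>)"
      if "\<omega> \<in> space P" for \<omega>
      using that by (intro avg_tendsto_nu continuous_on_mult \<psi> h_approx_continuous) (auto simp: space_P)
    fix n
    \<comment> \<open>\<open>h_approx \<omega> k\<close> reads \<open>k\<close> symbols of the past.
      Rewritten in terms of \<open>\<eta> = shift_pow (- int k) \<omega>\<close>, the expression
      reads nonnegative positions only, where the finite-coordinate argument applies; composing with
      the inverse shift brings it back.\<close>
    define F where "F \<eta> = avg T (shift_pow (int k) \<eta>) n (\<lambda>x. \<psi> x * cnt T \<eta> k x) undefined" for \<eta>
    have "F \<in> borel_measurable P"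
    proof (rule finite_coordinates_const)
      fix \<omega> \<omega>' :: "int \<Rightarrow> nat" assume eq: "\<And>i. i < k + n \<Longrightarrow> \<omega> (int i) = \<omega>' (int i)"
      have "preim T (shift_pow (int k) \<omega>) n = preim T (shift_pow (int k) \<omega>') n"
        using eq[of "k + _"] by (intro preim_cong) (simp add: shift_pow_apply add.commute)
      moreover have "preim T \<omega> k = preim T \<omega>' k" by (rule preim_cong) (rule eq, simp)
      ultimately show "F \<omega> = F \<omega>'" by (simp add: F_def avg_def tsum_def cnt_def)
    qed
    then have "(\<lambda>\<omega>. F (shift_pow (- int k) \<omega>) / Lam (shift_pow (- int k) \<omega>) k) \<in> borel_measurable P"
      by measurable
    also have "(\<lambda>\<omega>. F (shift_pow (- int k) \<omega>) / Lam (shift_pow (- int k) \<omega>) k) =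
        (\<lambda>\<omega>. avg T \<omega> n (\<lambda>x. \<psi> x * h_approx \<omega> k x) undefined)"
      by (auto simp: F_def avg_def tsum_def h_approx_def fun_eq_iff sum_divide_distrib mult.commute)
    finally show "(\<lambda>\<omega>. avg T \<omega> n (\<lambda>x. \<psi> x * h_approx \<omega> k x) undefined) \<in> borel_measurable P" .
  qed
qed

lemma mu_kernel: "mu \<in> measurable P (prob_algebra borel)"
proof (rule measurable_prob_algebra_generated[where G="Collect closed" and \<Omega>=UNIV])
  fix A :: "'a set" assume "A \<in> Collect closed"
  then have cl: "closed A" by simp
  obtain f :: "nat \<Rightarrow> 'a \<Rightarrow> real" where f: "\<And>n. continuous_on UNIV (f n)"
    "\<And>n x. 0 \<le> f n x" "\<And>n x. f n x \<le> 1" "\<And>x. (\<lambda>n. f n x) \<longlonglongrightarrow> indicator A x"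
    by (rule closed_indicator_approx[OF cl]) (rule that)
  have "(\<lambda>\<omega>. measure (mu \<omega>) A) \<in> borel_measurable P"
  proof (rule borel_measurable_LIMSEQ_real[OF _ mu_integral_measurable[OF f(1)]])
    show "(\<lambda>j. \<integral>x. f j x \<partial>mu \<omega>) \<longlonglongrightarrow> measure (mu \<omega>) A" if "\<omega> \<in> space P" for \<omega>
      using that prob_mu[of \<omega>] sets_mu[of \<omega>] borel_closed[OF cl] f
      by (intro measure_closed_limit) (auto simp: space_P prob_space_def)
  qed
  then have "(\<lambda>\<omega>. ennreal (measure (mu \<omega>) A)) \<in> borel_measurable P" by measurable
  also have "(\<lambda>\<omega>. ennreal (measure (mu \<omega>) A)) \<in> borel_measurable P \<longleftrightarrow> (\<lambda>\<omega>. emeasure (mu \<omega>) A) \<in> borel_measurable P"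
    using prob_mu by (intro measurable_cong)
      (auto simp: space_P finite_measure.emeasure_eq_measure prob_space_def)
  finally show "(\<lambda>\<omega>. emeasure (mu \<omega>) A) \<in> borel_measurable P" .
qed (auto simp: space_P prob_mu sets_mu borel_eq_closed Int_stable_def)

section \<open>The skew product and its invariant measures\<close>

definition skew_iter :: "nat \<Rightarrow> (int \<Rightarrow> nat) \<times> 'a \<Rightarrow> (int \<Rightarrow> nat) \<times> 'a" where
  "skew_iter n p = (shift_pow (int n) (fst p), fiber_iter T (fst p) n (snd p))"

lemma skew_iter_Suc: "skew_iter (Suc n) = skew T \<circ> skew_iter n"
  by (auto simp: skew_iter_def skew_def fun_eq_iff shift_eq_shift_pow shift_pow_apply)

lemma skew_iter_measurable [measurable]: "skew_iter n \<in> measurable (P \<Otimes>\<^sub>M borel) (P \<Otimes>\<^sub>M borel)"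
  unfolding skew_iter_def by measurable

lemma skew_eq_skew_iter: "skew T = skew_iter 1"
  by (auto simp: skew_iter_def skew_def shift_eq_shift_pow)

definition inv_meas :: "((int \<Rightarrow> nat) \<times> 'a) measure \<Rightarrow> bool" where
  "inv_meas m \<longleftrightarrow> sets m = sets (P \<Otimes>\<^sub>M borel) \<and> prob_space m \<and> distr m m (skew T) = m \<and> distr m P fst = P"

lemma inv_meas_iff: "inv_meas m \<longleftrightarrow> m \<in> {m \<in> invariant_measures l T. distr m P fst = P}"
  using sets_restrict_prod[OF sets_P, where 'a='a] by (auto simp: inv_meas_def invariant_measures_def)

text \<open>Invariance splits into equivariance on the fibres, which is \<open>mu_image\<close>, and
  invariance of \<open>P\<close> in the base.\<close>

lemma mu_measure:
  obtains m where "inv_meas m" "is_disintegration P m mu"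
proof -
  obtain m where sm: "sets m = sets (P \<Otimes>\<^sub>M (borel :: 'a measure))" and pm: "prob_space m"
    and em: "\<And>A. A \<in> sets m \<Longrightarrow> emeasure m A = (\<integral>\<^sup>+\<omega>. emeasure (mu \<omega>) {x. (\<omega>, x) \<in> A} \<partial>P)"
    by (rule kernel_measure_exists[OF prob_P mu_kernel]) (rule that)
  have spm: "space m = \<Sigma> \<times> UNIV"
    using sets_eq_imp_space_eq[OF sm] by (simp add: space_pair_measure space_P)
  have mf: "fst \<in> measurable m P" using sm by (simp cong: measurable_cong_sets)
  have ms: "skew T \<in> measurable m m"
    unfolding skew_eq_skew_iter using sm skew_iter_measurable[of 1] by (simp cong: measurable_cong_sets)
  have "distr m P fst = P"
  proof (rule measure_eqI)
    fix E assume "E \<in> sets (distr m P fst)"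
    then have E: "E \<in> sets P" by simp
    have "emeasure (distr m P fst) E = emeasure m (fst -` E \<inter> space m)"
      by (rule emeasure_distr[OF mf E])
    also have "\<dots> = (\<integral>\<^sup>+\<omega>. emeasure (mu \<omega>) {x. (\<omega>, x) \<in> fst -` E \<inter> space m} \<partial>P)"
      by (rule em[OF measurable_sets[OF mf E]])
    also have "\<dots> = (\<integral>\<^sup>+\<omega>. indicator E \<omega> \<partial>P)"
    proof (rule nn_integral_cong)
      fix \<omega> assume "\<omega> \<in> space P"
      then have \<omega>: "\<omega> \<in> \<Sigma>" by (simp add: space_P)
      have "emeasure (mu \<omega>) UNIV = 1"
        using prob_space.emeasure_space_1[OF prob_mu[OF \<omega>]] sets_eq_imp_space_eq[OF sets_mu[OF \<omega>]] by simp
      then show "emeasure (mu \<omega>) {x. (\<omega>, x) \<in> fst -` E \<inter> space m} = indicator E \<omega>"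
        using \<omega> by (auto simp: spm indicator_def)
    qed
    finally show "emeasure (distr m P fst) E = emeasure P E" using E by simp
  qed simp
  moreover have "distr m m (skew T) = m"
  proof (rule measure_eqI)
    fix A assume "A \<in> sets (distr m m (skew T))"
    then have A: "A \<in> sets m" by simp
    then have A': "A \<in> sets (P \<Otimes>\<^sub>M borel)" using sm by simp
    have Ax: "{x. (\<omega>, x) \<in> A} \<in> sets borel" for \<omega>
      using sets_Pair1[OF A', of \<omega>] by (simp add: vimage_def)
    have "emeasure (distr m m (skew T)) A = emeasure m (skew T -` A \<inter> space m)"
      by (rule emeasure_distr[OF ms A])
    also have "\<dots> = (\<integral>\<^sup>+\<omega>. emeasure (mu \<omega>) {x. (\<omega>, x) \<in> skew T -` A \<inter> space m} \<partial>P)"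
      by (rule em[OF measurable_sets[OF ms A]])
    also have "\<dots> = (\<integral>\<^sup>+\<omega>. emeasure (mu (shift_pow (int 1) \<omega>)) {x. (shift_pow (int 1) \<omega>, x) \<in> A} \<partial>P)"
    proof (rule nn_integral_cong)
      fix \<omega> assume "\<omega> \<in> space P"
      then have \<omega>: "\<omega> \<in> \<Sigma>" by (simp add: space_P)
      have "T (\<omega> 0) \<in> measurable (mu \<omega>) borel"
        using borel_measurable_continuous_onI[OF cont[OF \<Sigma>_less[OF \<omega>]]] sets_mu[OF \<omega>] by (simp cong: measurable_cong_sets)
      then have "emeasure (mu (shift_pow 1 \<omega>)) {x. (shift_pow 1 \<omega>, x) \<in> A} =
          emeasure (mu \<omega>) (T (\<omega> 0) -` {x. (shift_pow 1 \<omega>, x) \<in> A} \<inter> space (mu \<omega>))"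
        unfolding mu_image[OF \<omega>, symmetric] using Ax by (intro emeasure_distr)
      also have "T (\<omega> 0) -` {x. (shift_pow 1 \<omega>, x) \<in> A} \<inter> space (mu \<omega>) = {x. (\<omega>, x) \<in> skew T -` A \<inter> space m}"
        using \<omega> sets_eq_imp_space_eq[OF sets_mu[OF \<omega>]] by (auto simp: spm skew_def shift_eq_shift_pow)
      finally show "emeasure (mu \<omega>) {x. (\<omega>, x) \<in> skew T -` A \<inter> space m} =
          emeasure (mu (shift_pow (int 1) \<omega>)) {x. (shift_pow (int 1) \<omega>, x) \<in> A}" by simp
    qed
    also have "\<dots> = (\<integral>\<^sup>+\<omega>. emeasure (mu \<omega>) {x. (\<omega>, x) \<in> A} \<partial>P)"
      by (rule nn_integral_shift_pow[OF kernel_section_measurable[OF mu_kernel A']])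
    finally show "emeasure (distr m m (skew T)) A = emeasure m A" by (simp add: em[OF A])
  qed simp
  ultimately have "inv_meas m" by (simp add: inv_meas_def sm pm)
  moreover have "is_disintegration P m mu"
    unfolding is_disintegration_def using mu_kernel em by blast
  ultimately show thesis by (rule that)
qed

text \<open>Existence of some disintegration is what gives the \<open>SOME\<close> in
  \<open>disintegration\<close> its meaning.\<close>

lemma disintegration_inv_meas:
  assumes "inv_meas m"
  shows "is_disintegration P m (disintegration P m)"
proof -
  obtain \<kappa> where \<kappa>: "\<kappa> \<in> measurable P (prob_algebra borel)"
    "\<And>A. A \<in> sets m \<Longrightarrow> emeasure m A = (\<integral>\<^sup>+\<omega>. emeasure (\<kappa> \<omega>) {x. (\<omega>, x) \<in> A} \<partial>P)"
    using assms unfolding inv_meas_def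
    by (elim conjE) (rule disintegration_exists[OF comp prob_P], auto)
  have "is_disintegration P m \<kappa>" using \<kappa> unfolding is_disintegration_def by blast
  then show ?thesis unfolding disintegration_def by (rule someI[of "is_disintegration P m"])
qed

lemma distr_skew_iter:
  assumes m: "inv_meas m"
  shows "distr m m (skew_iter n) = m"
proof (induction n)
  case 0
  have "skew_iter 0 = (\<lambda>p. p)" by (auto simp: skew_iter_def fun_eq_iff)
  then show ?case by (simp add: distr_id)
next
  case (Suc n)
  have sm: "sets m = sets (P \<Otimes>\<^sub>M borel)" using m by (simp add: inv_meas_def)
  have sk: "skew_iter k \<in> measurable m m" for k
    using skew_iter_measurable[of k] sm by (simp cong: measurable_cong_sets)
  have "distr m m (skew_iter (Suc n)) = distr (distr m m (skew_iter n)) m (skew T)"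
    unfolding skew_iter_Suc by (rule distr_distr[symmetric]) (use sk sk[of 1] skew_eq_skew_iter in auto)
  then show ?case using m by (simp add: Suc inv_meas_def)
qed

end

section \<open>Entropy of partitions\<close>

lemma fekete:
  fixes a :: "nat \<Rightarrow> real"
  assumes nonneg: "\<And>n. 0 \<le> a n" and sub: "\<And>m n. a (m + n) \<le> a m + a n"
  shows "convergent (\<lambda>n. 1 / real n * a n)"
proof -
  define L where "L = (INF n\<in>{1..}. a n / real n)"
  have bdd: "bdd_below ((\<lambda>n. a n / real n) ` {1..})"
    by (rule bdd_belowI[of _ 0]) (auto simp: nonneg)
  have lower: "L \<le> a n / real n" if "1 \<le> n" for n
    unfolding L_def by (rule cINF_lower[OF bdd]) (use that in auto)
  have iter: "a (q * m + r) \<le> real q * a m + a r" for q m r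
  proof (induction q)
    case (Suc q)
    have "a (Suc q * m + r) \<le> a m + a (q * m + r)" using sub[of m "q * m + r"] by (simp add: add.assoc)
    then show ?case using Suc by (simp add: algebra_simps)
  qed simp
  have "(\<lambda>n. a n / real n) \<longlonglongrightarrow> L"
    unfolding LIMSEQ_iff
  proof (intro allI impI)
    fix e :: real assume e: "0 < e"
    have "\<exists>m\<in>{1..}. a m / real m < L + e / 2"
      using cINF_less_iff[OF _ bdd, of "L + e / 2"] e unfolding L_def[symmetric] by auto
    then obtain m where m: "1 \<le> m" "a m / real m < L + e / 2" by auto
    \<comment> \<open>\<open>B\<close> bounds the contribution of the remainder when
      \<open>n\<close> is divided by \<open>m\<close>; it disappears after division by
      \<open>n\<close>.\<close>
    define B where "B = Max (a ` {..<m})"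
    have B: "a r \<le> B" if "r < m" for r unfolding B_def using that by (intro Max_ge) auto
    have B0: "0 \<le> B" using B[of 0] nonneg[of 0] m by linarith
    obtain n0 where n0: "B / (e / 2) < real n0" using reals_Archimedean2 by blast
    show "\<exists>n0. \<forall>n\<ge>n0. norm (a n / real n - L) < e"
    proof (intro exI[of _ "max 1 n0"] allI impI)
      fix n assume n: "max 1 n0 \<le> n"
      then have n1: "1 \<le> n" "0 < real n" by auto
      have "B < real n0 * (e / 2)" using n0 e by (simp add: field_simps)
      also have "\<dots> \<le> real n * (e / 2)" using n e by (intro mult_right_mono) auto
      finally have Bn: "B < real n * (e / 2)" .
      have "a n \<le> real (n div m) * a m + a (n mod m)" using iter[of "n div m" m "n mod m"] by simp
      also have "\<dots> \<le> real (n div m) * a m + B" using B[of "n mod m"] m by simp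
      also have "real (n div m) * a m = real (n div m * m) * (a m / real m)" using m by simp
      also have "\<dots> \<le> real n * (a m / real m)"
        using nonneg[of m] by (intro mult_right_mono) (auto simp: times_div_less_eq_dividend simp del: of_nat_mult)
      finally have "a n \<le> real n * (a m / real m) + B" by simp
      also have "\<dots> < real n * (a m / real m) + real n * (e / 2)" using Bn by simp
      also have "\<dots> \<le> real n * (L + e / 2) + real n * (e / 2)" using m n1 by (intro add_right_mono mult_left_mono) auto
      finally have "a n / real n < L + e" using n1 by (simp add: field_simps)
      with lower[OF n1(1)] show "norm (a n / real n - L) < e" by simp
    qed
  qed
  then show ?thesis unfolding convergent_def by auto
qed

text \<open>Unlike \<open>partition_on\<close>, this admits the empty set as a cell, since a join
  may contain it.\<close>

definition parts :: "'a measure \<Rightarrow> 'a set set \<Rightarrow> bool" where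
  "parts \<nu> \<A> \<longleftrightarrow> finite \<A> \<and> \<A> \<subseteq> sets \<nu> \<and> disjoint \<A> \<and> \<Union>\<A> = space \<nu>"

lemma parts_unique: "parts \<nu> \<A> \<Longrightarrow> A \<in> \<A> \<Longrightarrow> B \<in> \<A> \<Longrightarrow> x \<in> A \<Longrightarrow> x \<in> B \<Longrightarrow> A = B"
  unfolding parts_def disjoint_def by blast

lemma parts_sum_indicator:
  assumes \<A>: "parts \<nu> \<A>" and A: "A \<in> \<A>" "x \<in> A"
  shows "(\<Sum>B\<in>\<A>. indicator B x * f B) = (f A :: real)"
proof -
  have "indicator B x * f B = (if B = A then f A else 0)" if "B \<in> \<A>" for B
    using parts_unique[OF \<A> A(1) that A(2)] A(2) by (cases "B = A") (auto simp: indicator_def)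
  then have "(\<Sum>B\<in>\<A>. indicator B x * f B) = (\<Sum>B\<in>\<A>. if B = A then f A else 0)"
    by (rule sum.cong[OF refl])
  then show ?thesis using \<A> A by (simp add: parts_def)
qed

context prob_space
begin

lemma parts_sum: "parts M \<A> \<Longrightarrow> (\<Sum>A\<in>\<A>. prob A) = 1"
  using finite_measure_finite_Union[of \<A> "\<lambda>A. A"] prob_space
  by (auto simp: parts_def disjoint_family_on_def disjoint_def)

text \<open>The inequality \<open>ln x \<le> x - 1\<close> at \<open>x = q A / prob A\<close>,
  summed over the cells. The cost is a function \<open>b\<close> of the point rather than a number
  per cell, so that it may count events, such as visits to a set, that vary within a cell.\<close>

lemma gibbs_inequality:
  assumes \<A>: "parts M \<A>" and q: "\<And>A. A \<in> \<A> \<Longrightarrow> 0 \<le> q A" "(\<Sum>A\<in>\<A>. q A) \<le> 1"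
    and b: "integrable M b"
    and qb: "\<And>A x. A \<in> \<A> \<Longrightarrow> 0 < prob A \<Longrightarrow> x \<in> A \<Longrightarrow> 0 < q A \<and> - ln (q A) \<le> b x"
  shows "partition_entropy M \<A> \<le> (\<integral>x. b x \<partial>M)"
proof -
  have fin: "finite \<A>" and sets: "\<And>A. A \<in> \<A> \<Longrightarrow> A \<in> sets M" using \<A> by (auto simp: parts_def)
  have le: "- (prob A * ln (prob A)) \<le> prob A * (- ln (q A)) + (q A - prob A)" if A: "A \<in> \<A>" for A
  proof (cases "prob A = 0")
    case False
    then have p: "0 < prob A" using measure_nonneg[of M A] by linarith
    have "A \<noteq> {}" using p by auto
    then obtain x where "x \<in> A" by auto
    then have q0: "0 < q A" using qb[OF A p] by blast
    have "prob A * ln (q A / prob A) \<le> prob A * (q A / prob A - 1)"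
      using p q0 by (intro mult_left_mono ln_le_minus_one) auto
    then show ?thesis using p q0 by (simp add: ln_div algebra_simps)
  qed (use q(1)[OF A] in simp)
  have "partition_entropy M \<A> \<le> (\<Sum>A\<in>\<A>. prob A * (- ln (q A)) + (q A - prob A))"
    unfolding partition_entropy_def sum_negf[symmetric] by (rule sum_mono) (rule le)
  also have "\<dots> \<le> (\<Sum>A\<in>\<A>. prob A * (- ln (q A)))"
    using q(2) parts_sum[OF \<A>] by (simp add: sum.distrib sum_subtractf sum_negf)
  also have "\<dots> \<le> (\<Sum>A\<in>\<A>. \<integral>x. indicator A x * b x \<partial>M)"
  proof (rule sum_mono)
    fix A assume A: "A \<in> \<A>"
    have int: "integrable M (\<lambda>x. indicator A x * b x)"
      using integrable_mult_indicator[OF sets[OF A] b] by simp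
    show "prob A * (- ln (q A)) \<le> (\<integral>x. indicator A x * b x \<partial>M)"
    proof (cases "prob A = 0")
      case True
      have "AE x in M. indicator A x * b x = 0"
        using prob_eq_0[OF sets[OF A]] True by (auto simp: indicator_def)
      then have "(\<integral>x. indicator A x * b x \<partial>M) = 0" by (rule integral_eq_zero_AE)
      then show ?thesis using True by simp
    next
      case False
      then have p: "0 < prob A" using measure_nonneg[of M A] by linarith
      have "prob A * (- ln (q A)) = (\<integral>x. indicator A x * (- ln (q A)) \<partial>M)"
        using sets[OF A] sets.sets_into_space[OF sets[OF A]] by (simp add: Int_absorb2)
      also have "\<dots> \<le> (\<integral>x. indicator A x * b x \<partial>M)"
      proof (rule integral_mono[OF _ int])
        show "integrable M (\<lambda>x. indicator A x * (- ln (q A)))"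
          using integrable_mult_indicator[OF sets[OF A] integrable_const, of "- ln (q A)"] by simp
      qed (use qb[OF A p] in \<open>auto simp: indicator_def\<close>)
      finally show ?thesis .
    qed
  qed
  also have "\<dots> = (\<integral>x. (\<Sum>A\<in>\<A>. indicator A x * b x) \<partial>M)"
    using integrable_mult_indicator[OF sets b] by (intro Bochner_Integration.integral_sum[symmetric]) simp
  also have "\<dots> = (\<integral>x. b x \<partial>M)"
  proof (rule Bochner_Integration.integral_cong[OF refl])
    fix x assume "x \<in> space M"
    then obtain A where A: "A \<in> \<A>" "x \<in> A" using \<A> by (auto simp: parts_def)
    show "(\<Sum>B\<in>\<A>. indicator B x * b x) = b x" by (rule parts_sum_indicator[OF \<A> A])
  qed
  finally show ?thesis .
qed

lemma entropy_le_ln_card: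
  assumes \<A>: "parts M \<A>"
  shows "partition_entropy M \<A> \<le> ln (real (card \<A>))"
proof -
  have "\<A> \<noteq> {}" using \<A> not_empty by (auto simp: parts_def)
  then have "0 < card \<A>" using \<A> by (auto simp: parts_def card_gt_0_iff)
  then have "partition_entropy M \<A> \<le> (\<integral>x. ln (real (card \<A>)) \<partial>M)"
    by (intro gibbs_inequality[OF \<A>, where q="\<lambda>_. 1 / real (card \<A>)"]) (auto simp: ln_div)
  then show ?thesis by (simp add: prob_space)
qed

lemma entropy_ge:
  assumes \<A>: "parts M \<A>" and \<epsilon>: "\<And>A. A \<in> \<A> \<Longrightarrow> prob A \<le> \<epsilon>"
  shows "- ln \<epsilon> \<le> partition_entropy M \<A>"
proof -
  have "(\<Sum>A\<in>\<A>. prob A * ln (prob A)) \<le> (\<Sum>A\<in>\<A>. prob A * ln \<epsilon>)"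
  proof (rule sum_mono)
    fix A assume A: "A \<in> \<A>"
    show "prob A * ln (prob A) \<le> prob A * ln \<epsilon>"
    proof (cases "prob A = 0")
      case False
      then have "0 < prob A" using measure_nonneg[of M A] by linarith
      then show ?thesis using \<epsilon>[OF A] by (intro mult_left_mono) auto
    qed simp
  qed
  also have "\<dots> = ln \<epsilon>"
    using arg_cong[OF parts_sum[OF \<A>], of "\<lambda>s. s * ln \<epsilon>"] by (simp only: sum_distrib_right mult_1)
  finally show ?thesis by (simp add: partition_entropy_def)
qed

lemma entropy_nonneg:
  assumes "parts M \<A>"
  shows "0 \<le> partition_entropy M \<A>"
  using entropy_ge[OF assms, of 1] by simp

text \<open>Gibbs' inequality with the weights of independence: a cell \<open>A \<inter> B\<close>
  receives \<open>prob A * prob B\<close>, and the cost is the sum of the information functions of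
  \<open>\<A>\<close> and \<open>\<B>\<close>, whose integrals are the two entropies.\<close>

lemma entropy_join_le:
  assumes \<A>: "parts M \<A>" and \<B>: "parts M \<B>" and \<S>: "parts M \<S>"
    and J: "\<And>S. S \<in> \<S> \<Longrightarrow> \<exists>A\<in>\<A>. \<exists>B\<in>\<B>. S = A \<inter> B"
  shows "partition_entropy M \<S> \<le> partition_entropy M \<A> + partition_entropy M \<B>"
proof -
  have "\<forall>S\<in>\<S>. \<exists>p. fst p \<in> \<A> \<and> snd p \<in> \<B> \<and> S = fst p \<inter> snd p"
    using J by force
  from bchoice[OF this] obtain p where p: "\<forall>S\<in>\<S>. fst (p S) \<in> \<A> \<and> snd (p S) \<in> \<B> \<and> S = fst (p S) \<inter> snd (p S)"
    by blast
  define f where "f S = fst (p S)" for S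
  define g where "g S = snd (p S)" for S
  have fg: "f S \<in> \<A>" "g S \<in> \<B>" "S = f S \<inter> g S" if "S \<in> \<S>" for S
    using bspec[OF p that] by (simp_all add: f_def g_def)
  define I where "I \<A> x = (\<Sum>A\<in>\<A>. indicator A x * (- ln (prob A)))" for \<A> x
  have I_eq: "I \<C> x = - ln (prob A)" if "parts M \<C>" "A \<in> \<C>" "x \<in> A" for \<C> A x
    unfolding I_def by (rule parts_sum_indicator[OF that])
  have I_int: "integrable M (I \<C>)" "(\<integral>x. I \<C> x \<partial>M) = partition_entropy M \<C>" if "parts M \<C>" for \<C>
  proof -
    have s: "A \<in> sets M" if "A \<in> \<C>" for A using that \<open>parts M \<C>\<close> by (auto simp: parts_def)
    have i: "integrable M (\<lambda>x. indicator A x * (- ln (prob A)))" if "A \<in> \<C>" for A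
      using integrable_mult_indicator[OF s[OF that] integrable_const, of "- ln (prob A)"] by simp
    show "integrable M (I \<C>)" unfolding I_def using i by (rule Bochner_Integration.integrable_sum)
    have "(\<integral>x. I \<C> x \<partial>M) = (\<Sum>A\<in>\<C>. \<integral>x. indicator A x * (- ln (prob A)) \<partial>M)"
      unfolding I_def using i by (rule Bochner_Integration.integral_sum)
    also have "\<dots> = (\<Sum>A\<in>\<C>. - (prob A * ln (prob A)))"
      using s sets.sets_into_space[OF s] by (intro sum.cong) (auto simp: Int_absorb2)
    finally show "(\<integral>x. I \<C> x \<partial>M) = partition_entropy M \<C>"
      by (simp add: partition_entropy_def sum_negf)
  qed
  have "partition_entropy M \<S> \<le> (\<integral>x. I \<A> x + I \<B> x \<partial>M)"
  proof (rule gibbs_inequality[OF \<S>, where q="\<lambda>S. if S = {} then 0 else prob (f S) * prob (g S)"])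
    have inj: "inj_on (\<lambda>S. (f S, g S)) {S\<in>\<S>. S \<noteq> {}}"
    proof (rule inj_onI)
      fix S S' assume S: "S \<in> {S \<in> \<S>. S \<noteq> {}}" "S' \<in> {S \<in> \<S>. S \<noteq> {}}" and e: "(f S, g S) = (f S', g S')"
      have "S = f S \<inter> g S" "S' = f S' \<inter> g S'" using S fg(3) by auto
      with e show "S = S'" by simp
    qed
    have "(\<Sum>S\<in>\<S>. if S = {} then 0 else prob (f S) * prob (g S)) = (\<Sum>S\<in>{S\<in>\<S>. S \<noteq> {}}. prob (f S) * prob (g S))"
      using \<S> by (intro sum.mono_neutral_cong_right) (auto simp: parts_def)
    also have "\<dots> = (\<Sum>p\<in>(\<lambda>S. (f S, g S)) ` {S\<in>\<S>. S \<noteq> {}}. prob (fst p) * prob (snd p))"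
      by (subst sum.reindex[OF inj]) (simp add: o_def)
    also have "\<dots> \<le> (\<Sum>p\<in>\<A> \<times> \<B>. prob (fst p) * prob (snd p))"
      using \<A> \<B> fg by (intro sum_mono2) (auto simp: parts_def)
    also have "\<dots> = (\<Sum>A\<in>\<A>. prob A) * (\<Sum>B\<in>\<B>. prob B)"
      by (simp add: sum_product sum.cartesian_product split_beta')
    also have "\<dots> = 1" by (simp add: parts_sum[OF \<A>] parts_sum[OF \<B>])
    finally show "(\<Sum>S\<in>\<S>. if S = {} then 0 else prob (f S) * prob (g S)) \<le> 1" .
    show "integrable M (\<lambda>x. I \<A> x + I \<B> x)" using I_int(1)[OF \<A>] I_int(1)[OF \<B>] by (rule Bochner_Integration.integrable_add)
    fix S x assume S: "S \<in> \<S>" "0 < prob S" "x \<in> S"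
    have x: "x \<in> f S" "x \<in> g S" using fg(3)[OF S(1)] S(3) by auto
    have "prob S \<le> prob (f S)" "prob S \<le> prob (g S)"
      using fg[OF S(1)] \<A> \<B> by (auto intro!: finite_measure_mono simp: parts_def)
    then have p: "0 < prob (f S)" "0 < prob (g S)" using S(2) by auto
    then show "0 < (if S = {} then 0 else prob (f S) * prob (g S)) \<and>
        - ln (if S = {} then 0 else prob (f S) * prob (g S)) \<le> I \<A> x + I \<B> x"
      using S(3) I_eq[OF \<A> fg(1)[OF S(1)] x(1)] I_eq[OF \<B> fg(2)[OF S(1)] x(2)] by (auto simp: ln_mult)
  qed auto
  also have "\<dots> = partition_entropy M \<A> + partition_entropy M \<B>"
    using I_int[OF \<A>] I_int[OF \<B>] by simp
  finally show ?thesis .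
qed

end

section \<open>Iterated joins along a fibre\<close>

lemma fiber_join_finite: "finite \<xi> \<Longrightarrow> finite (fiber_join T \<xi> \<omega> n)"
  and card_fiber_join_le: "finite \<xi> \<Longrightarrow> card (fiber_join T \<xi> \<omega> n) \<le> card \<xi> ^ n"
proof -
  assume fin: "finite \<xi>"
  have sub: "fiber_join T \<xi> \<omega> n \<subseteq> (\<lambda>A. \<Inter>k<n. fiber_iter T \<omega> k -` A k) ` (PiE {..<n} (\<lambda>_. \<xi>))"
  proof
    fix S assume "S \<in> fiber_join T \<xi> \<omega> n"
    then obtain A where A: "S = (\<Inter>k<n. fiber_iter T \<omega> k -` A k)" "\<forall>k<n. A k \<in> \<xi>"
      by (auto simp: fiber_join_def)
    then show "S \<in> (\<lambda>A. \<Inter>k<n. fiber_iter T \<omega> k -` A k) ` (PiE {..<n} (\<lambda>_. \<xi>))"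
      by (intro image_eqI[of _ _ "restrict A {..<n}"]) auto
  qed
  have f: "finite (PiE {..<n} (\<lambda>_. \<xi>))" using fin by (intro finite_PiE) auto
  show "finite (fiber_join T \<xi> \<omega> n)" by (rule finite_subset[OF sub finite_imageI[OF f]])
  show "card (fiber_join T \<xi> \<omega> n) \<le> card \<xi> ^ n"
    using card_mono[OF finite_imageI[OF f] sub] card_image_le[OF f, of "\<lambda>A. \<Inter>k<n. fiber_iter T \<omega> k -` A k"]
    by (simp add: card_PiE)
qed

lemma fiber_join_cong:
  assumes "\<And>i. i < n \<Longrightarrow> \<omega> (int i) = \<omega>' (int i)"
  shows "fiber_join T \<xi> \<omega> n = fiber_join T \<xi> \<omega>' n"
proof -
  have "fiber_iter T \<omega> k = fiber_iter T \<omega>' k" if "k < n" for k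
    by (rule fiber_iter_cong) (use assms that in auto)
  then have "(\<Inter>k<n. fiber_iter T \<omega> k -` A k) = (\<Inter>k<n. fiber_iter T \<omega>' k -` A k)" for A
    by (intro INF_cong) auto
  then show ?thesis by (simp add: fiber_join_def)
qed

lemma fiber_join_add:
  assumes "S \<in> fiber_join T \<xi> \<omega> (n + k)"
  shows "\<exists>A\<in>fiber_join T \<xi> \<omega> n. \<exists>B\<in>fiber_join T \<xi> (shift_pow (int n) \<omega>) k. S = A \<inter> fiber_iter T \<omega> n -` B"
proof -
  obtain A where A: "S = (\<Inter>j<n + k. fiber_iter T \<omega> j -` A j)" "\<forall>j<n + k. A j \<in> \<xi>"
    using assms by (auto simp: fiber_join_def)
  define B where "B = (\<Inter>j<k. fiber_iter T (shift_pow (int n) \<omega>) j -` A (n + j))"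
  have "{..<n + k} = {..<n} \<union> (\<lambda>j. n + j) ` {..<k}"
  proof (intro equalityI subsetI)
    fix j assume "j \<in> {..<n + k}"
    then show "j \<in> {..<n} \<union> (\<lambda>j. n + j) ` {..<k}"
      by (cases "j < n") (auto intro!: image_eqI[of _ _ "j - n"])
  qed auto
  then have "S = (\<Inter>j<n. fiber_iter T \<omega> j -` A j) \<inter> fiber_iter T \<omega> n -` B"
    unfolding A(1) B_def by (auto simp: fiber_iter_add[symmetric])
  moreover have "(\<Inter>j<n. fiber_iter T \<omega> j -` A j) \<in> fiber_join T \<xi> \<omega> n"
    using A(2) by (auto simp: fiber_join_def intro!: exI[of _ A])
  moreover have "B \<in> fiber_join T \<xi> (shift_pow (int n) \<omega>) k"
    unfolding B_def fiber_join_def using A(2) by (auto intro!: exI[of _ "\<lambda>j. A (n + j)"])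
  ultimately show ?thesis by blast
qed

text \<open>A join depends only on the first \<open>n\<close> symbols, and there are countably many
  words. Identities between measures that hold almost everywhere for each set thus hold for all
  cells of all joins outside a single null set.\<close>

lemma countable_fiber_joins:
  assumes "finite \<xi>"
  shows "countable (\<Union>\<omega>. fiber_join T \<xi> \<omega> n)"
proof (rule countable_subset)
  \<comment> \<open>Any list is read as a sequence. What it yields at negative positions or beyond
    its end does not enter the join.\<close>
  let ?e = "\<lambda>w i. w ! nat i :: nat"
  show "(\<Union>\<omega>. fiber_join T \<xi> \<omega> n) \<subseteq> (\<Union>w. fiber_join T \<xi> (?e w) n)"
  proof (rule UN_least)
    fix \<omega> :: "int \<Rightarrow> nat"
    have "fiber_join T \<xi> \<omega> n = fiber_join T \<xi> (?e (map (\<lambda>i. \<omega> (int i)) [0..<n])) n"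
      by (rule fiber_join_cong) simp
    then show "fiber_join T \<xi> \<omega> n \<subseteq> (\<Union>w. fiber_join T \<xi> (?e w) n)" by blast
  qed
  show "countable (\<Union>w. fiber_join T \<xi> (?e w) n)"
    by (rule countable_UN[OF countableI_type]) (intro countable_finite fiber_join_finite assms)
qed

context expanding_ifs
begin

lemma parts_fiber_join:
  assumes \<omega>: "\<omega> \<in> \<Sigma>" and \<xi>: "finite_partition \<xi>" and \<nu>: "sets \<nu> = sets (borel :: 'a measure)"
  shows "parts \<nu> (fiber_join T \<xi> \<omega> n)"
  unfolding parts_def
proof (intro conjI)
  have sp: "space \<nu> = UNIV" using sets_eq_imp_space_eq[OF \<nu>] by simp
  have \<xi>': "finite \<xi>" "\<xi> \<subseteq> sets borel" "\<Union>\<xi> = UNIV" "disjoint \<xi>"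
    using \<xi> by (auto simp: finite_partition_def partition_on_def)
  show "finite (fiber_join T \<xi> \<omega> n)" by (rule fiber_join_finite[OF \<xi>'(1)])
  have fm: "fiber_iter T \<omega> k \<in> measurable borel borel" for k
    by (rule borel_measurable_continuous_onI[OF cont_iter[OF \<omega>]])
  have "(\<Inter>k<n. fiber_iter T \<omega> k -` A k) \<in> sets borel" if "\<forall>k<n. A k \<in> \<xi>" for A
  proof (cases "n = 0")
    case False
    then show ?thesis
      using that \<xi>'(2) measurable_sets[OF fm] by (intro sets.finite_INT) auto
  qed simp
  then show "fiber_join T \<xi> \<omega> n \<subseteq> sets \<nu>" unfolding \<nu> fiber_join_def by blast
  show "disjoint (fiber_join T \<xi> \<omega> n)"
  proof (rule disjointI, rule ccontr)
    fix S S' assume S: "S \<in> fiber_join T \<xi> \<omega> n" "S' \<in> fiber_join T \<xi> \<omega> n" "S \<noteq> S'" and ne: "S \<inter> S' \<noteq> {}"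
    obtain A B where A: "S = (\<Inter>k<n. fiber_iter T \<omega> k -` A k)" "\<forall>k<n. A k \<in> \<xi>"
      and B: "S' = (\<Inter>k<n. fiber_iter T \<omega> k -` B k)" "\<forall>k<n. B k \<in> \<xi>"
      using S(1,2) by (auto simp: fiber_join_def)
    obtain x where x: "x \<in> S" "x \<in> S'" using ne by auto
    have "A k = B k" if "k < n" for k
    proof -
      have "fiber_iter T \<omega> k x \<in> A k \<inter> B k" using x that unfolding A(1) B(1) by auto
      then show ?thesis using A(2) B(2) that \<xi>'(4) unfolding disjoint_def by blast
    qed
    then have "S = S'" unfolding A(1) B(1) by (intro INF_cong) auto
    with S(3) show False by simp
  qed
  show "\<Union>(fiber_join T \<xi> \<omega> n) = space \<nu>"
  proof -
    have "\<exists>S\<in>fiber_join T \<xi> \<omega> n. x \<in> S" for x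
    proof -
      have "\<forall>k. \<exists>A\<in>\<xi>. fiber_iter T \<omega> k x \<in> A" using \<xi>'(3) by blast
      then obtain A where "\<And>k. A k \<in> \<xi>" "\<And>k. fiber_iter T \<omega> k x \<in> A k"
        using bchoice[of UNIV "\<lambda>k A. A \<in> \<xi> \<and> fiber_iter T \<omega> k x \<in> A"] by blast
      then show ?thesis by (intro bexI[of _ "\<Inter>k<n. fiber_iter T \<omega> k -` A k"]) (auto simp: fiber_join_def)
    qed
    then show ?thesis unfolding sp by blast
  qed
qed

text \<open>The nonempty atoms of the algebra generated by finitely many balls of radius
  \<open>\<delta> / 2\<close>. Since the balls cover the space, every atom lies inside one of
  them.\<close>

lemma small_partition_exists:
  obtains \<xi> :: "'a set set" where "finite_partition \<xi>" "\<And>A x y. A \<in> \<xi> \<Longrightarrow> x \<in> A \<Longrightarrow> y \<in> A \<Longrightarrow> dist x y \<le> \<delta>"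
proof -
  obtain F :: "'a set" where F: "finite F" "(\<Union>x\<in>F. ball x (\<delta> / 2)) = UNIV"
    using finite_ball_cover[OF comp, of "\<delta> / 2"] \<delta> by auto
  define C where "C S = {x. \<forall>b\<in>F. x \<in> ball b (\<delta> / 2) \<longleftrightarrow> b \<in> S}" for S
  define \<xi> where "\<xi> = C ` Pow F - {{}}"
  show thesis
  proof (rule that[of \<xi>])
    have "C S \<in> sets borel" for S
    proof -
      have "C S = (\<Inter>b\<in>F. if b \<in> S then ball b (\<delta> / 2) else - ball b (\<delta> / 2))"
      proof -
        have "x \<in> (if b \<in> S then B else - B) \<longleftrightarrow> (x \<in> B \<longleftrightarrow> b \<in> S)" for x b and B :: "'a set" by simp
        then show ?thesis by (intro set_eqI) (simp only: C_def mem_Collect_eq INT_iff)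
      qed
      also have "\<dots> \<in> sets borel"
      proof (cases "F = {}")
        case False
        then show ?thesis using F(1) by (intro sets.finite_INT) auto
      qed simp
      finally show ?thesis .
    qed
    moreover have "partition_on UNIV \<xi>"
    proof (rule partition_onI)
      show "\<Union>\<xi> = UNIV"
      proof -
        have "\<exists>A\<in>\<xi>. x \<in> A" for x
        proof
          show x: "x \<in> C {b\<in>F. x \<in> ball b (\<delta> / 2)}" by (simp add: C_def)
          then show "C {b\<in>F. x \<in> ball b (\<delta> / 2)} \<in> \<xi>" by (auto simp: \<xi>_def)
        qed
        then show ?thesis by blast
      qed
      fix p q assume "p \<in> \<xi>" "q \<in> \<xi>" "p \<noteq> q"
      then obtain S S' where S: "p = C S" "q = C S'" "S \<subseteq> F" "S' \<subseteq> F" "S \<noteq> S'" by (auto simp: \<xi>_def)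
      obtain b where b: "b \<in> F" "(b \<in> S) \<noteq> (b \<in> S')" using S(3-5) by blast
      have "x \<notin> q" if "x \<in> p" for x using that b unfolding S(1,2) C_def by blast
      then show "disjnt p q" unfolding disjnt_def by blast
    qed (auto simp: \<xi>_def)
    ultimately show "finite_partition \<xi>"
      using F(1) by (auto simp: finite_partition_def \<xi>_def)
    fix A x y assume A: "A \<in> \<xi>" "x \<in> A" "y \<in> A"
    obtain b where b: "b \<in> F" "x \<in> ball b (\<delta> / 2)" using F(2) by blast
    then have "y \<in> ball b (\<delta> / 2)" using A by (auto simp: \<xi>_def C_def)
    with b show "dist x y \<le> \<delta>"
      using dist_triangle[of x y b] by (simp add: dist_commute)
  qed
qed

end

section \<open>Fibre entropy of invariant measures\<close>

context shift_expanding_ifs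
begin

lemma kernel_facts:
  assumes \<kappa>: "\<kappa> \<in> measurable P (prob_algebra (borel :: 'a measure))" and \<omega>: "\<omega> \<in> \<Sigma>"
  shows "prob_space (\<kappa> \<omega>)" "sets (\<kappa> \<omega>) = sets borel" "space (\<kappa> \<omega>) = UNIV"
proof -
  show "prob_space (\<kappa> \<omega>)" and s: "sets (\<kappa> \<omega>) = sets borel"
    using measurable_space[OF \<kappa>, of \<omega>] \<omega> by (auto simp: space_prob_algebra space_P)
  show "space (\<kappa> \<omega>) = UNIV" using sets_eq_imp_space_eq[OF s] by simp
qed

lemma kernel_measure_measurable:
  assumes \<kappa>: "\<kappa> \<in> measurable P (prob_algebra (borel :: 'a measure))" and A: "A \<in> sets borel"
  shows "(\<lambda>\<omega>. measure (\<kappa> \<omega>) A) \<in> borel_measurable P" "(\<lambda>\<omega>. emeasure (\<kappa> \<omega>) A) \<in> borel_measurable P"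
  using measurable_compose[OF measurable_prob_algebraD[OF \<kappa>] measurable_measure_subprob_algebra[OF A]]
    measurable_compose[OF measurable_prob_algebraD[OF \<kappa>] measurable_emeasure_subprob_algebra[OF A]] by auto

text \<open>One form for two uses: with \<open>g\<close> a power of the shift it compares a
  disintegration with its image, with \<open>g\<close> the identity it compares two disintegrations
  of one measure.\<close>

lemma kernel_integral_eq_AE:
  assumes \<kappa>: "\<kappa> \<in> measurable P (prob_algebra (borel :: 'a measure))"
    and \<kappa>': "\<kappa>' \<in> measurable P (prob_algebra (borel :: 'a measure))"
    and g: "g \<in> measurable P P"
    and A: "A \<in> sets borel"
    and B: "(\<lambda>\<omega>. emeasure (\<kappa>' \<omega>) (B \<omega>)) \<in> borel_measurable P"
    and eq: "\<And>E. E \<in> sets P \<Longrightarrow> (\<integral>\<^sup>+\<omega>. emeasure (\<kappa> (g \<omega>)) A * indicator E \<omega> \<partial>P) =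
      (\<integral>\<^sup>+\<omega>. emeasure (\<kappa>' \<omega>) (B \<omega>) * indicator E \<omega> \<partial>P)"
  shows "AE \<omega> in P. measure (\<kappa> (g \<omega>)) A = measure (\<kappa>' \<omega>) (B \<omega>)"
proof -
  have m: "(\<lambda>\<omega>. emeasure (\<kappa> (g \<omega>)) A) \<in> borel_measurable P"
    by (rule measurable_compose[OF g kernel_measure_measurable(2)[OF \<kappa> A]])
  have gS: "\<omega> \<in> \<Sigma> \<Longrightarrow> g \<omega> \<in> \<Sigma>" for \<omega>
    using measurable_space[OF g] by (simp add: space_P)
  have fin: "(\<integral>\<^sup>+\<omega>. f \<omega> \<partial>P) \<noteq> \<infinity>" if "\<And>\<omega>. \<omega> \<in> \<Sigma> \<Longrightarrow> f \<omega> \<le> 1" for f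
  proof -
    have "(\<integral>\<^sup>+\<omega>. f \<omega> \<partial>P) \<le> (\<integral>\<^sup>+\<omega>. 1 \<partial>P)"
      by (rule nn_integral_mono) (use that in \<open>simp add: space_P\<close>)
    then show ?thesis by (auto simp: P.emeasure_space_1 top_unique)
  qed
  have "AE \<omega> in P. emeasure (\<kappa> (g \<omega>)) A = emeasure (\<kappa>' \<omega>) (B \<omega>)"
  proof (rule AE_eq_of_nn_integral_eq[OF m B fin fin eq])
    fix \<omega> assume \<omega>: "\<omega> \<in> \<Sigma>"
    show "emeasure (\<kappa> (g \<omega>)) A \<le> 1" "emeasure (\<kappa>' \<omega>) (B \<omega>) \<le> 1"
      using kernel_facts[OF \<kappa> gS[OF \<omega>]] kernel_facts[OF \<kappa>' \<omega>]
      by (auto intro!: prob_space.emeasure_le_1)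
  qed
  then show ?thesis by eventually_elim (simp add: measure_def)
qed

lemma partition_entropy_measurable:
  assumes \<kappa>: "\<kappa> \<in> measurable P (prob_algebra (borel :: 'a measure))" and \<xi>: "finite_partition \<xi>"
  shows "(\<lambda>\<omega>. partition_entropy (\<kappa> \<omega>) (fiber_join T \<xi> \<omega> n)) \<in> borel_measurable P"
\<comment> \<open>The sequence enters twice. Only its occurrence in the join, renamed
  \<open>\<eta>\<close>, depends on finitely many symbols; the one in \<open>\<kappa>\<close> is
  covered by the kernel property.\<close>
proof (rule finite_coordinates_P[where f="\<lambda>\<eta> \<omega>. partition_entropy (\<kappa> \<omega>) (fiber_join T \<xi> \<eta> n)" and g="\<lambda>\<omega>. \<omega>" and n=n])
  fix \<eta> assume \<eta>: "\<eta> \<in> \<Sigma>"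
  have "A \<in> sets borel" if "A \<in> fiber_join T \<xi> \<eta> n" for A
    using parts_fiber_join[OF \<eta> \<xi> refl, of n] that by (auto simp: parts_def)
  then have "(\<lambda>\<omega>. measure (\<kappa> \<omega>) A) \<in> borel_measurable P" if "A \<in> fiber_join T \<xi> \<eta> n" for A
    using kernel_measure_measurable(1)[OF \<kappa>] that by blast
  then show "(\<lambda>\<omega>. partition_entropy (\<kappa> \<omega>) (fiber_join T \<xi> \<eta> n)) \<in> borel_measurable P"
    unfolding partition_entropy_def by (intro borel_measurable_uminus borel_measurable_sum borel_measurable_times borel_measurable_ln)
next
  fix \<omega> \<omega>' \<eta> :: "int \<Rightarrow> nat" assume "\<And>i. i < n \<Longrightarrow> \<omega> (int i) = \<omega>' (int i)"
  then have "fiber_join T \<xi> \<omega> n = fiber_join T \<xi> \<omega>' n" by (rule fiber_join_cong)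
  then show "partition_entropy (\<kappa> \<eta>) (fiber_join T \<xi> \<omega> n) = partition_entropy (\<kappa> \<eta>) (fiber_join T \<xi> \<omega>' n)"
    by simp
qed simp

lemma partition_entropy_bounds:
  assumes \<kappa>: "\<kappa> \<in> measurable P (prob_algebra (borel :: 'a measure))" and \<xi>: "finite_partition \<xi>" and \<omega>: "\<omega> \<in> \<Sigma>"
  shows "0 \<le> partition_entropy (\<kappa> \<omega>) (fiber_join T \<xi> \<omega> n)"
    "partition_entropy (\<kappa> \<omega>) (fiber_join T \<xi> \<omega> n) \<le> ln (real (card \<xi> ^ n))"
proof -
  interpret \<kappa>: prob_space "\<kappa> \<omega>" by (rule kernel_facts[OF \<kappa> \<omega>])
  have p: "parts (\<kappa> \<omega>) (fiber_join T \<xi> \<omega> n)"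
    by (rule parts_fiber_join[OF \<omega> \<xi> kernel_facts(2)[OF \<kappa> \<omega>]])
  show "0 \<le> partition_entropy (\<kappa> \<omega>) (fiber_join T \<xi> \<omega> n)" by (rule \<kappa>.entropy_nonneg[OF p])
  have fin: "finite \<xi>" using \<xi> by (simp add: finite_partition_def)
  have "fiber_join T \<xi> \<omega> n \<noteq> {}" using p \<kappa>.not_empty by (auto simp: parts_def)
  then have c0: "0 < card (fiber_join T \<xi> \<omega> n)" using fiber_join_finite[OF fin] by (simp add: card_gt_0_iff)
  have "ln (real (card (fiber_join T \<xi> \<omega> n))) \<le> ln (real (card \<xi> ^ n))"
    using c0 card_fiber_join_le[OF fin, of T \<omega> n] less_le_trans[OF c0 card_fiber_join_le[OF fin]]
    by (subst ln_le_cancel_iff) (simp_all only: of_nat_0_less_iff of_nat_le_iff)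
  with \<kappa>.entropy_le_ln_card[OF p] show "partition_entropy (\<kappa> \<omega>) (fiber_join T \<xi> \<omega> n) \<le> ln (real (card \<xi> ^ n))"
    by simp
qed

lemma partition_entropy_integrable:
  assumes \<kappa>: "\<kappa> \<in> measurable P (prob_algebra (borel :: 'a measure))" and \<xi>: "finite_partition \<xi>"
  shows "integrable P (\<lambda>\<omega>. partition_entropy (\<kappa> \<omega>) (fiber_join T \<xi> \<omega> n))"
  by (rule P.integrable_const_bound[where B="ln (real (card \<xi> ^ n))"])
    (use partition_entropy_bounds[OF \<kappa> \<xi>, of _ n] partition_entropy_measurable[OF \<kappa> \<xi>, of n] in \<open>auto simp: space_P\<close>)

text \<open>Invariance of \<open>m\<close>, applied to rectangles and disintegrated on both
  sides.\<close>

lemma disintegration_equivariant: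
  assumes m: "inv_meas m" and d: "is_disintegration P m \<kappa>" and B: "B \<in> sets borel"
  shows "AE \<omega> in P. measure (\<kappa> (shift_pow (int n) \<omega>)) B = measure (\<kappa> \<omega>) (fiber_iter T \<omega> n -` B)"
proof -
  have \<kappa>: "\<kappa> \<in> measurable P (prob_algebra borel)"
    and em: "\<And>A. A \<in> sets m \<Longrightarrow> emeasure m A = (\<integral>\<^sup>+\<omega>. emeasure (\<kappa> \<omega>) {x. (\<omega>, x) \<in> A} \<partial>P)"
    using d by (auto simp: is_disintegration_def)
  have sm: "sets m = sets (P \<Otimes>\<^sub>M borel)" using m by (simp add: inv_meas_def)
  have spm: "space m = \<Sigma> \<times> UNIV"
    using sets_eq_imp_space_eq[OF sm] by (simp add: space_pair_measure space_P)
  have sk: "skew_iter n \<in> measurable m m"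
    using skew_iter_measurable[of n] sm by (simp cong: measurable_cong_sets)
  have fB: "(\<lambda>p. fiber_iter T (fst p) n (snd p)) -` B \<inter> space (P \<Otimes>\<^sub>M borel) \<in> sets (P \<Otimes>\<^sub>M borel)"
    by (rule measurable_sets[OF fiber_iter_measurable B])
  have eqB: "{x. (\<omega>, x) \<in> (\<lambda>p. fiber_iter T (fst p) n (snd p)) -` B \<inter> space (P \<Otimes>\<^sub>M (borel :: 'a measure))} = fiber_iter T \<omega> n -` B"
    if "\<omega> \<in> \<Sigma>" for \<omega>
    using that by (auto simp: space_pair_measure space_P)
  have Bm: "(\<lambda>\<omega>. emeasure (\<kappa> \<omega>) (fiber_iter T \<omega> n -` B)) \<in> borel_measurable P"
    using kernel_section_measurable[OF \<kappa> fB] eqB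
    by (subst measurable_cong[of P _ "\<lambda>\<omega>. emeasure (\<kappa> \<omega>) {x. (\<omega>, x) \<in> (\<lambda>p. fiber_iter T (fst p) n (snd p)) -` B \<inter> space (P \<Otimes>\<^sub>M (borel :: 'a measure))}"])
      (simp_all add: space_P)
  show ?thesis
  proof (rule kernel_integral_eq_AE[OF \<kappa> \<kappa> shift_pow_measurable B Bm])
    fix E assume E: "E \<in> sets P"
    \<comment> \<open>Because the base shift is invertible, \<open>E\<close> can be carried forward:
      \<open>\<omega> \<in> E\<close> exactly when
      \<open>shift_pow (int n) \<omega> \<in> E'\<close>. The rectangle over \<open>E'\<close> then
      pulls back to the part over \<open>E\<close>.\<close>
    define E' where "E' = shift_pow (- int n) -` E \<inter> space P"
    have E': "E' \<in> sets P" unfolding E'_def by (rule measurable_sets[OF shift_pow_measurable E])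
    have ind: "indicator E \<omega> = (indicator E' (shift_pow (int n) \<omega>) :: ennreal)" if "\<omega> \<in> space P" for \<omega>
      using that by (auto simp: E'_def indicator_def space_P)
    have R: "E' \<times> B \<in> sets m" using E' B sm by simp
    have "(\<integral>\<^sup>+\<omega>. emeasure (\<kappa> (shift_pow (int n) \<omega>)) B * indicator E \<omega> \<partial>P) =
        (\<integral>\<^sup>+\<omega>. emeasure (\<kappa> (shift_pow (int n) \<omega>)) B * indicator E' (shift_pow (int n) \<omega>) \<partial>P)"
      by (rule nn_integral_cong) (simp add: ind)
    also have "\<dots> = (\<integral>\<^sup>+\<omega>. emeasure (\<kappa> \<omega>) B * indicator E' \<omega> \<partial>P)"
      using kernel_measure_measurable(2)[OF \<kappa> B] E'
      by (intro nn_integral_shift_pow borel_measurable_times_ennreal borel_measurable_indicator)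
    also have "\<dots> = (\<integral>\<^sup>+\<omega>. emeasure (\<kappa> \<omega>) {x. (\<omega>, x) \<in> E' \<times> B} \<partial>P)"
      by (rule nn_integral_cong) (auto simp: indicator_def)
    also have "\<dots> = emeasure m (E' \<times> B)" by (rule em[OF R, symmetric])
    also have "\<dots> = emeasure m (skew_iter n -` (E' \<times> B) \<inter> space m)"
      using emeasure_distr[OF sk R] by (simp add: distr_skew_iter[OF m])
    also have "\<dots> = (\<integral>\<^sup>+\<omega>. emeasure (\<kappa> \<omega>) {x. (\<omega>, x) \<in> skew_iter n -` (E' \<times> B) \<inter> space m} \<partial>P)"
      by (rule em[OF measurable_sets[OF sk R]])
    also have "\<dots> = (\<integral>\<^sup>+\<omega>. emeasure (\<kappa> \<omega>) (fiber_iter T \<omega> n -` B) * indicator E \<omega> \<partial>P)"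
    proof (rule nn_integral_cong)
      fix \<omega> assume \<omega>: "\<omega> \<in> space P"
      have "{x. (\<omega>, x) \<in> skew_iter n -` (E' \<times> B) \<inter> space m} = (if \<omega> \<in> E then fiber_iter T \<omega> n -` B else {})"
        using ind[OF \<omega>] \<omega> by (auto simp: spm skew_iter_def space_P indicator_def split: if_splits)
      then show "emeasure (\<kappa> \<omega>) {x. (\<omega>, x) \<in> skew_iter n -` (E' \<times> B) \<inter> space m} =
          emeasure (\<kappa> \<omega>) (fiber_iter T \<omega> n -` B) * indicator E \<omega>"
        by (simp add: indicator_def)
    qed
    finally show "(\<integral>\<^sup>+\<omega>. emeasure (\<kappa> (shift_pow (int n) \<omega>)) B * indicator E \<omega> \<partial>P) =
        (\<integral>\<^sup>+\<omega>. emeasure (\<kappa> \<omega>) (fiber_iter T \<omega> n -` B) * indicator E \<omega> \<partial>P)" .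
  qed
qed

lemma disintegration_unique:
  assumes sm: "sets m = sets (P \<Otimes>\<^sub>M borel)" and d: "is_disintegration P m \<kappa>" "is_disintegration P m \<kappa>'"
    and B: "B \<in> sets (borel :: 'a measure)"
  shows "AE \<omega> in P. measure (\<kappa> \<omega>) B = measure (\<kappa>' \<omega>) B"
proof -
  have \<kappa>: "\<kappa> \<in> measurable P (prob_algebra borel)" "\<kappa>' \<in> measurable P (prob_algebra borel)"
    using d by (auto simp: is_disintegration_def)
  have e: "(\<integral>\<^sup>+\<omega>. emeasure (k \<omega>) B * indicator E \<omega> \<partial>P) = emeasure m (E \<times> B)"
    if "is_disintegration P m k" "E \<in> sets P" for k E
  proof -
    have "emeasure m (E \<times> B) = (\<integral>\<^sup>+\<omega>. emeasure (k \<omega>) {x. (\<omega>, x) \<in> E \<times> B} \<partial>P)"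
      using that B sm unfolding is_disintegration_def by simp
    also have "\<dots> = (\<integral>\<^sup>+\<omega>. emeasure (k \<omega>) B * indicator E \<omega> \<partial>P)"
      by (rule nn_integral_cong) (auto simp: indicator_def)
    finally show ?thesis by simp
  qed
  show ?thesis
    by (rule kernel_integral_eq_AE[OF \<kappa> _ B kernel_measure_measurable(2)[OF \<kappa>(2) B], where g="\<lambda>\<omega>. \<omega>"])
      (simp_all add: e d)
qed

definition mean_entropy :: "((int \<Rightarrow> nat) \<times> 'a) measure \<Rightarrow> 'a set set \<Rightarrow> nat \<Rightarrow> real" where
  "mean_entropy m \<xi> n = (\<integral>\<omega>. partition_entropy (disintegration P m \<omega>) (fiber_join T \<xi> \<omega> n) \<partial>P)"

text \<open>The join over \<open>n + k\<close> steps refines into the join over \<open>n\<close>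
  steps and the pullback of the join over \<open>k\<close> steps at the shifted sequence.
  Equivariance identifies the entropy of the pullback with that on the fibre over the shifted
  sequence, and invariance of \<open>P\<close> removes the shift after integration.\<close>

lemma entropy_subadditive:
  assumes m: "inv_meas m" and \<xi>: "finite_partition \<xi>"
  shows "mean_entropy m \<xi> (n + k) \<le> mean_entropy m \<xi> n + mean_entropy m \<xi> k"
proof -
  define \<kappa> where "\<kappa> = disintegration P m"
  have d: "is_disintegration P m \<kappa>" unfolding \<kappa>_def by (rule disintegration_inv_meas[OF m])
  then have \<kappa>: "\<kappa> \<in> measurable P (prob_algebra borel)" by (simp add: is_disintegration_def)
  let ?H = "\<lambda>\<omega> n. partition_entropy (\<kappa> \<omega>) (fiber_join T \<xi> \<omega> n)"
  have fin: "finite \<xi>" using \<xi> by (simp add: finite_partition_def)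
  have Cb: "B \<in> sets borel" if "B \<in> fiber_join T \<xi> \<omega> k" "\<omega> \<in> \<Sigma>" for \<omega> B
    using parts_fiber_join[OF that(2) \<xi> refl, of k] that(1) by (auto simp: parts_def)
  define \<C> where "\<C> = (\<Union>\<omega>. fiber_join T \<xi> \<omega> k) \<inter> sets borel"
  have "countable \<C>" unfolding \<C>_def using countable_fiber_joins[OF fin] by (rule countable_Int1)
  then have "AE \<omega> in P. \<forall>B\<in>\<C>. measure (\<kappa> (shift_pow (int n) \<omega>)) B = measure (\<kappa> \<omega>) (fiber_iter T \<omega> n -` B)"
    using disintegration_equivariant[OF m d] by (subst AE_ball_countable) (auto simp: \<C>_def)
  then have "AE \<omega> in P. ?H \<omega> (n + k) \<le> ?H \<omega> n + ?H (shift_pow (int n) \<omega>) k"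
  proof (rule AE_mp, intro AE_I2 impI)
    fix \<omega> assume "\<omega> \<in> space P" and eqv: "\<forall>B\<in>\<C>. measure (\<kappa> (shift_pow (int n) \<omega>)) B = measure (\<kappa> \<omega>) (fiber_iter T \<omega> n -` B)"
    then have \<omega>: "\<omega> \<in> \<Sigma>" by (simp add: space_P)
    let ?\<sigma> = "shift_pow (int n) \<omega>" and ?f = "fiber_iter T \<omega> n"
    have \<omega>': "?\<sigma> \<in> \<Sigma>" using \<omega> by simp
    note kf = kernel_facts[OF \<kappa> \<omega>]
    interpret \<kappa>: prob_space "\<kappa> \<omega>" by (rule kf(1))
    let ?J = "fiber_join T \<xi> ?\<sigma> k"
    have pJ: "parts borel ?J" by (rule parts_fiber_join[OF \<omega>' \<xi> refl])
    have fm: "?f \<in> measurable borel borel" by (rule borel_measurable_continuous_onI[OF cont_iter[OF \<omega>]])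
    \<comment> \<open>Surjectivity of the fibre maps makes taking preimages injective on sets, so
      the sum over pulled-back cells can be reindexed by the original ones.\<close>
    have vs: "?f -` A = ?f -` B \<Longrightarrow> A = B" for A B
      using surj_image_vimage_eq[OF surj_iter[OF \<omega>, of n]] by metis
    have inj: "inj_on (vimage ?f) ?J" by (rule inj_onI) (rule vs)
    have pB: "parts (\<kappa> \<omega>) (vimage ?f ` ?J)"
      unfolding parts_def
    proof (intro conjI)
      show "finite (vimage ?f ` ?J)" using pJ by (simp add: parts_def)
      show "vimage ?f ` ?J \<subseteq> sets (\<kappa> \<omega>)"
        using pJ measurable_sets[OF fm] by (auto simp: parts_def kf(2))
      show "disjoint (vimage ?f ` ?J)"
        using parts_unique[OF pJ] by (auto simp: disjoint_def)
      show "\<Union>(vimage ?f ` ?J) = space (\<kappa> \<omega>)"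
        using pJ by (auto simp: parts_def kf(3) set_eq_iff)
    qed
    have "?H \<omega> (n + k) \<le> ?H \<omega> n + partition_entropy (\<kappa> \<omega>) (vimage ?f ` ?J)"
    proof (rule \<kappa>.entropy_join_le[OF parts_fiber_join[OF \<omega> \<xi> kf(2)] pB parts_fiber_join[OF \<omega> \<xi> kf(2)]])
      fix S assume "S \<in> fiber_join T \<xi> \<omega> (n + k)"
      from fiber_join_add[OF this] show "\<exists>A\<in>fiber_join T \<xi> \<omega> n. \<exists>B\<in>vimage ?f ` ?J. S = A \<inter> B" by blast
    qed
    also have "partition_entropy (\<kappa> \<omega>) (vimage ?f ` ?J) = ?H ?\<sigma> k"
    proof -
      have "measure (\<kappa> \<omega>) (?f -` B) = measure (\<kappa> ?\<sigma>) B" if "B \<in> ?J" for B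
      proof -
        have "B \<in> \<C>" unfolding \<C>_def using that Cb[OF that \<omega>'] by blast
        then show ?thesis using eqv by simp
      qed
      then show ?thesis
        unfolding partition_entropy_def by (subst sum.reindex[OF inj]) simp
    qed
    finally show "?H \<omega> (n + k) \<le> ?H \<omega> n + ?H ?\<sigma> k" .
  qed
  moreover have Hm: "(\<lambda>\<omega>. ?H \<omega> k) \<in> borel_measurable P" by (rule partition_entropy_measurable[OF \<kappa> \<xi>])
  have int: "integrable P (\<lambda>\<omega>. ?H (shift_pow (int n) \<omega>) k)"
    by (rule P.integrable_const_bound[where B="ln (real (card \<xi> ^ k))"])
      (use partition_entropy_bounds[OF \<kappa> \<xi>, of "shift_pow (int n) _" k] measurable_compose[OF shift_pow_measurable Hm] in \<open>auto simp: space_P\<close>)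
  ultimately have "(\<integral>\<omega>. ?H \<omega> (n + k) \<partial>P) \<le> (\<integral>\<omega>. ?H \<omega> n + ?H (shift_pow (int n) \<omega>) k \<partial>P)"
    by (intro integral_mono_AE Bochner_Integration.integrable_add partition_entropy_integrable[OF \<kappa> \<xi>])
  also have "\<dots> = (\<integral>\<omega>. ?H \<omega> n \<partial>P) + (\<integral>\<omega>. ?H (shift_pow (int n) \<omega>) k \<partial>P)"
    by (rule Bochner_Integration.integral_add[OF partition_entropy_integrable[OF \<kappa> \<xi>] int])
  also have "(\<integral>\<omega>. ?H (shift_pow (int n) \<omega>) k \<partial>P) = (\<integral>\<omega>. ?H \<omega> k \<partial>P)"
    by (rule integral_shift_pow[OF Hm])
  finally show ?thesis unfolding mean_entropy_def \<kappa>_def .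
qed

lemma rel_entropy_partition_tendsto:
  assumes m: "inv_meas m" and \<xi>: "finite_partition \<xi>"
  shows "(\<lambda>n. 1 / real n * mean_entropy m \<xi> n) \<longlonglongrightarrow> rel_entropy_partition P T m \<xi>"
proof -
  have \<kappa>: "disintegration P m \<in> measurable P (prob_algebra borel)"
    using disintegration_inv_meas[OF m] by (simp add: is_disintegration_def)
  have "0 \<le> mean_entropy m \<xi> n" for n
    unfolding mean_entropy_def using partition_entropy_bounds(1)[OF \<kappa> \<xi>] by (intro Bochner_Integration.integral_nonneg) (auto simp: space_P)
  then have "convergent (\<lambda>n. 1 / real n * mean_entropy m \<xi> n)"
    by (rule fekete) (rule entropy_subadditive[OF m \<xi>])
  then show ?thesis
    unfolding rel_entropy_partition_def mean_entropy_def by (simp add: convergent_LIMSEQ_iff)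
qed

text \<open>For a partition into cells of diameter at most \<open>\<delta>\<close>, each cell of the
  \<open>n\<close>-step join stays small for \<open>n\<close> steps, so \<open>mu_small\<close>
  bounds its mass by \<open>K / Lam \<omega> n\<close>. The entropy is then at least
  \<open>ln (Lam \<omega> n) - ln K\<close>, and the constant vanishes in the limit.\<close>

lemma rel_entropy_mu_ge:
  assumes m: "inv_meas m" and d: "is_disintegration P m mu"
  shows "ereal (\<integral>\<omega>. ln (lam \<omega>) \<partial>P) \<le> rel_entropy P T m"
proof -
  obtain \<xi> :: "'a set set" where \<xi>: "finite_partition \<xi>" and small: "\<And>A x y. A \<in> \<xi> \<Longrightarrow> x \<in> A \<Longrightarrow> y \<in> A \<Longrightarrow> dist x y \<le> \<delta>"
    by (rule small_partition_exists) (rule that)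
  define \<kappa> where "\<kappa> = disintegration P m"
  have d': "is_disintegration P m \<kappa>" unfolding \<kappa>_def by (rule disintegration_inv_meas[OF m])
  then have \<kappa>: "\<kappa> \<in> measurable P (prob_algebra borel)" by (simp add: is_disintegration_def)
  have sm: "sets m = sets (P \<Otimes>\<^sub>M borel)" using m by (simp add: inv_meas_def)
  have fin: "finite \<xi>" using \<xi> by (simp add: finite_partition_def)
  let ?\<Lambda> = "\<integral>\<omega>. ln (lam \<omega>) \<partial>P"
  have ge: "real n * ?\<Lambda> - ln K \<le> mean_entropy m \<xi> n" for n
  proof -
    \<comment> \<open>The entropy is defined through the selected disintegration, which agrees with
      \<open>mu\<close> only almost everywhere; a countable family containing all cells makes the
      exceptional set uniform.\<close>
    define \<C> where "\<C> = (\<Union>\<omega>. fiber_join T \<xi> \<omega> n) \<inter> sets borel"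
    have "countable \<C>" unfolding \<C>_def using countable_fiber_joins[OF fin] by (rule countable_Int1)
    then have "AE \<omega> in P. \<forall>B\<in>\<C>. measure (\<kappa> \<omega>) B = measure (mu \<omega>) B"
      using disintegration_unique[OF sm d' d] by (subst AE_ball_countable) (auto simp: \<C>_def)
    then have AE: "AE \<omega> in P. ln (Lam \<omega> n) - ln K \<le> partition_entropy (\<kappa> \<omega>) (fiber_join T \<xi> \<omega> n)"
    proof (rule AE_mp, intro AE_I2 impI)
      fix \<omega> assume "\<omega> \<in> space P" and eq: "\<forall>B\<in>\<C>. measure (\<kappa> \<omega>) B = measure (mu \<omega>) B"
      then have \<omega>: "\<omega> \<in> \<Sigma>" by (simp add: space_P)
      note kf = kernel_facts[OF \<kappa> \<omega>]
      interpret \<kappa>: prob_space "\<kappa> \<omega>" by (rule kf(1))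
      have p: "parts (\<kappa> \<omega>) (fiber_join T \<xi> \<omega> n)" by (rule parts_fiber_join[OF \<omega> \<xi> kf(2)])
      have "- ln (K / Lam \<omega> n) \<le> partition_entropy (\<kappa> \<omega>) (fiber_join T \<xi> \<omega> n)"
      proof (rule \<kappa>.entropy_ge[OF p])
        fix A assume A: "A \<in> fiber_join T \<xi> \<omega> n"
        then have Ab: "A \<in> sets borel" using p kf(2) by (auto simp: parts_def)
        then have "measure (\<kappa> \<omega>) A = measure (mu \<omega>) A" using eq A by (auto simp: \<C>_def)
        also have "\<dots> \<le> K / Lam \<omega> n"
        proof (rule mu_small[OF \<omega> Ab])
          fix x y k assume xy: "x \<in> A" "y \<in> A" "k < n"
          obtain a where a: "A = (\<Inter>k<n. fiber_iter T \<omega> k -` a k)" "\<forall>k<n. a k \<in> \<xi>"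
            using A by (auto simp: fiber_join_def)
          show "dist (fiber_iter T \<omega> k x) (fiber_iter T \<omega> k y) \<le> \<delta>"
            by (rule small[of "a k"]) (use a xy in auto)
        qed
        finally show "measure (\<kappa> \<omega>) A \<le> K / Lam \<omega> n" .
      qed
      then show "ln (Lam \<omega> n) - ln K \<le> partition_entropy (\<kappa> \<omega>) (fiber_join T \<xi> \<omega> n)"
        using K_ge_1 Lam_pos[OF \<omega>, of n] by (simp add: ln_div)
    qed
    have "(\<integral>\<omega>. ln (Lam \<omega> n) - ln K \<partial>P) \<le> mean_entropy m \<xi> n"
      unfolding mean_entropy_def \<kappa>_def[symmetric]
      by (rule integral_mono_AE[OF _ partition_entropy_integrable[OF \<kappa> \<xi>] AE]) (simp add: ln_Lam_integrable)
    then show ?thesis using ln_Lam_integrable[of n] by (simp add: ln_Lam_integral P.prob_space)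
  qed
  have "?\<Lambda> \<le> rel_entropy_partition P T m \<xi>"
  proof (rule tendsto_le[OF _ rel_entropy_partition_tendsto[OF m \<xi>]])
    have "(\<lambda>n. ?\<Lambda> - ln K * (1 / real n)) \<longlonglongrightarrow> ?\<Lambda> - ln K * 0"
      by (intro tendsto_intros lim_1_over_n)
    then show "(\<lambda>n. ?\<Lambda> - ln K * (1 / real n)) \<longlonglongrightarrow> ?\<Lambda>" by simp
    show "eventually (\<lambda>n. ?\<Lambda> - ln K * (1 / real n) \<le> 1 / real n * mean_entropy m \<xi> n) sequentially"
      using eventually_gt_at_top[of 0]
    proof eventually_elim
      case (elim n)
      then have "1 / real n * (real n * ?\<Lambda> - ln K) \<le> 1 / real n * mean_entropy m \<xi> n"
        by (intro mult_left_mono ge) auto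
      then show ?case using elim by (simp add: algebra_simps)
    qed
  qed simp
  then show ?thesis
    unfolding rel_entropy_def using \<xi> by (intro SUP_upper2[of \<xi>]) auto
qed

end

section \<open>Upper bounds and topological entropy\<close>

context expanding_ifs
begin

lemma card_net_preim:
  assumes \<omega>: "\<omega> \<in> \<Sigma>" and F: "finite F"
  shows "real (card (\<Union>w\<in>F. preim T \<omega> n w)) \<le> real (card F) * K * Lam \<omega> n"
proof -
  have "real (card (\<Union>w\<in>F. preim T \<omega> n w)) \<le> (\<Sum>w\<in>F. cnt T \<omega> n w)"
    using card_UN_le[OF F, of "preim T \<omega> n"] unfolding cnt_def by (simp flip: of_nat_sum)
  also have "\<dots> \<le> (\<Sum>w\<in>F. K * Lam \<omega> n)" by (intro sum_mono Lam_cnt(2) \<omega>)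
  finally show ?thesis by simp
qed

text \<open>Follow the inverse branch ending at the net point nearest to the end of the orbit; going
  backward only shrinks the distance.\<close>

lemma net_shadow:
  assumes \<omega>: "\<omega> \<in> \<Sigma>" and F: "\<And>x::'a. \<exists>w\<in>F. dist x w < min r \<delta>"
  shows "\<exists>y\<in>(\<Union>w\<in>F. preim T \<omega> n w). \<forall>k\<le>n. dist (fiber_iter T \<omega> k x) (fiber_iter T \<omega> k y) < r"
proof -
  obtain w where w: "w \<in> F" "dist (fiber_iter T \<omega> n x) w < min r \<delta>" using F by blast
  then obtain y where y: "fiber_iter T \<omega> n y = w"
    "\<And>k. k \<le> n \<Longrightarrow> dist (fiber_iter T \<omega> k x) (fiber_iter T \<omega> k y) \<le> \<rho> ^ (n - k) * dist (fiber_iter T \<omega> n x) w"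
    using inverse_branch[OF \<omega>, of n x w] by auto
  have "dist (fiber_iter T \<omega> k x) (fiber_iter T \<omega> k y) < r" if "k \<le> n" for k
  proof -
    have "\<rho> ^ (n - k) * dist (fiber_iter T \<omega> n x) w \<le> 1 * dist (fiber_iter T \<omega> n x) w"
      using \<rho> by (intro mult_right_mono power_le_one) auto
    then show ?thesis using y(2)[OF that] w(2) by simp
  qed
  with y(1) w(1) show ?thesis by (auto simp: preim_def)
qed

text \<open>
  The comparison weights: choose a preimage \<open>y\<close> of the net uniformly, then guess the itinerary of a
  shadowed point from that of \<open>y\<close>, each symbol being wrong with probability about \<open>\<eta>\<close>. A guess can
  only fail when the orbit visits \<open>U\<close>.
\<close>

lemma entropy_upper_pointwise:
  assumes \<omega>: "\<omega> \<in> \<Sigma>" and \<nu>: "prob_space \<nu>" "sets \<nu> = sets borel" and \<xi>: "finite_partition \<xi>"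
    and KK: "\<And>A. A \<in> \<xi> \<Longrightarrow> KK A \<subseteq> A"
    and sep: "\<And>A B x y. A \<in> \<xi> \<Longrightarrow> B \<in> \<xi> \<Longrightarrow> A \<noteq> B \<Longrightarrow> x \<in> KK A \<Longrightarrow> y \<in> KK B \<Longrightarrow> 2 * r \<le> dist x y"
    and F: "finite F" "\<And>x::'a. \<exists>w\<in>F. dist x w < min r \<delta>"
    and \<eta>: "0 < \<eta>" "\<eta> < 1" and U: "U = - (\<Union>A\<in>\<xi>. KK A)" "U \<in> sets borel"
  shows "partition_entropy \<nu> (fiber_join T \<xi> \<omega> n) \<le>
    ln (real (card F) * K) + ln (Lam \<omega> n) + real n * (- ln (1 - \<eta>))
      + (- ln (\<eta> / real (card \<xi>))) * (\<Sum>k<n. measure \<nu> (fiber_iter T \<omega> k -` U))"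
proof -
  interpret \<nu>: prob_space \<nu> by fact
  have sp: "space \<nu> = UNIV" using sets_eq_imp_space_eq[OF \<nu>(2)] by simp
  let ?f = "fiber_iter T \<omega>"
  have \<xi>': "finite \<xi>" "\<Union>\<xi> = UNIV" "disjoint \<xi>"
    using \<xi> by (auto simp: finite_partition_def partition_on_def)
  define M where "M = real (card \<xi>)"
  have "\<xi> \<noteq> {}" using \<xi>'(2) by auto
  then have M: "1 \<le> M" unfolding M_def using \<xi>'(1) by (simp add: Suc_le_eq card_gt_0_iff)
  define cell where "cell p = (THE A. A \<in> \<xi> \<and> p \<in> A)" for p
  have cell: "cell p \<in> \<xi>" "p \<in> cell p" and cell_eq: "A \<in> \<xi> \<Longrightarrow> p \<in> A \<Longrightarrow> cell p = A" for p A
  proof -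
    obtain B where B: "B \<in> \<xi>" "p \<in> B" using \<xi>'(2) by blast
    have u: "A = B" if "A \<in> \<xi>" "p \<in> A" for A
      using \<xi>'(3) that B unfolding disjoint_def by blast
    have c: "cell p = B" unfolding cell_def by (rule the_equality) (simp add: B, elim conjE, rule u)
    then show "cell p \<in> \<xi>" "p \<in> cell p" using B by simp_all
    assume "A \<in> \<xi>" "p \<in> A"
    then have "A = B" by (rule u)
    then show "cell p = A" using c by simp
  qed
  define Y where "Y = (\<Union>w\<in>F. preim T \<omega> n w)"
  have Yfin: "finite Y" unfolding Y_def using F(1) finite_preim[OF \<omega>] by auto
  have shadow: "\<exists>y\<in>Y. \<forall>k\<le>n. dist (?f k x) (?f k y) < r" for x
    unfolding Y_def by (rule net_shadow[OF \<omega> F(2)])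
  then have "Y \<noteq> {}" by blast
  then have Y0: "1 \<le> real (card Y)" using Yfin by (simp add: Suc_le_eq card_gt_0_iff)
  \<comment> \<open>At most one cell has its core within \<open>r\<close> of \<open>p\<close>,
    because cores of different cells are \<open>2 * r\<close> apart. If there is none, the choice is
    arbitrary and may even lie outside \<open>\<xi>\<close>.\<close>
  define guess where "guess p = (SOME A. A \<in> \<xi> \<and> (\<exists>x\<in>KK A. dist x p < r))" for p
  have guess: "guess p = A" if A: "A \<in> \<xi>" "x \<in> KK A" "dist x p < r" for p A x
  proof -
    have "guess p \<in> \<xi> \<and> (\<exists>x\<in>KK (guess p). dist x p < r)"
      unfolding guess_def by (rule someI[of _ A]) (use A in blast)
    then obtain x' where x': "guess p \<in> \<xi>" "x' \<in> KK (guess p)" "dist x' p < r" by blast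
    have "dist x x' < 2 * r"
      using dist_triangle2[of x x' p] x'(3) A(3) by linarith
    then show ?thesis using sep[OF A(1) x'(1) _ A(2) x'(2)] by force
  qed
  \<comment> \<open>The error probability is spread over all \<open>M\<close> cells instead of the
    \<open>M - 1\<close> wrong ones; a total mass of at most 1 is all that Gibbs' inequality asks
    for.\<close>
  define qk where "qk A p = (if A = guess p then 1 - \<eta> else \<eta> / M)" for A p
  have qk_pos: "0 < qk A p" for A p unfolding qk_def using \<eta> M by auto
  have qk_nonneg: "0 \<le> qk A p" for A p by (rule less_imp_le[OF qk_pos])
  have qk_sum: "(\<Sum>A\<in>\<xi>. qk A p) \<le> 1" for p
  proof -
    have "(\<Sum>A\<in>\<xi>. qk A p) \<le> (\<Sum>A\<in>\<xi>. (if A = guess p then 1 - \<eta> else 0) + \<eta> / M)"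
      by (rule sum_mono) (use \<eta> M in \<open>auto simp: qk_def\<close>)
    also have "\<dots> = (\<Sum>A\<in>\<xi>. if A = guess p then 1 - \<eta> else 0) + \<eta>"
      using M by (simp add: sum.distrib M_def)
    also have "(\<Sum>A\<in>\<xi>. if A = guess p then 1 - \<eta> else 0) \<le> 1 - \<eta>"
      using \<xi>'(1) \<eta> by simp
    finally show ?thesis by simp
  qed
  have nonneg: "0 \<le> - ln (1 - \<eta>)" "0 \<le> - ln (\<eta> / M)"
    using \<eta> M by auto
  have qk_ln: "- ln (qk (cell p) p') \<le> - ln (1 - \<eta>) + (- ln (\<eta> / M)) * indicator U p" if d: "dist p p' < r" for p p'
  proof (cases "p \<in> U")
    case True
    then show ?thesis using nonneg by (auto simp: qk_def)
  next
    case False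
    then obtain A where A: "A \<in> \<xi>" "p \<in> KK A" using U(1) by auto
    have "guess p' = A" by (rule guess[OF A d])
    moreover have "cell p = A" by (rule cell_eq[OF A(1)]) (use A KK in blast)
    ultimately show ?thesis using False by (simp add: qk_def)
  qed
  \<comment> \<open>A mixture, uniform over the shadowing points, of product distributions on
    itineraries.\<close>
  define q where "q A = (\<Sum>y\<in>Y. \<Prod>k<n. qk (A k) (?f k y)) / real (card Y)" for A
  have q_sum: "(\<Sum>A\<in>PiE {..<n} (\<lambda>_. \<xi>). q A) \<le> 1"
  proof -
    have "(\<Sum>A\<in>PiE {..<n} (\<lambda>_. \<xi>). q A) = (\<Sum>y\<in>Y. \<Sum>A\<in>PiE {..<n} (\<lambda>_. \<xi>). \<Prod>k<n. qk (A k) (?f k y)) / real (card Y)"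
      unfolding q_def sum_divide_distrib[symmetric] by (subst sum.swap) simp
    also have "\<dots> = (\<Sum>y\<in>Y. \<Prod>k<n. \<Sum>A\<in>\<xi>. qk A (?f k y)) / real (card Y)"
      using \<xi>'(1) by (subst prod_sum_PiE) auto
    also have "\<dots> \<le> (\<Sum>y\<in>Y. 1) / real (card Y)"
      using qk_sum qk_nonneg by (intro divide_right_mono sum_mono prod_le_1) (auto intro!: sum_nonneg)
    finally show ?thesis using Y0 by simp
  qed
  have q_pos: "0 < q A" for A
    unfolding q_def using Y0 Yfin \<open>Y \<noteq> {}\<close> qk_pos by (intro divide_pos_pos sum_pos prod_pos) auto
  \<comment> \<open>Cells of the join are matched with itineraries through one of their points. The
    empty cell has none, so it receives weight 0 below.\<close>
  define pt where "pt S = (SOME x. x \<in> S)" for S :: "'a set"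
  define it where "it x = restrict (\<lambda>k. cell (?f k x)) {..<n}" for x
  let ?J = "fiber_join T \<xi> \<omega> n"
  have it_eq: "S = (\<Inter>k<n. ?f k -` it x k)" if S: "S \<in> ?J" "x \<in> S" for S x
  proof -
    obtain A where A: "S = (\<Inter>k<n. ?f k -` A k)" "\<forall>k<n. A k \<in> \<xi>" using S by (auto simp: fiber_join_def)
    have "it x k = A k" if "k < n" for k
      using that cell_eq[of "A k" "?f k x"] A S(2) by (auto simp: it_def)
    then show ?thesis unfolding A(1) by (intro INF_cong) auto
  qed
  have it_const: "it x = it y" if S: "S \<in> ?J" "x \<in> S" "y \<in> S" for S x y
  proof -
    have "y \<in> (\<Inter>k<n. ?f k -` it x k)" using it_eq[OF S(1,2)] S(3) by simp
    then have "cell (?f k y) = cell (?f k x)" if "k < n" for k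
      using that cell(1) by (intro cell_eq) (auto simp: it_def)
    then show ?thesis by (simp add: it_def restrict_def fun_eq_iff)
  qed
  have pt: "pt S \<in> S" if "S \<noteq> {}" for S
    unfolding pt_def using that by (auto intro: someI)
  have pJ: "parts \<nu> ?J" by (rule parts_fiber_join[OF \<omega> \<xi> \<nu>(2)])
  \<comment> \<open>The cost of a point: the choice of \<open>y\<close>, one correct guess per step,
    and one error for each visit to \<open>U\<close>. The number of visits is not constant on cells,
    which is why the cost is a function.\<close>
  define b where "b x = ln (real (card Y)) + real n * (- ln (1 - \<eta>)) + (- ln (\<eta> / M)) * (\<Sum>k<n. indicator (?f k -` U) x)" for x
  have fU: "?f k -` U \<in> sets \<nu>" for k
    using measurable_sets[OF borel_measurable_continuous_onI[OF cont_iter[OF \<omega>, of k]] U(2)] \<nu>(2) by simp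
  have iU: "integrable \<nu> (\<lambda>x. indicator (?f k -` U) x :: real)" for k
    using integrable_mult_indicator[OF fU[of k] \<nu>.integrable_const[of "1::real"]] by simp
  have "partition_entropy \<nu> ?J \<le> (\<integral>x. b x \<partial>\<nu>)"
  proof (rule \<nu>.gibbs_inequality[OF pJ, where q="\<lambda>S. if S = {} then 0 else q (it (pt S))"])
    have inj: "inj_on (\<lambda>S. it (pt S)) {S \<in> ?J. S \<noteq> {}}"
    proof (rule inj_onI)
      fix S S' assume S: "S \<in> {S \<in> ?J. S \<noteq> {}}" "S' \<in> {S \<in> ?J. S \<noteq> {}}" and e: "it (pt S) = it (pt S')"
      have "S = (\<Inter>k<n. ?f k -` it (pt S) k)" "S' = (\<Inter>k<n. ?f k -` it (pt S') k)"
        using S by (auto intro!: it_eq pt simp del: INT_iff)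
      with e show "S = S'" by simp
    qed
    have "(\<Sum>S\<in>?J. if S = {} then 0 else q (it (pt S))) = (\<Sum>S\<in>{S \<in> ?J. S \<noteq> {}}. q (it (pt S)))"
      using pJ by (intro sum.mono_neutral_cong_right) (auto simp: parts_def)
    also have "\<dots> = (\<Sum>A\<in>(\<lambda>S. it (pt S)) ` {S \<in> ?J. S \<noteq> {}}. q A)"
      by (subst sum.reindex[OF inj]) (simp add: o_def)
    also have "\<dots> \<le> (\<Sum>A\<in>PiE {..<n} (\<lambda>_. \<xi>). q A)"
    proof (rule sum_mono2)
      show "finite (PiE {..<n} (\<lambda>_. \<xi>))" using \<xi>'(1) by (intro finite_PiE) auto
      show "(\<lambda>S. it (pt S)) ` {S \<in> ?J. S \<noteq> {}} \<subseteq> PiE {..<n} (\<lambda>_. \<xi>)"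
        using cell(1) by (auto simp: it_def)
      show "0 \<le> q A" for A using q_pos[of A] by simp
    qed
    finally show "(\<Sum>S\<in>?J. if S = {} then 0 else q (it (pt S))) \<le> 1" using q_sum by simp
    show "0 \<le> (if S = {} then 0 else q (it (pt S)))" for S using q_pos[of "it (pt S)"] by simp
    show "integrable \<nu> b"
      unfolding b_def using iU by (intro Bochner_Integration.integrable_add integrable_mult_right Bochner_Integration.integrable_sum) auto
    fix S x assume S: "S \<in> ?J" "x \<in> S"
    then have "it (pt S) = it x" using it_const[OF S(1) pt S(2)] by blast
    moreover have "- ln (q (it x)) \<le> b x"
    proof -
      \<comment> \<open>Of the whole mixture only the term of a point shadowing \<open>x\<close> is
        kept; this loses no more than \<open>ln (card Y)\<close>.\<close>
      obtain y where y: "y \<in> Y" "\<And>k. k \<le> n \<Longrightarrow> dist (?f k x) (?f k y) < r" using shadow[of x] by blast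
      let ?p = "\<Prod>k<n. qk (cell (?f k x)) (?f k y)"
      have "?p \<le> (\<Sum>y\<in>Y. \<Prod>k<n. qk (it x k) (?f k y))"
      proof -
        have "?p = (\<Prod>k<n. qk (it x k) (?f k y))" by (rule prod.cong) (auto simp: it_def)
        also have "\<dots> \<le> (\<Sum>y\<in>Y. \<Prod>k<n. qk (it x k) (?f k y))"
          using qk_nonneg by (intro member_le_sum[OF y(1) _ Yfin] prod_nonneg) auto
        finally show ?thesis .
      qed
      then have "?p / real (card Y) \<le> q (it x)" unfolding q_def using Y0 by (intro divide_right_mono) auto
      moreover have p0: "0 < ?p" using qk_pos by (intro prod_pos) auto
      ultimately have "ln (?p / real (card Y)) \<le> ln (q (it x))"
        using q_pos[of "it x"] Y0 by (subst ln_le_cancel_iff) auto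
      moreover have "ln (?p / real (card Y)) = ln ?p - ln (real (card Y))"
        using p0 Y0 by (intro ln_divide_pos) auto
      moreover have "ln ?p = (\<Sum>k<n. ln (qk (cell (?f k x)) (?f k y)))"
        by (rule ln_prod) (use qk_pos in \<open>auto simp: less_le\<close>)
      ultimately have "- ln (q (it x)) \<le> ln (real (card Y)) + (\<Sum>k<n. - ln (qk (cell (?f k x)) (?f k y)))"
        by (simp add: sum_negf)
      also have "\<dots> \<le> ln (real (card Y)) + (\<Sum>k<n. - ln (1 - \<eta>) + (- ln (\<eta> / M)) * indicator U (?f k x))"
        by (intro add_left_mono sum_mono qk_ln y(2)) auto
      also have "\<dots> = b x"
        unfolding b_def by (simp only: sum.distrib sum_distrib_left[symmetric] indicator_vimage[symmetric] sum_constant card_lessThan o_def)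
      finally show ?thesis .
    qed
    ultimately show "0 < (if S = {} then 0 else q (it (pt S))) \<and> - ln (if S = {} then 0 else q (it (pt S))) \<le> b x"
      using S(2) q_pos by auto
  qed
  also have "(\<integral>x. b x \<partial>\<nu>) = ln (real (card Y)) + real n * (- ln (1 - \<eta>)) + (- ln (\<eta> / M)) * (\<Sum>k<n. measure \<nu> (?f k -` U))"
  proof -
    have "(\<integral>x. (\<Sum>k<n. indicator (?f k -` U) x) \<partial>\<nu>) = (\<Sum>k<n. measure \<nu> (?f k -` U))"
      using iU fU by (subst Bochner_Integration.integral_sum) (auto simp: sp)
    moreover have "integrable \<nu> (\<lambda>x. \<Sum>k<n. indicator (?f k -` U) x :: real)"
      using iU by (rule Bochner_Integration.integrable_sum)
    ultimately show ?thesis unfolding b_def by (simp add: \<nu>.prob_space)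
  qed
  also have "ln (real (card Y)) \<le> ln (real (card F) * K) + ln (Lam \<omega> n)"
  proof -
    have F0: "0 < real (card F)" using F by (force simp: card_gt_0_iff)
    have L: "0 < Lam \<omega> n" by (rule Lam_pos[OF \<omega>])
    have "ln (real (card Y)) \<le> ln (real (card F) * K * Lam \<omega> n)"
      using card_net_preim[OF \<omega> F(1), of n] Y0 F0 L K_ge_1 unfolding Y_def by (subst ln_le_cancel_iff) auto
    also have "\<dots> = ln (real (card F) * K) + ln (Lam \<omega> n)"
      using F0 L K_ge_1 by (intro ln_mult_pos) auto
    finally show ?thesis .
  qed
  finally show ?thesis by (simp add: M_def)
qed

section \<open>Separated sets and topological entropy\<close>

lemma separated_upper:
  assumes \<omega>: "\<omega> \<in> \<Sigma>" and F: "finite F" "\<And>x::'a. \<exists>w\<in>F. dist x w < min (\<epsilon> / 2) \<delta>"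
    and n: "0 < n" and E: "finite E" "separated T \<omega> n \<epsilon> E"
  shows "card E \<le> card (\<Union>w\<in>F. preim T \<omega> n w)"
proof -
  let ?Y = "\<Union>w\<in>F. preim T \<omega> n w"
  have "\<forall>x\<in>E. \<exists>y. y \<in> ?Y \<and> (\<forall>k\<le>n. dist (fiber_iter T \<omega> k x) (fiber_iter T \<omega> k y) < \<epsilon> / 2)"
    using net_shadow[OF \<omega> F(2), of n] by blast
  from bchoice[OF this] obtain g where g: "\<And>x. x \<in> E \<Longrightarrow> g x \<in> ?Y"
    "\<And>x k. x \<in> E \<Longrightarrow> k \<le> n \<Longrightarrow> dist (fiber_iter T \<omega> k x) (fiber_iter T \<omega> k (g x)) < \<epsilon> / 2" by blast
  have "inj_on g E"
  proof (rule inj_onI, rule ccontr)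
    fix x y assume xy: "x \<in> E" "y \<in> E" "g x = g y" "x \<noteq> y"
    have le: "dist (fiber_iter T \<omega> k x) (fiber_iter T \<omega> k y) \<le> \<epsilon>" if "k < n" for k
      using g(2)[OF xy(1), of k] g(2)[OF xy(2), of k] that xy(3)
        dist_triangle2[of "fiber_iter T \<omega> k x" "fiber_iter T \<omega> k y" "fiber_iter T \<omega> k (g x)"] by simp
    \<comment> \<open>Two points sharing a shadow are within twice \<open>\<epsilon> / 2\<close> at
      all times before \<open>n\<close>. The hypothesis \<open>0 < n\<close> keeps the maximum from
      being taken over the empty set.\<close>
    have "fiber_dist T \<omega> n x y \<le> \<epsilon>"
      unfolding fiber_dist_def using n le by (intro Max.boundedI) auto
    moreover have "fiber_dist T \<omega> n x y > \<epsilon>" using E(2) xy by (auto simp: separated_def)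
    ultimately show False by simp
  qed
  then show ?thesis
    using g(1) F(1) finite_preim[OF \<omega>] by (intro card_inj_on_le[of g]) auto
qed

lemma preim_separated:
  assumes \<omega>: "\<omega> \<in> \<Sigma>" and \<epsilon>: "\<epsilon> \<le> \<delta>"
  shows "separated T \<omega> n \<epsilon> (preim T \<omega> n z)"
  unfolding separated_def
proof (intro ballI impI)
  fix x y assume x: "x \<in> preim T \<omega> n z" and y: "y \<in> preim T \<omega> n z" and "x \<noteq> y"
  have "\<exists>k<n. \<delta> < dist (fiber_iter T \<omega> k x) (fiber_iter T \<omega> k y)"
  proof (rule ccontr)
    assume neg: "\<not> (\<exists>k<n. \<delta> < dist (fiber_iter T \<omega> k x) (fiber_iter T \<omega> k y))"
    have d: "dist (fiber_iter T \<omega> k x) (fiber_iter T \<omega> k y) \<le> \<delta>" if "k < n" for k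
      using neg that not_le by blast
    have "fiber_iter T \<omega> n x = fiber_iter T \<omega> n y" using x y by (simp add: preim_def)
    then have "x = y" using d by (rule backward_unique[OF \<omega>])
    with \<open>x \<noteq> y\<close> show False by simp
  qed
  then obtain k where k: "k < n" "\<delta> < dist (fiber_iter T \<omega> k x) (fiber_iter T \<omega> k y)" by blast
  have "dist (fiber_iter T \<omega> k x) (fiber_iter T \<omega> k y) \<le> fiber_dist T \<omega> n x y"
    unfolding fiber_dist_def using k(1) by (intro Max_ge) auto
  then show "fiber_dist T \<omega> n x y > \<epsilon>" using k \<epsilon> by linarith
qed

lemma max_separated_bounds:
  assumes \<omega>: "\<omega> \<in> \<Sigma>" and F: "finite F" "\<And>x::'a. \<exists>w\<in>F. dist x w < min (\<epsilon> / 2) \<delta>"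
    and n: "0 < n" and \<epsilon>: "\<epsilon> \<le> \<delta>"
  shows "ln (Lam \<omega> n) - ln K \<le> ln (real (max_separated T \<omega> n \<epsilon>))"
    "0 \<le> ln (real (max_separated T \<omega> n \<epsilon>))"
    "ln (real (max_separated T \<omega> n \<epsilon>)) \<le> ln (real (card F) * K) + ln (Lam \<omega> n)"
proof -
  let ?S = "{card E | E. finite E \<and> separated T \<omega> n \<epsilon> E}" and ?Y = "\<Union>w\<in>F. preim T \<omega> n w"
  let ?m = "real (max_separated T \<omega> n \<epsilon>)" and ?z = "undefined :: 'a"
  \<comment> \<open>\<open>Max\<close> is meaningful only for a finite set of cardinalities; the
    preimages of a net provide the bound.\<close>
  have sub: "?S \<subseteq> {..card ?Y}" using separated_upper[OF \<omega> F n] by auto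
  have fin: "finite ?S" by (rule finite_subset[OF sub]) simp
  have mem: "card (preim T \<omega> n ?z) \<in> ?S"
    using preim_separated[OF \<omega> \<epsilon>] finite_preim[OF \<omega>] by blast
  have ge: "cnt T \<omega> n ?z \<le> ?m"
    unfolding cnt_def max_separated_def using Max_ge[OF fin mem] by simp
  have "Max ?S \<in> ?S" by (rule Max_in[OF fin]) (use mem in auto)
  then have "max_separated T \<omega> n \<epsilon> \<le> card ?Y" using sub unfolding max_separated_def by blast
  then have le: "?m \<le> real (card F) * K * Lam \<omega> n" using card_net_preim[OF \<omega> F(1), of n] by linarith
  have m1: "1 \<le> ?m" using cnt_ge_1[OF \<omega>, of n ?z] ge by linarith
  then show "0 \<le> ln ?m" by simp
  have L: "0 < Lam \<omega> n" by (rule Lam_pos[OF \<omega>])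
  have F0: "0 < real (card F)" using F by (force simp: card_gt_0_iff)
  have "Lam \<omega> n \<le> K * cnt T \<omega> n ?z" by (rule Lam_cnt(1)[OF \<omega>])
  also have "\<dots> \<le> K * ?m" using ge K_ge_1 by (intro mult_left_mono) auto
  finally have "Lam \<omega> n / K \<le> ?m" using K_ge_1 by (simp add: divide_le_eq mult.commute)
  then have "ln (Lam \<omega> n / K) \<le> ln ?m" using L K_ge_1 m1 by (subst ln_le_cancel_iff) auto
  then show "ln (Lam \<omega> n) - ln K \<le> ln ?m" using L K_ge_1 by (simp add: ln_div)
  have "ln ?m \<le> ln (real (card F) * K * Lam \<omega> n)" using le m1 F0 K_ge_1 L by (subst ln_le_cancel_iff) auto
  also have "\<dots> = ln (real (card F) * K) + ln (Lam \<omega> n)"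
    using F0 L K_ge_1 by (intro ln_mult_pos) auto
  finally show "ln ?m \<le> ln (real (card F) * K) + ln (Lam \<omega> n)" .
qed

lemma finite_net:
  assumes "0 < e"
  obtains F :: "'a set" where "finite F" "\<And>x::'a. \<exists>w\<in>F. dist x w < e"
proof -
  obtain F :: "'a set" where F: "finite F" "(\<Union>x\<in>F. ball x e) = UNIV"
    using finite_ball_cover[OF comp assms] by blast
  have "\<exists>w\<in>F. dist x w < e" for x
  proof -
    have "x \<in> (\<Union>x\<in>F. ball x e)" using F(2) by simp
    then show ?thesis by (auto simp: dist_commute)
  qed
  with F(1) show thesis by (rule that)
qed

end

lemma max_separated_cong:
  assumes "\<And>i. i < n \<Longrightarrow> \<omega> (int i) = \<omega>' (int i)"
  shows "max_separated T \<omega> n \<epsilon> = max_separated T \<omega>' n \<epsilon>"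
proof -
  have "fiber_iter T \<omega> k = fiber_iter T \<omega>' k" if "k < n" for k
    by (rule fiber_iter_cong) (use assms that in auto)
  then have "fiber_dist T \<omega> n x y = fiber_dist T \<omega>' n x y" for x y
    unfolding fiber_dist_def by (intro arg_cong[where f=Max] image_cong) auto
  then show ?thesis by (simp add: max_separated_def separated_def)
qed

context shift_expanding_ifs
begin

lemma average_squeeze:
  fixes a :: "nat \<Rightarrow> real"
  assumes "\<And>n. 0 < n \<Longrightarrow> real n * L - c1 \<le> a n" "\<And>n. 0 < n \<Longrightarrow> a n \<le> c2 + real n * L"
  shows "(\<lambda>n. 1 / real n * a n) \<longlonglongrightarrow> L"
proof (rule tendsto_sandwich)
  have "(\<lambda>n. L - c1 * (1 / real n)) \<longlonglongrightarrow> L - c1 * 0" "(\<lambda>n. c2 * (1 / real n) + L) \<longlonglongrightarrow> c2 * 0 + L"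
    by (intro tendsto_intros lim_1_over_n)+
  then show "(\<lambda>n. L - c1 * (1 / real n)) \<longlonglongrightarrow> L" "(\<lambda>n. c2 * (1 / real n) + L) \<longlonglongrightarrow> L" by simp_all
  show "eventually (\<lambda>n. L - c1 * (1 / real n) \<le> 1 / real n * a n) sequentially"
    using eventually_gt_at_top[of 0]
  proof eventually_elim
    case (elim n)
    then have "1 / real n * (real n * L - c1) \<le> 1 / real n * a n" using assms(1) by (intro mult_left_mono) auto
    then show ?case using elim by (simp add: algebra_simps)
  qed
  show "eventually (\<lambda>n. 1 / real n * a n \<le> c2 * (1 / real n) + L) sequentially"
    using eventually_gt_at_top[of 0]
  proof eventually_elim
    case (elim n)
    then have "1 / real n * a n \<le> 1 / real n * (c2 + real n * L)" using assms(2) by (intro mult_left_mono) auto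
    then show ?case using elim by (simp add: algebra_simps)
  qed
qed

text \<open>For \<open>\<epsilon> \<le> \<delta>\<close> the size of separated sets matches
  \<open>Lam \<omega> n\<close> up to factors independent of \<open>n\<close> and
  \<open>\<omega>\<close>. The growth rate is therefore a genuine limit, the same for all these
  \<open>\<epsilon>\<close>, and the limit at 0 is that of an eventually constant function.\<close>

lemma rel_top_entropy_eq: "rel_top_entropy P T = ereal (\<integral>\<omega>. ln (lam \<omega>) \<partial>P)"
proof -
  let ?\<Lambda> = "\<integral>\<omega>. ln (lam \<omega>) \<partial>P"
  let ?g = "\<lambda>\<epsilon>. limsup (\<lambda>n. ereal (1 / real n * (\<integral>\<omega>. ln (real (max_separated T \<omega> n \<epsilon>)) \<partial>P)))"
  have eq: "?g \<epsilon> = ereal ?\<Lambda>" if \<epsilon>: "0 < \<epsilon>" "\<epsilon> \<le> \<delta>" for \<epsilon>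
  proof -
    obtain F :: "'a set" where F: "finite F" "\<And>x::'a. \<exists>w\<in>F. dist x w < min (\<epsilon> / 2) \<delta>"
      by (rule finite_net[of "min (\<epsilon> / 2) \<delta>"]) (use \<epsilon> in auto)
    note b = max_separated_bounds[OF _ F _ \<epsilon>(2)]
    let ?s = "\<lambda>n \<omega>. ln (real (max_separated T \<omega> n \<epsilon>))"
    have m: "?s n \<in> borel_measurable P" for n
    proof (rule finite_coordinates_const)
      fix \<omega> \<omega>' :: "int \<Rightarrow> nat" assume "\<And>i. i < n \<Longrightarrow> \<omega> (int i) = \<omega>' (int i)"
      then have "max_separated T \<omega> n \<epsilon> = max_separated T \<omega>' n \<epsilon>" by (rule max_separated_cong)
      then show "?s n \<omega> = ?s n \<omega>'" by simp
    qed
    have iF: "integrable P (\<lambda>\<omega>. ln (real (card F) * K) + ln (Lam \<omega> n))" for n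
      by (intro Bochner_Integration.integrable_add P.integrable_const ln_Lam_integrable)
    have int: "integrable P (?s n)" if "0 < n" for n
    proof (rule Bochner_Integration.integrable_bound[OF iF[of n] m], rule AE_I2)
      fix \<omega> assume "\<omega> \<in> space P"
      then have "\<omega> \<in> \<Sigma>" by (simp add: space_P)
      from b(2,3)[OF this that] show "norm (?s n \<omega>) \<le> norm (ln (real (card F) * K) + ln (Lam \<omega> n))" by simp
    qed
    have "(\<lambda>n. 1 / real n * (\<integral>\<omega>. ?s n \<omega> \<partial>P)) \<longlonglongrightarrow> ?\<Lambda>"
    proof (rule average_squeeze)
      fix n :: nat assume n: "0 < n"
      have "(\<integral>\<omega>. ln (Lam \<omega> n) - ln K \<partial>P) \<le> (\<integral>\<omega>. ?s n \<omega> \<partial>P)"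
        by (intro integral_mono int[OF n] Bochner_Integration.integrable_diff ln_Lam_integrable P.integrable_const b(1) n)
          (simp add: space_P)
      then show "real n * ?\<Lambda> - ln K \<le> (\<integral>\<omega>. ?s n \<omega> \<partial>P)"
        using ln_Lam_integrable[of n] by (simp add: ln_Lam_integral P.prob_space)
      have "(\<integral>\<omega>. ?s n \<omega> \<partial>P) \<le> (\<integral>\<omega>. ln (real (card F) * K) + ln (Lam \<omega> n) \<partial>P)"
        by (intro integral_mono int[OF n] iF b(3) n) (simp add: space_P)
      then show "(\<integral>\<omega>. ?s n \<omega> \<partial>P) \<le> ln (real (card F) * K) + real n * ?\<Lambda>"
        using ln_Lam_integrable[of n] by (simp add: ln_Lam_integral P.prob_space)
    qed
    then have "(\<lambda>n. ereal (1 / real n * (\<integral>\<omega>. ?s n \<omega> \<partial>P))) \<longlonglongrightarrow> ereal ?\<Lambda>" by simp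
    then show ?thesis by (intro lim_imp_Limsup) auto
  qed
  have "eventually (\<lambda>\<epsilon>. ?g \<epsilon> = ereal ?\<Lambda>) (at_right 0)"
    using eventually_at_right_real[OF \<delta>] by eventually_elim (use eq in auto)
  then have "(?g \<longlongrightarrow> ereal ?\<Lambda>) (at_right 0)" by (rule tendsto_eventually)
  then show ?thesis unfolding rel_top_entropy_def by (intro tendsto_Lim) auto
qed

section \<open>Upper bound for an arbitrary invariant measure\<close>

lemma separated_compacts:
  fixes KK :: "'a set \<Rightarrow> 'a set"
  assumes \<xi>: "finite_partition \<xi>" and cl: "\<And>A. A \<in> \<xi> \<Longrightarrow> closed (KK A)" and sub: "\<And>A. A \<in> \<xi> \<Longrightarrow> KK A \<subseteq> A"
  obtains r where "0 < r" "\<And>A B x y. A \<in> \<xi> \<Longrightarrow> B \<in> \<xi> \<Longrightarrow> A \<noteq> B \<Longrightarrow> x \<in> KK A \<Longrightarrow> y \<in> KK B \<Longrightarrow> 2 * r \<le> dist x y"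
proof -
  have fin: "finite \<xi>" and disj: "disjoint \<xi>" using \<xi> by (auto simp: finite_partition_def partition_on_def)
  have pair: "\<exists>d>0. \<forall>x\<in>KK A. \<forall>y\<in>KK B. d \<le> dist x y" if A: "A \<in> \<xi>" "B \<in> \<xi>" "A \<noteq> B" for A B
  proof -
    have c: "compact (KK A)" using compact_Int_closed[OF comp cl[OF A(1)]] by simp
    have dj: "KK A \<inter> KK B = {}" using A sub disj unfolding disjoint_def by blast
    show ?thesis
    proof (cases "KK A = {} \<or> KK B = {}")
      case True
      then show ?thesis by (intro exI[of _ 1]) auto
    next
      case False
      have "continuous_on (KK A) (\<lambda>x. infdist x (KK B))" by (intro continuous_on_infdist continuous_on_id)
      then obtain x0 where x0: "x0 \<in> KK A" "\<And>x. x \<in> KK A \<Longrightarrow> infdist x0 (KK B) \<le> infdist x (KK B)"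
        using continuous_attains_inf[OF c] False by blast
      have "x0 \<notin> KK B" using x0(1) dj by blast
      then have "infdist x0 (KK B) \<noteq> 0" using in_closed_iff_infdist_zero[OF cl[OF A(2)]] False by blast
      then have "0 < infdist x0 (KK B)" using infdist_nonneg[of x0 "KK B"] by linarith
      moreover have "infdist x0 (KK B) \<le> dist x y" if "x \<in> KK A" "y \<in> KK B" for x y
        using x0(2)[OF that(1)] infdist_le[OF that(2), of x] by linarith
      ultimately show ?thesis by blast
    qed
  qed
  \<comment> \<open>Any smaller \<open>r\<close> serves a pair as well, so the filter at 0 from the
    right yields one \<open>r\<close> for the finitely many pairs.\<close>
  have ev: "eventually (\<lambda>r. A \<noteq> B \<longrightarrow> (\<forall>x\<in>KK A. \<forall>y\<in>KK B. 2 * r \<le> dist x y)) (at_right 0)"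
    if A: "A \<in> \<xi>" "B \<in> \<xi>" for A B
  proof (cases "A = B")
    case False
    obtain d where d: "d > 0" "\<And>x y. x \<in> KK A \<Longrightarrow> y \<in> KK B \<Longrightarrow> d \<le> dist x y" using pair[OF A False] by blast
    have "eventually (\<lambda>r. r \<in> {0<..<d / 2}) (at_right 0)"
      using d(1) by (intro eventually_at_right_real) auto
    then show ?thesis
    proof eventually_elim
      case (elim r)
      show ?case
      proof (intro impI ballI)
        fix x y assume "x \<in> KK A" "y \<in> KK B"
        from d(2)[OF this] elim show "2 * r \<le> dist x y" by simp
      qed
    qed
  qed simp
  have "eventually (\<lambda>r. \<forall>A\<in>\<xi>. \<forall>B\<in>\<xi>. A \<noteq> B \<longrightarrow> (\<forall>x\<in>KK A. \<forall>y\<in>KK B. 2 * r \<le> dist x y)) (at_right 0)"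
    using fin ev by (auto intro!: eventually_ball_finite)
  moreover have "eventually (\<lambda>r::real. 0 < r) (at_right 0)" by (rule eventually_at_right_less)
  ultimately have "eventually (\<lambda>r. 0 < r \<and> (\<forall>A\<in>\<xi>. \<forall>B\<in>\<xi>. A \<noteq> B \<longrightarrow> (\<forall>x\<in>KK A. \<forall>y\<in>KK B. 2 * r \<le> dist x y))) (at_right 0)"
    by eventually_elim simp
  from eventually_happens'[OF trivial_limit_at_right_real this]
  obtain r where r: "0 < r" and s: "\<forall>A\<in>\<xi>. \<forall>B\<in>\<xi>. A \<noteq> B \<longrightarrow> (\<forall>x\<in>KK A. \<forall>y\<in>KK B. 2 * r \<le> dist x y)"
    by (elim exE conjE)
  show thesis
  proof (rule that[OF r])
    show "2 * r \<le> dist x y" if "A \<in> \<xi>" "B \<in> \<xi>" "A \<noteq> B" "x \<in> KK A" "y \<in> KK B" for A B x y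
      using s[rule_format, OF that] .
  qed
qed

text \<open>Inner regularity with tolerance \<open>e / card \<xi>\<close> in each cell; a point
  outside all cores lies in its own cell minus the core of that cell.\<close>

lemma inner_closed_partition:
  fixes \<mu> :: "'a measure"
  assumes \<mu>: "finite_measure \<mu>" "sets \<mu> = sets borel" and \<xi>: "finite_partition \<xi>" and e: "0 < e"
  obtains KK where "\<And>A. A \<in> \<xi> \<Longrightarrow> closed (KK A)" "\<And>A. A \<in> \<xi> \<Longrightarrow> KK A \<subseteq> A" "measure \<mu> (- (\<Union>A\<in>\<xi>. KK A)) \<le> e"
proof -
  interpret finite_measure \<mu> by fact
  have \<xi>': "finite \<xi>" "\<xi> \<subseteq> sets borel" "\<Union>\<xi> = UNIV"
    using \<xi> by (auto simp: finite_partition_def partition_on_def)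
  have "\<xi> \<noteq> {}" using \<xi>'(3) by auto
  then have M: "0 < real (card \<xi>)" using \<xi>'(1) by (simp add: card_gt_0_iff)
  then have e': "0 < e / real (card \<xi>)" using e by simp
  have "\<forall>A\<in>\<xi>. \<exists>C. closed C \<and> C \<subseteq> A \<and> measure \<mu> (A - C) < e / real (card \<xi>)"
  proof
    fix A assume "A \<in> \<xi>"
    then have A: "A \<in> sets borel" using \<xi>'(2) by blast
    show "\<exists>C. closed C \<and> C \<subseteq> A \<and> measure \<mu> (A - C) < e / real (card \<xi>)"
      by (rule closed_inner_approx[OF comp \<mu> A e']) blast
  qed
  from bchoice[OF this] obtain KK where KK: "\<And>A. A \<in> \<xi> \<Longrightarrow> closed (KK A)" "\<And>A. A \<in> \<xi> \<Longrightarrow> KK A \<subseteq> A"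
    "\<And>A. A \<in> \<xi> \<Longrightarrow> measure \<mu> (A - KK A) < e / real (card \<xi>)" by blast
  have s: "A - KK A \<in> sets \<mu>" if "A \<in> \<xi>" for A
    using KK(1)[OF that] \<xi>'(2) that \<mu>(2) by auto
  have "- (\<Union>A\<in>\<xi>. KK A) \<subseteq> (\<Union>A\<in>\<xi>. A - KK A)"
  proof
    fix x assume x: "x \<in> - (\<Union>A\<in>\<xi>. KK A)"
    obtain A where "A \<in> \<xi>" "x \<in> A" using \<xi>'(3) by blast
    with x show "x \<in> (\<Union>A\<in>\<xi>. A - KK A)" by blast
  qed
  then have "measure \<mu> (- (\<Union>A\<in>\<xi>. KK A)) \<le> measure \<mu> (\<Union>A\<in>\<xi>. A - KK A)"
    using s \<xi>'(1) by (intro finite_measure_mono sets.finite_UN) auto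
  also have "\<dots> \<le> (\<Sum>A\<in>\<xi>. measure \<mu> (A - KK A))"
    using s \<xi>'(1) by (intro measure_UNION_le) auto
  also have "\<dots> \<le> (\<Sum>A\<in>\<xi>. e / real (card \<xi>))"
    by (intro sum_mono less_imp_le KK(3))
  also have "\<dots> = e" using M by simp
  finally show thesis using KK(1,2) by (intro that[of KK])
qed

text \<open>The slack \<open>e\<close> is shared equally between the cost of correct guesses and the
  cost of visits to \<open>U\<close>. All other terms are independent of \<open>n\<close> or are
  \<open>ln (Lam \<omega> n)\<close>, whose integral is \<open>n\<close> times the claimed
  bound.\<close>

lemma rel_entropy_partition_le:
  assumes m: "inv_meas m" and \<xi>: "finite_partition \<xi>"
  shows "rel_entropy_partition P T m \<xi> \<le> (\<integral>\<omega>. ln (lam \<omega>) \<partial>P)"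
proof (rule field_le_epsilon)
  let ?\<Lambda> = "\<integral>\<omega>. ln (lam \<omega>) \<partial>P"
  fix e :: real assume e: "0 < e"
  define \<kappa> where "\<kappa> = disintegration P m"
  have d: "is_disintegration P m \<kappa>" unfolding \<kappa>_def by (rule disintegration_inv_meas[OF m])
  then have \<kappa>: "\<kappa> \<in> measurable P (prob_algebra borel)"
    and em: "\<And>A. A \<in> sets m \<Longrightarrow> emeasure m A = (\<integral>\<^sup>+\<omega>. emeasure (\<kappa> \<omega>) {x. (\<omega>, x) \<in> A} \<partial>P)"
    by (auto simp: is_disintegration_def)
  have sm: "sets m = sets (P \<Otimes>\<^sub>M borel)" and pm: "prob_space m" using m by (auto simp: inv_meas_def)
  interpret m: prob_space m by (rule pm)
  have spm: "space m = \<Sigma> \<times> UNIV"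
    using sets_eq_imp_space_eq[OF sm] by (simp add: space_pair_measure space_P)
  have snd: "snd \<in> measurable m borel" using sm by (simp cong: measurable_cong_sets)
  \<comment> \<open>The marginal of \<open>m\<close> on the fibre coordinate. By equivariance and
    invariance of \<open>P\<close>, at each time the probability of being in \<open>U\<close> is
    \<open>measure \<mu> U\<close>, so one measure controls all times at once.\<close>
  define \<mu> where "\<mu> = distr m borel snd"
  have \<mu>: "finite_measure \<mu>" "sets \<mu> = sets borel"
    unfolding \<mu>_def using m.prob_space_distr[OF snd] by (auto simp: prob_space_def)
  have \<mu>_int: "(\<integral>\<omega>. measure (\<kappa> \<omega>) U \<partial>P) = measure \<mu> U" if U: "U \<in> sets borel" for U
  proof -
    have R: "\<Sigma> \<times> U \<in> sets m" using U sm pair_measureI[of \<Sigma> P U borel] sets.top[of P] by (simp add: space_P)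
    have i: "integrable P (\<lambda>\<omega>. measure (\<kappa> \<omega>) U)"
      using kernel_measure_measurable(1)[OF \<kappa> U] kernel_facts[OF \<kappa>]
      by (intro P.integrable_const_bound[where B=1]) (auto simp: space_P intro!: prob_space.prob_le_1)
    have "ennreal (measure \<mu> U) = emeasure m (snd -` U \<inter> space m)"
      using finite_measure.emeasure_eq_measure[OF \<mu>(1)] emeasure_distr[OF snd U] by (simp add: \<mu>_def)
    also have "snd -` U \<inter> space m = \<Sigma> \<times> U" by (auto simp: spm)
    also have "emeasure m (\<Sigma> \<times> U) = (\<integral>\<^sup>+\<omega>. emeasure (\<kappa> \<omega>) {x. (\<omega>, x) \<in> \<Sigma> \<times> U} \<partial>P)" by (rule em[OF R])
    also have "\<dots> = (\<integral>\<^sup>+\<omega>. ennreal (measure (\<kappa> \<omega>) U) \<partial>P)"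
      using kernel_facts(1)[OF \<kappa>]
      by (intro nn_integral_cong) (simp add: space_P finite_measure.emeasure_eq_measure prob_space_def)
    also have "\<dots> = ennreal (\<integral>\<omega>. measure (\<kappa> \<omega>) U \<partial>P)" by (rule nn_integral_eq_integral[OF i]) simp
    finally show ?thesis by (simp add: ennreal_inj Bochner_Integration.integral_nonneg)
  qed
  \<comment> \<open>Makes the cost of a correct guess, \<open>- ln (1 - \<eta>)\<close>, equal to
    \<open>e / 2\<close> per step.\<close>
  define \<eta> where "\<eta> = 1 - exp (- e / 2)"
  have \<eta>: "0 < \<eta>" "\<eta> < 1" "- ln (1 - \<eta>) = e / 2" using e by (auto simp: \<eta>_def)
  define \<beta> where "\<beta> = - ln (\<eta> / real (card \<xi>))"
  have "\<xi> \<noteq> {}" "finite \<xi>" using \<xi> by (auto simp: finite_partition_def partition_on_def)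
  then have "1 \<le> real (card \<xi>)" by (simp add: Suc_le_eq card_gt_0_iff)
  then have \<beta>: "0 \<le> \<beta>" unfolding \<beta>_def using \<eta> by simp
  \<comment> \<open>The cores depend on \<open>\<beta>\<close>, the price of an error, so that
    visits to \<open>U\<close> cost at most \<open>e / 2\<close> per step on average. The
    denominator \<open>\<beta> + 1\<close> is positive given just
    \<open>0 \<le> \<beta>\<close>.\<close>
  obtain KK where KK: "\<And>A. A \<in> \<xi> \<Longrightarrow> closed (KK A)" "\<And>A. A \<in> \<xi> \<Longrightarrow> KK A \<subseteq> A"
    "measure \<mu> (- (\<Union>A\<in>\<xi>. KK A)) \<le> e / 2 / (\<beta> + 1)"
    by (rule inner_closed_partition[OF \<mu> \<xi>, of "e / 2 / (\<beta> + 1)"]) (use e \<beta> in auto)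
  define U where "U = - (\<Union>A\<in>\<xi>. KK A)"
  have "closed (\<Union>A\<in>\<xi>. KK A)" using KK(1) \<open>finite \<xi>\<close> by (intro closed_UN) auto
  then have U: "U \<in> sets borel" unfolding U_def by (intro borel_open) (simp add: open_closed)
  have \<beta>U: "\<beta> * measure \<mu> U \<le> e / 2"
  proof -
    have "\<beta> * measure \<mu> U \<le> (\<beta> + 1) * (e / 2 / (\<beta> + 1))"
      using \<beta> KK(3) by (intro mult_mono) (auto simp: U_def)
    also have "\<dots> = e / 2" 
    proof -
      have "\<beta> + 1 \<noteq> 0" using \<beta> by simp
      then show ?thesis by (metis nonzero_mult_div_cancel_left times_divide_eq_right)
    qed
    finally show ?thesis .
  qed
  obtain r where r: "0 < r" "\<And>A B x y. A \<in> \<xi> \<Longrightarrow> B \<in> \<xi> \<Longrightarrow> A \<noteq> B \<Longrightarrow> x \<in> KK A \<Longrightarrow> y \<in> KK B \<Longrightarrow> 2 * r \<le> dist x y"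
    by (rule separated_compacts[OF \<xi>, of KK], erule KK(1), erule KK(2)) (rule that)
  obtain F :: "'a set" where F: "finite F" "\<And>x::'a. \<exists>w\<in>F. dist x w < min r \<delta>"
    by (rule finite_net[of "min r \<delta>"]) (use r \<delta> in auto)
  \<comment> \<open>The net depends on \<open>r\<close>, hence on the cores and on \<open>e\<close>,
    but not on \<open>n\<close>; the constant \<open>C\<close> disappears after division by
    \<open>n\<close>.\<close>
  define C where "C = ln (real (card F) * K)"
  have bound: "mean_entropy m \<xi> n \<le> C + real n * (?\<Lambda> + e)" for n
  proof -
    have "AE \<omega> in P. \<forall>k\<in>{..<n}. measure (\<kappa> (shift_pow (int k) \<omega>)) U = measure (\<kappa> \<omega>) (fiber_iter T \<omega> k -` U)"
      using disintegration_equivariant[OF m d U] by (intro AE_finite_allI) auto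
    then have AE: "AE \<omega> in P. partition_entropy (\<kappa> \<omega>) (fiber_join T \<xi> \<omega> n) \<le>
      C + ln (Lam \<omega> n) + real n * (e / 2) + \<beta> * (\<Sum>k<n. measure (\<kappa> (shift_pow (int k) \<omega>)) U)"
    proof (rule AE_mp, intro AE_I2 impI)
      fix \<omega> assume "\<omega> \<in> space P" and eq: "\<forall>k\<in>{..<n}. measure (\<kappa> (shift_pow (int k) \<omega>)) U = measure (\<kappa> \<omega>) (fiber_iter T \<omega> k -` U)"
      then have \<omega>: "\<omega> \<in> \<Sigma>" by (simp add: space_P)
      have pw: "partition_entropy (\<kappa> \<omega>) (fiber_join T \<xi> \<omega> n) \<le>
          ln (real (card F) * K) + ln (Lam \<omega> n) + real n * (- ln (1 - \<eta>))
            + (- ln (\<eta> / real (card \<xi>))) * (\<Sum>k<n. measure (\<kappa> \<omega>) (fiber_iter T \<omega> k -` U))"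
      proof (rule entropy_upper_pointwise[OF \<omega> kernel_facts(1,2)[OF \<kappa> \<omega>] \<xi> _ _ F \<eta>(1,2) U_def U])
        show "KK A \<subseteq> A" if "A \<in> \<xi>" for A by (rule KK(2)[OF that])
        show "2 * r \<le> dist x y" if "A \<in> \<xi>" "B \<in> \<xi>" "A \<noteq> B" "x \<in> KK A" "y \<in> KK B" for A B x y
          by (rule r(2)[OF that])
      qed
      have "(\<Sum>k<n. measure (\<kappa> (shift_pow (int k) \<omega>)) U) = (\<Sum>k<n. measure (\<kappa> \<omega>) (fiber_iter T \<omega> k -` U))"
        using eq by (intro sum.cong) auto
      then show "partition_entropy (\<kappa> \<omega>) (fiber_join T \<xi> \<omega> n) \<le>
          C + ln (Lam \<omega> n) + real n * (e / 2) + \<beta> * (\<Sum>k<n. measure (\<kappa> (shift_pow (int k) \<omega>)) U)"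
        using pw unfolding C_def \<beta>_def \<eta>(3) by simp
    qed
    have mU: "(\<lambda>\<omega>. measure (\<kappa> \<omega>) U) \<in> borel_measurable P" by (rule kernel_measure_measurable(1)[OF \<kappa> U])
    have iU: "integrable P (\<lambda>\<omega>. measure (\<kappa> (shift_pow (int k) \<omega>)) U)" for k
      using measurable_compose[OF shift_pow_measurable mU, of "int k"] kernel_facts(1)[OF \<kappa>]
      by (intro P.integrable_const_bound[where B=1]) (auto simp: space_P intro!: prob_space.prob_le_1)
    have iS: "integrable P (\<lambda>\<omega>. \<Sum>k<n. measure (\<kappa> (shift_pow (int k) \<omega>)) U)"
      by (rule Bochner_Integration.integrable_sum) (rule iU)
    have "(\<integral>\<omega>. (\<Sum>k<n. measure (\<kappa> (shift_pow (int k) \<omega>)) U) \<partial>P) = real n * measure \<mu> U"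
      using iU by (subst Bochner_Integration.integral_sum) (auto simp: integral_shift_pow[OF mU] \<mu>_int[OF U])
    moreover have "mean_entropy m \<xi> n \<le> (\<integral>\<omega>. C + ln (Lam \<omega> n) + real n * (e / 2) + \<beta> * (\<Sum>k<n. measure (\<kappa> (shift_pow (int k) \<omega>)) U) \<partial>P)"
      unfolding mean_entropy_def \<kappa>_def[symmetric]
      by (rule integral_mono_AE[OF partition_entropy_integrable[OF \<kappa> \<xi>] _ AE])
        (intro Bochner_Integration.integrable_add integrable_mult_right iS ln_Lam_integrable P.integrable_const)
    ultimately have "mean_entropy m \<xi> n \<le> C + real n * ?\<Lambda> + real n * (e / 2) + \<beta> * (real n * measure \<mu> U)"
      using iS ln_Lam_integrable[of n] by (simp add: ln_Lam_integral P.prob_space)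
    also have "\<beta> * (real n * measure \<mu> U) \<le> real n * (e / 2)"
      using mult_left_mono[OF \<beta>U, of "real n"] by (simp add: mult_ac)
    finally show ?thesis by (simp add: algebra_simps)
  qed
  show "rel_entropy_partition P T m \<xi> \<le> ?\<Lambda> + e"
  proof (rule tendsto_le[OF _ _ rel_entropy_partition_tendsto[OF m \<xi>]])
    have "(\<lambda>n. C * (1 / real n) + (?\<Lambda> + e)) \<longlonglongrightarrow> C * 0 + (?\<Lambda> + e)"
      by (intro tendsto_intros lim_1_over_n)
    then show "(\<lambda>n. C * (1 / real n) + (?\<Lambda> + e)) \<longlonglongrightarrow> ?\<Lambda> + e" by simp
    show "eventually (\<lambda>n. 1 / real n * mean_entropy m \<xi> n \<le> C * (1 / real n) + (?\<Lambda> + e)) sequentially"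
      using eventually_gt_at_top[of 0]
    proof eventually_elim
      case (elim n)
      then have "1 / real n * mean_entropy m \<xi> n \<le> 1 / real n * (C + real n * (?\<Lambda> + e))" by (intro mult_left_mono bound) auto
      then show ?case using elim by (simp add: distrib_left)
    qed
  qed simp
qed

section \<open>Equality of the three quantities\<close>

lemma variational_principle:
  "rel_top_entropy P T = ereal (\<integral>\<omega>. ln (eigenvalue T \<omega>) \<partial>P)
    \<and> ereal (\<integral>\<omega>. ln (eigenvalue T \<omega>) \<partial>P) =
        (SUP m\<in>{m \<in> invariant_measures l T. distr m P fst = P}. rel_entropy P T m)"
proof
  show "rel_top_entropy P T = ereal (\<integral>\<omega>. ln (eigenvalue T \<omega>) \<partial>P)"
    by (simp only: rel_top_entropy_eq eigenvalue_integral)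
  obtain m where m: "inv_meas m" "is_disintegration P m mu" by (rule mu_measure) (rule that)
  show "ereal (\<integral>\<omega>. ln (eigenvalue T \<omega>) \<partial>P) =
      (SUP m\<in>{m \<in> invariant_measures l T. distr m P fst = P}. rel_entropy P T m)"
    unfolding eigenvalue_integral
  proof (rule antisym)
    show "ereal (\<integral>\<omega>. ln (lam \<omega>) \<partial>P) \<le> (SUP m\<in>{m \<in> invariant_measures l T. distr m P fst = P}. rel_entropy P T m)"
      by (rule SUP_upper2) (rule m(1)[unfolded inv_meas_iff], rule rel_entropy_mu_ge[OF m])
    show "(SUP m\<in>{m \<in> invariant_measures l T. distr m P fst = P}. rel_entropy P T m) \<le> ereal (\<integral>\<omega>. ln (lam \<omega>) \<partial>P)"
    proof (rule SUP_least)
      fix m assume "m \<in> {m \<in> invariant_measures l T. distr m P fst = P}"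
      then have "inv_meas m" by (simp only: inv_meas_iff)
      then show "rel_entropy P T m \<le> ereal (\<integral>\<omega>. ln (lam \<omega>) \<partial>P)"
        unfolding rel_entropy_def by (intro SUP_least) (simp add: rel_entropy_partition_le)
    qed
  qed
qed

end

theorem theoremA:
  fixes l :: nat
    and T :: "nat \<Rightarrow> 'a::metric_space \<Rightarrow> 'a"
    and P :: "(int \<Rightarrow> nat) measure"
  assumes "compact (UNIV :: 'a set)"
    and "\<And>i. i < l \<Longrightarrow> continuous_on UNIV (T i)"
    and "\<And>i. i < l \<Longrightarrow> surj (T i)"
    and "expanding_type l T"
    and "ergodic_shift_measure l P"
  shows "rel_top_entropy P T = ereal (\<integral>\<omega>. ln (eigenvalue T \<omega>) \<partial>P)
    \<and> ereal (\<integral>\<omega>. ln (eigenvalue T \<omega>) \<partial>P) =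
        (SUP m\<in>{m \<in> invariant_measures l T. distr m P fst = P}. rel_entropy P T m)"
proof -
  note et = assms(4)[unfolded expanding_type_def]
  obtain D :: nat where D: "\<forall>\<omega>\<in>full_shift l. \<forall>z. finite (T (\<omega> 0) -` {z}) \<and> card (T (\<omega> 0) -` {z}) \<le> D"
    using conjunct1[OF et] by (elim exE)
  obtain \<delta> \<rho> :: real where \<delta>: "0 < \<delta>" "0 < \<rho>" "\<rho> < 1"
    and ex: "\<forall>\<omega>\<in>full_shift l.
        (\<forall>x x'. dist x x' \<le> \<delta> \<longrightarrow> dist x x' \<le> \<rho> * dist (T (\<omega> 0) x) (T (\<omega> 0) x')) \<and>
        (\<forall>x. ball (T (\<omega> 0) x) \<delta> \<subseteq> T (\<omega> 0) ` ball x \<delta>)"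
    using conjunct1[OF conjunct2[OF et]] by (elim exE conjE)
  have "0 < \<delta> / 2" using \<delta>(1) by simp
  then obtain N where N: "\<forall>\<omega>\<in>full_shift l. \<forall>x. \<forall>n\<ge>N. fiber_iter T \<omega> n ` ball x (\<delta> / 2) = UNIV"
    using conjunct2[OF conjunct2[OF et]] by blast
  \<comment> \<open>Constant sequences turn conditions quantified over sequences into conditions on
    single symbols.\<close>
  have const: "(\<lambda>_. i) \<in> full_shift l" if "i < l" for i
    using that by (simp add: full_shift_def)
  \<comment> \<open>\<open>Suc N\<close> makes the covering time positive, so that division by it
    counts full contraction periods; covering persists from \<open>N\<close> on.\<close>
  interpret shift_expanding_ifs l T D "Suc N" \<delta> \<rho> P
  proof (intro shift_expanding_ifs.intro expanding_ifs.intro shift_expanding_ifs_axioms.intro)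
    show "compact (UNIV :: 'a set)" by fact
    show "0 < \<delta>" "0 < \<rho>" "\<rho> < 1" by fact+
    fix i assume i: "i < l"
    show "continuous_on UNIV (T i)" "surj (T i)" using assms(2,3) i by auto
    show "finite (T i -` {z})" "card (T i -` {z}) \<le> D" for z using D const[OF i] by auto
    show "dist x x' \<le> \<rho> * dist (T i x) (T i x')" if "dist x x' \<le> \<delta>" for x x'
      using bspec[OF ex const[OF i]] that by blast
    show "ball (T i x) \<delta> \<subseteq> T i ` ball x \<delta>" for x
      using bspec[OF ex const[OF i]] by blast
  next
    show "fiber_iter T \<omega> (Suc N) ` ball x (\<delta> / 2) = UNIV" if "\<omega> \<in> full_shift l" for \<omega> x
      using bspec[OF N that] by (simp only: le_Suc_eq le_refl simp_thms)
    show "sets P = sets (restrict_space borel (full_shift l))" "prob_space P" "distr P P shift = P"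
      using assms(5) by (simp_all add: ergodic_shift_measure_def)
  qed simp
  show ?thesis by (rule variational_principle)
qed

end
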